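(* For $n\ge1$ define $$M_1(n)=\max\Big\{\prod_{1\le i,j\le t}\gcd(a_i,a_j)\ :\ t\ge1,\ 0<a_1<a_2<\cdots<a_t \text{ integers},\ \prod_{i=1}^t a_i\le n\Big\},$$ $$M_2(n)=\max\Big\{\prod_{p,p'\in\mathcal P}\gcd(p-1,p'-1)\ :\ \mathcal P \text{ a set of distinct primes with } \prod_{p\in\mathcal P}p\le n\Big\}$$ (products over ordered pairs). With $\lambda(n)=\frac{(\log n)^2}{\log\log n}$, $$\liminf_{n\to\infty}\frac{\log M_1(n)}{\lambda(n)}=\limsup_{n\to\infty}\frac{\log M_2(n)}{\lambda(n)}=\frac14.$$ *)

theory Defs
  imports "HOL-Analysis.Analysis" "HOL-Computational_Algebra.Primes"
begin

text \<open>A strictly increasing tuple 0 < a_1 < ... < a_t (t \<ge> 1) of integers is the same as a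
  finite nonempty set of positive integers; products are over ordered pairs (i,j).\<close>
definition M1 :: "nat \<Rightarrow> nat" where
  "M1 n = Max {(\<Prod>a\<in>A. \<Prod>b\<in>A. gcd a b) | A :: nat set.
                 finite A \<and> A \<noteq> {} \<and> 0 \<notin> A \<and> \<Prod>A \<le> n}"

definition M2 :: "nat \<Rightarrow> nat" where
  "M2 n = Max {(\<Prod>p\<in>P. \<Prod>q\<in>P. gcd (p - 1) (q - 1)) | P :: nat set.
                 finite P \<and> (\<forall>p\<in>P. prime p) \<and> \<Prod>P \<le> n}"

definition lam :: "nat \<Rightarrow> real" where
  "lam n = (ln (real n))^2 / ln (ln (real n))"

end

theory Submission
  imports Defs "HOL-Number_Theory.Number_Theory"
    "HOL-Computational_Algebra.Squarefree" "HOL-Library.Real_Mod" "HOL-Real_Asymp.Real_Asymp"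
begin

text \<open>
  Write \<open>L = ln n\<close>. For the upper bound let \<open>A\<close> have \<open>t\<close> elements and weigh \<open>a \<in> A\<close> by a product over
  primes \<open>p\<close> of normalised weights decaying geometrically in the distance of the \<open>p\<close>-adic valuation of \<open>a\<close> from a
  centre depending on \<open>p\<close>. The total weight is at most 1 by unique factorisation, so Jensen's inequality
  bounds \<open>ln t\<close> by a sum over \<open>p\<close> of mean distances from the centres, and this is at most
  \<open>(1 + o(1))\<close> times the mean of \<open>ln a - ln (gcd a b)\<close>. Hence
  \<open>\<Sum> ln (gcd a b) \<le> t L - (1 - o(1)) t\<^sup>2 ln t\<close>, which is at most \<open>(1/4 + o(1)) L\<^sup>2 / ln L\<close>.
  The set \<open>{m, 2 m, \<dots>, m\<^sup>2}\<close> with \<open>m\<close> close to \<open>L / (2 ln L)\<close> attains this for \<open>M1\<close>, and \<open>M2 \<le> M1\<close>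
  by passing from \<open>p\<close> to \<open>p - 1\<close>.

  For \<open>M2\<close> one needs infinitely many moduli \<open>m\<close> with at least \<open>m\<close> primes \<open>p \<le> m powr (2 + \<epsilon>)\<close>, \<open>p \<equiv> 1 (mod m)\<close>.
  They are found by averaging over prime moduli in the manner of the Bombieri-Vinogradov theorem: Vaughan's identity
  splits the von Mangoldt function into type I sums, which are equidistributed trivially, and bilinear sums, which are
  handled by the large sieve. As the moduli are prime, all characters
  that occur have large conductor, so that no information on small moduli (Siegel-Walfisz) is needed.
\<close>

section \<open>An upper bound for sums of logarithms of greatest common divisors\<close>

text \<open>The constant 1/4 has two sources. Above, it comes from maximising
  \<open>t * L - t^2 * ln L\<close>, with the peak at \<open>t = L / (2 * ln L)\<close>. There
  \<open>ln t\<close> and \<open>ln L\<close> agree asymptotically, so a loss of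
  \<open>C * t^2\<close> is harmless, provided that \<open>C\<close> does not depend on
  \<open>A\<close>. The natural decay rate 1 would cost about \<open>2 / p\<close> for normalising
  at each prime, which has a divergent sum. This obstacle forces the distinction between primes at
  which one valuation dominates, where a slightly larger rate is affordable, and primes at which the
  mean distance is so large that it pays for the normalisation itself. Below, \<open>t\<close>
  primes up to \<open>x\<close>, all congruent to 1 modulo \<open>m\<close>, have
  \<open>L <= t * ln x\<close> and give a ratio of at least \<open>ln m * ln t / (ln x)^2\<close>.
  If \<open>m = x^a\<close>, at most about \<open>x^(1-a)\<close> such primes exist, and
  \<open>a * (1 - a)\<close> reaches 1/4 only at \<open>a = 1/2\<close>. This is exactly the level
  of distribution that the large sieve yields on average over moduli. Because a limsup is claimed,
  one good modulus at each of infinitely many scales suffices, so an average is enough.\<close>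

lemma card_ln_card_le_sum_neg_ln:
  fixes g :: "'a \<Rightarrow> real"
  assumes "finite A" "\<And>a. a \<in> A \<Longrightarrow> g a > 0" "(\<Sum>a\<in>A. g a) \<le> 1"
  shows "real (card A) * ln (card A) \<le> (\<Sum>a\<in>A. - ln (g a))"
proof (cases "A = {}")
  case False
  define t where "t = real (card A)"
  have t: "t > 0" using False assms(1) by (simp add: t_def card_gt_0_iff)
  \<comment> \<open>Gibbs' inequality: \<open>g\<close> is compared with the uniform weight
    \<open>1 / t\<close> through \<open>ln z <= z - 1\<close>.\<close>
  have "(\<Sum>a\<in>A. ln t + ln (g a)) \<le> (\<Sum>a\<in>A. t * g a - 1)"
  proof (rule sum_mono)
    fix a assume "a \<in> A"
    then have "g a > 0" by (rule assms(2))
    then show "ln t + ln (g a) \<le> t * g a - 1"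
      using t ln_le_minus_one[of "t * g a"] by (simp add: ln_mult)
  qed
  also have "\<dots> = t * (\<Sum>a\<in>A. g a) - t"
    by (simp add: sum_subtractf sum_distrib_left t_def)
  also have "\<dots> \<le> 0" using assms(3) t by (simp add: mult_left_le)
  finally show ?thesis by (simp add: sum.distrib sum_negf t_def)
qed simp

lemma multiplicity_eq_imp_eq_nat:
  fixes a b :: nat
  assumes "a > 0" "b > 0" "prime_factors a \<subseteq> P" "prime_factors b \<subseteq> P"
    "\<And>p. p \<in> P \<Longrightarrow> multiplicity p a = multiplicity p b"
  shows "a = b"
proof (rule multiplicity_eq_nat)
  fix p :: nat assume p: "prime p"
  show "multiplicity p a = multiplicity p b"
  proof (cases "p \<in> P")
    case False
    then have "p \<notin> prime_factors a" "p \<notin> prime_factors b" using assms by auto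
    then show ?thesis using p assms by (simp add: prime_factors_multiplicity)
  qed (use assms in auto)
qed (use assms in auto)

text \<open>The vector of valuations determines \<open>a\<close>, so the left side is part of the
  expansion of the product of the one-prime sums, as in a truncated Euler product. \<open>N\<close>
  only has to dominate all valuations, to make the box of vectors finite.\<close>

lemma sum_prod_multiplicity_le_1:
  fixes A P :: "nat set" and u :: "nat \<Rightarrow> nat \<Rightarrow> real"
  assumes A: "finite A" "0 \<notin> A" and P: "finite P" "\<And>a. a \<in> A \<Longrightarrow> prime_factors a \<subseteq> P"
    and u: "\<And>p k. p \<in> P \<Longrightarrow> u p k \<ge> 0" "\<And>p N. p \<in> P \<Longrightarrow> (\<Sum>k\<le>N. u p k) \<le> 1"
  shows "(\<Sum>a\<in>A. \<Prod>p\<in>P. u p (multiplicity p a)) \<le> 1"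
proof -
  define f where "f = (\<lambda>a::nat. restrict (\<lambda>p. multiplicity p a) P)"
  define N where "N = (\<Sum>a\<in>A. \<Sum>p\<in>P. multiplicity p a)"
  have inj: "inj_on f A"
  proof (rule inj_onI)
    fix a b assume ab: "a \<in> A" "b \<in> A" "f a = f b"
    show "a = b"
    proof (rule multiplicity_eq_imp_eq_nat[of _ _ P])
      fix p assume "p \<in> P"
      then show "multiplicity p a = multiplicity p b"
        using fun_cong[OF ab(3), of p] by (simp add: f_def)
    qed (use ab A P in \<open>auto intro!: Nat.gr0I\<close>)
  qed
  have sub: "f ` A \<subseteq> PiE P (\<lambda>_. {..N})"
  proof (rule image_subsetI)
    fix a assume a: "a \<in> A"
    have "multiplicity p a \<le> N" if p: "p \<in> P" for p
    proof -
      have "multiplicity p a \<le> (\<Sum>p\<in>P. multiplicity p a)"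
        using P p by (intro member_le_sum) auto
      also have "\<dots> \<le> N" unfolding N_def
        using A a by (intro member_le_sum[of a A "\<lambda>a. \<Sum>p\<in>P. multiplicity p a"]) auto
      finally show ?thesis .
    qed
    then show "f a \<in> PiE P (\<lambda>_. {..N})" by (auto simp: f_def)
  qed
  have "(\<Sum>a\<in>A. \<Prod>p\<in>P. u p (multiplicity p a)) = (\<Sum>a\<in>A. \<Prod>p\<in>P. u p (f a p))"
    by (intro sum.cong prod.cong) (auto simp: f_def)
  also have "\<dots> = (\<Sum>\<phi>\<in>f ` A. \<Prod>p\<in>P. u p (\<phi> p))"
    by (simp add: sum.reindex[OF inj])
  also have "\<dots> \<le> (\<Sum>\<phi>\<in>PiE P (\<lambda>_. {..N}). \<Prod>p\<in>P. u p (\<phi> p))"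
    using sub P u by (intro sum_mono2 finite_PiE prod_nonneg) auto
  also have "\<dots> = (\<Prod>p\<in>P. \<Sum>k\<le>N. u p k)"
    using P by (subst prod_sum_PiE) auto
  also have "\<dots> \<le> 1" using u by (intro prod_le_1) (auto intro: sum_nonneg)
  finally show ?thesis .
qed

text \<open>The absolute difference within \<open>nat\<close>: truncated subtraction makes at least
  one summand vanish.\<close>

definition ndist :: "nat \<Rightarrow> nat \<Rightarrow> nat" where "ndist k x = (k - x) + (x - k)"

lemma sum_power_ndist_le:
  fixes r :: real
  assumes "0 < r" "r < 1"
  shows "(\<Sum>k\<le>N. r ^ ndist k x) \<le> (1 + r) / (1 - r)"
proof -
  have geo: "(\<Sum>j<M. r ^ j) \<le> 1 / (1 - r)" for M
    using assms by (simp add: sum_gp_strict divide_simps)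
  have "(\<Sum>k\<le>N. r ^ ndist k x) \<le> (\<Sum>k<x+N+1. r ^ ndist k x)"
    using assms by (intro sum_mono2) auto
  also have "{..<x+N+1} = {..<x} \<union> {x..<x+N+1}" by auto
  also have "(\<Sum>k\<in>\<dots>. r ^ ndist k x) = (\<Sum>k<x. r ^ ndist k x) + (\<Sum>k\<in>{x..<x+N+1}. r ^ ndist k x)"
    by (rule sum.union_disjoint) auto
  also have "(\<Sum>k<x. r ^ ndist k x) = (\<Sum>k<x. r ^ ndist (x - Suc k) x)"
    by (rule sum.nat_diff_reindex[symmetric])
  also have "\<dots> = r * (\<Sum>k<x. r ^ k)"
    unfolding sum_distrib_left by (intro sum.cong) (auto simp: ndist_def simp flip: power_Suc)
  also have "(\<Sum>k\<in>{x..<x+N+1}. r ^ ndist k x) = (\<Sum>k<N+1. r ^ k)"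
    by (rule sum.reindex_bij_witness[of _ "\<lambda>k. k + x" "\<lambda>k. k - x"]) (auto simp: ndist_def)
  also have "r * (\<Sum>k<x. r ^ k) + (\<Sum>k<N+1. r ^ k) \<le> r * (1 / (1 - r)) + 1 / (1 - r)"
    by (intro add_mono mult_left_mono geo) (use assms in auto)
  also have "\<dots> = (1 + r) / (1 - r)" by (simp add: add_divide_distrib)
  finally show ?thesis .
qed

text \<open>The normaliser is the two-sided geometric series \<open>Z = (1 + r) / (1 - r)\<close>;
  bounding \<open>ln Z\<close> by \<open>Z - 1\<close> produces the cost
  \<open>2 * r / (1 - r)\<close>.\<close>

lemma ex_geometric_weight:
  fixes p c :: real
  assumes p: "p > 1" and c: "c > 0"
  defines "r \<equiv> p powr (- c)"
  shows "\<exists>u :: nat \<Rightarrow> real. (\<forall>k. u k > 0) \<and> (\<forall>N. (\<Sum>k\<le>N. u k) \<le> 1) \<and>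
           (\<forall>k. - ln (u k) \<le> c * ln p * ndist k x + 2 * r / (1 - r))"
proof -
  have r: "0 < r" "r < 1" using p c by (auto simp: r_def powr_less_one)
  have lnr: "ln r = - c * ln p" using p by (simp add: r_def ln_powr)
  define Z where "Z = (1 + r) / (1 - r)"
  have Z: "Z > 0" using r by (auto simp: Z_def)
  have "ln Z \<le> Z - 1" using Z by (rule ln_le_minus_one)
  also have "Z - 1 = 2 * r / (1 - r)" using r by (simp add: Z_def field_simps)
  finally have lnZ: "ln Z \<le> 2 * r / (1 - r)" .
  define u where "u = (\<lambda>k. r ^ ndist k x / Z)"
  show ?thesis
  proof (intro exI[of _ u] conjI allI)
    fix k
    show "u k > 0" using r Z by (simp add: u_def)
    have "- ln (u k) = c * ln p * ndist k x + ln Z"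
      using r Z by (simp add: u_def ln_div ln_realpow lnr)
    then show "- ln (u k) \<le> c * ln p * ndist k x + 2 * r / (1 - r)" using lnZ by simp
  next
    fix N
    have "(\<Sum>k\<le>N. u k) = (\<Sum>k\<le>N. r ^ ndist k x) / Z"
      by (simp add: u_def sum_divide_distrib)
    also have "\<dots> \<le> Z / Z"
      unfolding Z_def using Z by (intro divide_right_mono sum_power_ndist_le r) (auto simp: Z_def)
    also have "\<dots> = 1" using Z by simp
    finally show "(\<Sum>k\<le>N. u k) \<le> 1" .
  qed
qed

text \<open>Only pairs with a member at \<open>x\<close> are kept. They occur in both orders, which
  gives a factor 2 that plain averaging over centres does not give; pairs with both members at
  \<open>x\<close> contribute zero on either side.\<close>

lemma sum_ndist_atom:
  fixes v :: "'a \<Rightarrow> nat"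
  assumes "finite A"
  shows "2 * real (card {a\<in>A. v a = x}) * (\<Sum>a\<in>A. real (ndist (v a) x))
           \<le> (\<Sum>a\<in>A. \<Sum>b\<in>A. real (ndist (v a) (v b)))"
proof -
  have card: "(\<Sum>b\<in>A. of_bool (v b = x) :: real) = card {a\<in>A. v a = x}"
    using assms by (simp add: Int_def)
  have "(\<Sum>a\<in>A. \<Sum>b\<in>A. real (ndist (v a) (v b))) \<ge>
        (\<Sum>a\<in>A. \<Sum>b\<in>A. real (ndist (v a) x) * of_bool (v b = x) + of_bool (v a = x) * real (ndist (v b) x))"
    by (intro sum_mono) (auto simp: ndist_def)
  also have "(\<Sum>a\<in>A. \<Sum>b\<in>A. real (ndist (v a) x) * of_bool (v b = x) + of_bool (v a = x) * real (ndist (v b) x))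
     = (\<Sum>a\<in>A. real (ndist (v a) x)) * card {a\<in>A. v a = x} + card {a\<in>A. v a = x} * (\<Sum>a\<in>A. real (ndist (v a) x))"
    unfolding sum.distrib card[symmetric] by (simp only: sum_product)
  finally show ?thesis by (simp add: mult_ac)
qed

lemma ex_sum_ndist_le_average:
  fixes v :: "'a \<Rightarrow> nat"
  assumes "finite A" "A \<noteq> {}"
  shows "\<exists>x. card A * (\<Sum>a\<in>A. real (ndist (v a) x)) \<le> (\<Sum>a\<in>A. \<Sum>b\<in>A. real (ndist (v a) (v b)))"
proof (rule ccontr)
  assume *: "\<not> ?thesis"
  let ?W = "(\<Sum>a\<in>A. \<Sum>b\<in>A. real (ndist (v a) (v b)))"
  have "card A * ?W = (\<Sum>b\<in>A. ?W)" by simp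
  also have "\<dots> < (\<Sum>b\<in>A. card A * (\<Sum>a\<in>A. real (ndist (v a) (v b))))"
    using * assms by (intro sum_strict_mono) (auto simp: not_le)
  also have "\<dots> = card A * ?W"
    unfolding sum_distrib_left by (rule sum.swap)
  finally show False by simp
qed

lemma sum_ndist_ge_no_atom:
  fixes v :: "'a \<Rightarrow> nat" and \<delta> :: real
  assumes "finite A" and "\<And>x. real (card {a\<in>A. v a = x}) \<le> (1 - \<delta>) * card A"
  shows "\<delta> * real (card A) ^ 2 \<le> (\<Sum>a\<in>A. \<Sum>b\<in>A. real (ndist (v a) (v b)))"
proof -
  have "\<delta> * real (card A) ^ 2 = (\<Sum>a\<in>A. card A - (1 - \<delta>) * card A)"
    by (simp add: power2_eq_square algebra_simps)
  also have "\<dots> \<le> (\<Sum>a\<in>A. \<Sum>b\<in>A. real (ndist (v a) (v b)))"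
  proof (rule sum_mono)
    fix a assume "a \<in> A"
    have "card A - (1 - \<delta>) * card A \<le> real (card A) - card {b\<in>A. v b = v a}"
      using assms(2)[of "v a"] by simp
    also have "\<dots> = (\<Sum>b\<in>A. 1 - of_bool (v b = v a))"
      using assms(1) by (simp add: sum_subtractf Int_def)
    also have "\<dots> \<le> (\<Sum>b\<in>A. real (ndist (v a) (v b)))"
      by (intro sum_mono) (auto simp: ndist_def)
    finally show "card A - (1 - \<delta>) * card A \<le> (\<Sum>b\<in>A. real (ndist (v a) (v b)))" .
  qed
  finally show ?thesis .
qed

text \<open>If some value carries almost all of the mass, weights with decay rate \<open>1 + \<delta>\<close> centred there
  are used, so that the normalisation is summable over \<open>p\<close>. Otherwise the mean
  distance is bounded below and rate \<open>1/2\<close> suffices.\<close>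

lemma ex_weight_prime:
  fixes v :: "'a \<Rightarrow> nat" and p \<delta> :: real
  assumes A: "finite A" "A \<noteq> {}" and \<delta>: "0 < \<delta>" "\<delta> < 1" and p: "p \<ge> 2"
    and P0: "p > P0 \<Longrightarrow> 2 * p powr (- 1/2) / (1 - p powr (-1/2)) \<le> \<delta>^2 * ln p / 2"
  defines "W \<equiv> (\<Sum>a\<in>A. \<Sum>b\<in>A. real (ndist (v a) (v b)))"
  shows "\<exists>u :: nat \<Rightarrow> real. (\<forall>k. u k > 0) \<and> (\<forall>N. (\<Sum>k\<le>N. u k) \<le> 1) \<and>
           card A * (\<Sum>a\<in>A. - ln (u (v a))) \<le> (1 + \<delta>) / (1 - \<delta>) * (ln p * W / 2) +
             (card A)^2 * ((if p \<le> P0 then 5 else 0) + 4 * p powr (- 1 - \<delta>))"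
proof -
  define t where "t = real (card A)"
  have t: "t > 0" using A by (simp add: t_def card_gt_0_iff)
  have W0: "W \<ge> 0" by (simp add: W_def sum_nonneg)
  have lnp: "ln p > 0" using p by simp
  have step: "\<exists>u :: nat \<Rightarrow> real. (\<forall>k. u k > 0) \<and> (\<forall>N. (\<Sum>k\<le>N. u k) \<le> 1) \<and>
           t * (\<Sum>a\<in>A. - ln (u (v a))) \<le> c * ln p * (t * (\<Sum>a\<in>A. real (ndist (v a) x))) +
              t^2 * (2 * p powr (- c) / (1 - p powr (- c)))" if "c > 0" for c x
  proof -
    have "1 < p" using p by simp
    from ex_geometric_weight[OF this that, of x]
    obtain u :: "nat \<Rightarrow> real" where u: "\<forall>k. u k > 0" "\<forall>N. (\<Sum>k\<le>N. u k) \<le> 1"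
      "\<forall>k. - ln (u k) \<le> c * ln p * ndist k x + 2 * p powr (-c) / (1 - p powr (-c))"
      by blast
    have "(\<Sum>a\<in>A. - ln (u (v a))) \<le> (\<Sum>a\<in>A. c * ln p * ndist (v a) x + 2 * p powr (-c) / (1 - p powr (-c)))"
      by (intro sum_mono u(3)[rule_format])
    also have "\<dots> = c * ln p * (\<Sum>a\<in>A. real (ndist (v a) x)) + t * (2 * p powr (-c) / (1 - p powr (-c)))"
      by (simp add: sum.distrib sum_distrib_left t_def)
    finally have "t * (\<Sum>a\<in>A. - ln (u (v a))) \<le> t * \<dots>" using t by (intro mult_left_mono) auto
    then show ?thesis using u(1,2)
      by (intro exI[of _ u]) (simp add: algebra_simps power2_eq_square)
  qed
  show ?thesis
  proof (cases "\<exists>x. real (card {a\<in>A. v a = x}) > (1 - \<delta>) * t")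
    case True
    then obtain x where x: "real (card {a\<in>A. v a = x}) > (1 - \<delta>) * t" by blast
    define Wx where "Wx = (\<Sum>a\<in>A. real (ndist (v a) x))"
    have "2 * ((1 - \<delta>) * t) * Wx \<le> 2 * real (card {a\<in>A. v a = x}) * Wx"
      using x by (intro mult_right_mono) (auto simp: Wx_def sum_nonneg)
    also have "\<dots> \<le> W" unfolding Wx_def W_def by (rule sum_ndist_atom[OF A(1)])
    finally have "t * Wx \<le> W / 2 / (1 - \<delta>)" using \<delta> by (simp add: field_simps)
    then have 1: "(1 + \<delta>) * ln p * (t * Wx) \<le> (1 + \<delta>) * ln p * (W / 2 / (1 - \<delta>))"
      using lnp \<delta> by (intro mult_left_mono) auto
    define r where "r = p powr (- (1 + \<delta>))"
    have "r \<le> p powr (- 1)" using p \<delta> unfolding r_def by (intro powr_mono) auto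
    also have "\<dots> \<le> 1 / 2" using p by (simp add: powr_minus_divide)
    finally have r: "0 < r" "r \<le> 1/2" using p by (auto simp: r_def)
    have "2 * r \<le> 4 * r * (1 - r)" using r by (simp add: algebra_simps)
    then have 2: "2 * r / (1 - r) \<le> 4 * r" using r by (simp add: divide_simps)
    obtain u :: "nat \<Rightarrow> real" where u: "\<And>k. u k > 0" "\<And>N. (\<Sum>k\<le>N. u k) \<le> 1"
      "t * (\<Sum>a\<in>A. - ln (u (v a))) \<le> (1 + \<delta>) * ln p * (t * Wx) + t^2 * (2 * r / (1 - r))"
      using step[of "1 + \<delta>" x] \<delta> unfolding Wx_def r_def by auto
    have "t^2 * (2 * r / (1 - r)) \<le> t^2 * ((if p \<le> P0 then 5 else 0) + 4 * r)"
      using 2 r by (intro mult_left_mono) auto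
    then have "t * (\<Sum>a\<in>A. - ln (u (v a))) \<le> (1 + \<delta>) / (1 - \<delta>) * (ln p * W / 2) +
          t^2 * ((if p \<le> P0 then 5 else 0) + 4 * r)" using u(3) 1 by (simp add: field_simps)
    moreover have "r = p powr (- 1 - \<delta>)" by (simp add: r_def)
    ultimately show ?thesis using u(1,2) unfolding t_def by (intro exI[of _ u]) simp
  next
    case False
    \<comment> \<open>Without an atom the best centre only gives \<open>t * Wx <= W\<close>, about
      twice the bound available with an atom. The rate 1/2 makes up for this factor.\<close>
    obtain x where x: "t * (\<Sum>a\<in>A. real (ndist (v a) x)) \<le> W"
      using ex_sum_ndist_le_average[OF A, of v] unfolding t_def W_def by blast
    define Wx where "Wx = (\<Sum>a\<in>A. real (ndist (v a) x))"
    have Wge: "\<delta> * t^2 \<le> W" unfolding W_def t_def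
      by (rule sum_ndist_ge_no_atom) (use False A in \<open>auto simp: not_less t_def\<close>)
    define r where "r = p powr (- (1/2))"
    have r0: "0 < r" using p by (simp add: r_def)
    have "r * r = p powr (-1)" by (simp add: r_def flip: powr_add)
    then have "r * r \<le> 1 / 2" using p by (simp add: powr_minus_divide)
    \<comment> \<open>5/7 is a rational just above \<open>1 / sqrt 2\<close>, and
      \<open>2 * r / (1 - r)\<close> takes the value 5 there.\<close>
    then have r: "r \<le> 5/7" using abs_le_square_iff[of r "5/7"] r0 by (simp add: power2_eq_square)
    obtain u :: "nat \<Rightarrow> real" where u: "\<And>k. u k > 0" "\<And>N. (\<Sum>k\<le>N. u k) \<le> 1"
      "t * (\<Sum>a\<in>A. - ln (u (v a))) \<le> 1/2 * ln p * (t * Wx) + t^2 * (2 * r / (1 - r))"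
      using step[of "1/2" x] unfolding Wx_def r_def by auto
    have kap: "(1 + \<delta>) * (ln p * W / 2) \<le> (1 + \<delta>) / (1 - \<delta>) * (ln p * W / 2)"
      using \<delta> lnp W0 by (intro mult_right_mono) (auto simp: divide_simps)
    have kap': "(ln p * W / 2) \<le> (1 + \<delta>) * (ln p * W / 2)"
      using \<delta> lnp W0 by (simp add: algebra_simps)
    have 1: "1/2 * ln p * (t * Wx) \<le> ln p * W / 2"
      using x lnp by (simp add: Wx_def)
    have 2: "t^2 * (2 * r / (1 - r)) \<le> (if p \<le> P0 then t^2 * 5 else \<delta> * (ln p * W / 2))"
    proof (cases "p \<le> P0")
      case True
      have "2 * r / (1 - r) \<le> 5" using r by (simp add: divide_simps)
      then have "t^2 * (2 * r / (1 - r)) \<le> t^2 * 5" by (intro mult_left_mono) auto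
      then show ?thesis by (simp only: True if_True)
    next
      case False
      \<comment> \<open>At rate 1/2 the normalisation is not summable over \<open>p\<close>. For
        \<open>p > P0\<close> it is a small fraction of \<open>ln p\<close>, and by
        \<open>Wge\<close> it can be charged to the mean distance at relative cost \<delta>.\<close>
      have "t^2 * (2 * r / (1 - r)) \<le> t^2 * (\<delta>^2 * ln p / 2)"
        using P0 False unfolding r_def by (intro mult_left_mono) auto
      also have "\<dots> = \<delta> * (ln p * (\<delta> * t^2) / 2)" by (simp add: power2_eq_square)
      also have "\<dots> \<le> \<delta> * (ln p * W / 2)"
        using Wge lnp \<delta> by (intro mult_left_mono divide_right_mono) auto
      finally show ?thesis using False by simp
    qed
    have pos: "0 \<le> t^2 * (4 * p powr (-1 - \<delta>))" by simp
    have "t * (\<Sum>a\<in>A. - ln (u (v a))) \<le> ln p * W / 2 + t^2 * (2 * r / (1 - r))"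
      using u(3) 1 by linarith
    also have "\<dots> \<le> (1 + \<delta>) / (1 - \<delta>) * (ln p * W / 2) + (if p \<le> P0 then t^2 * 5 else 0)"
    proof -
      have "\<dots> \<le> ln p * W / 2 + (if p \<le> P0 then t^2 * 5 else \<delta> * (ln p * W / 2))" using 2 by linarith
      also have "\<dots> \<le> (1 + \<delta>) * (ln p * W / 2) + (if p \<le> P0 then t^2 * 5 else 0)"
        using kap' by (simp add: algebra_simps)
      finally show ?thesis using kap by linarith
    qed
    also have "\<dots> \<le> (1 + \<delta>) / (1 - \<delta>) * (ln p * W / 2) +
          t^2 * ((if p \<le> P0 then 5 else 0) + 4 * p powr (-1 - \<delta>))"
      unfolding distrib_left[of "t^2"] using pos by (auto split: if_splits)
    finally have "t * (\<Sum>a\<in>A. - ln (u (v a))) \<le> (1 + \<delta>) / (1 - \<delta>) * (ln p * W / 2) +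
          t^2 * ((if p \<le> P0 then 5 else 0) + 4 * p powr (-1 - \<delta>))" .
    then show ?thesis using u(1,2) unfolding t_def by (intro exI[of _ u]) simp
  qed
qed

lemma ln_eq_sum_multiplicity:
  fixes n :: nat
  assumes "n > 0" "finite P" "prime_factors n \<subseteq> P" "\<And>p. p \<in> P \<Longrightarrow> prime p"
  shows "ln (real n) = (\<Sum>p\<in>P. ln (real p) * multiplicity p n)"
proof -
  have "real n = (\<Prod>p\<in>prime_factors n. real p ^ multiplicity p n)"
    using assms(1) by (subst (1) prime_factorization_nat[of n]) simp_all
  also have "\<dots> = (\<Prod>p\<in>P. real p ^ multiplicity p n)"
    using assms by (intro prod.mono_neutral_left) (auto simp: prime_factors_multiplicity)
  also have "ln \<dots> = (\<Sum>p\<in>P. ln (real p ^ multiplicity p n))"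
    using assms by (intro ln_prod) (auto dest: prime_gt_0_nat)
  also have "\<dots> = (\<Sum>p\<in>P. ln (real p) * multiplicity p n)"
    using assms by (intro sum.cong refl) (auto simp: ln_realpow dest: prime_gt_0_nat)
  finally show ?thesis .
qed

text \<open>This is \<open>|i - j| = i + j - 2 * min i j\<close> for the valuations of
  \<open>a\<close> and \<open>b\<close>, summed with weights \<open>ln p\<close>. It explains why
  \<open>ln p * W / 2\<close> is the target at each single prime.\<close>

lemma sum_ln_gcd_eq:
  fixes A P :: "nat set"
  assumes A: "finite A" "0 \<notin> A" and P: "finite P" "\<And>p. p \<in> P \<Longrightarrow> prime p"
    "\<And>a. a \<in> A \<Longrightarrow> prime_factors a \<subseteq> P"
  shows "(\<Sum>p\<in>P. ln (real p) * (\<Sum>a\<in>A. \<Sum>b\<in>A. real (ndist (multiplicity p a) (multiplicity p b))) / 2) =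
         card A * (\<Sum>a\<in>A. ln (real a)) - (\<Sum>a\<in>A. \<Sum>b\<in>A. ln (real (gcd a b)))"
proof -
  have pos: "a > 0" if "a \<in> A" for a using that A by (auto intro: Nat.gr0I)
  have "(\<Sum>p\<in>P. ln (real p) * (\<Sum>a\<in>A. \<Sum>b\<in>A. real (ndist (multiplicity p a) (multiplicity p b))) / 2)
      = (\<Sum>a\<in>A. \<Sum>b\<in>A. \<Sum>p\<in>P. ln (real p) * real (ndist (multiplicity p a) (multiplicity p b)) / 2)"
    unfolding sum_distrib_left sum_divide_distrib
    by (rule trans[OF sum.swap], rule sum.cong[OF refl], rule sum.swap)
  also have "\<dots> = (\<Sum>a\<in>A. \<Sum>b\<in>A. ln (real a) / 2 + ln (real b) / 2 - ln (real (gcd a b)))"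
  proof (intro sum.cong refl)
    fix a b assume ab: "a \<in> A" "b \<in> A"
    have "prime_factors (gcd a b) \<subseteq> prime_factors a"
      using pos[OF ab(1)] by (intro dvd_prime_factors) auto
    then have sub: "prime_factors (gcd a b) \<subseteq> P" using P(3)[OF ab(1)] by blast
    have "(\<Sum>p\<in>P. ln (real p) * real (ndist (multiplicity p a) (multiplicity p b)) / 2)
       = (\<Sum>p\<in>P. ln (real p) * multiplicity p a / 2 + ln (real p) * multiplicity p b / 2
             - ln (real p) * multiplicity p (gcd a b))"
    proof (intro sum.cong refl)
      fix p assume p: "p \<in> P"
      have m: "multiplicity p (gcd a b) = min (multiplicity p a) (multiplicity p b)"
        using pos ab P(2)[OF p] by (intro multiplicity_gcd) auto
      have "real (ndist (multiplicity p a) (multiplicity p b)) =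
          real (multiplicity p a) + multiplicity p b - 2 * multiplicity p (gcd a b)"
        unfolding m ndist_def by (auto simp: min_def of_nat_diff)
      then show "ln (real p) * real (ndist (multiplicity p a) (multiplicity p b)) / 2 =
           ln (real p) * multiplicity p a / 2 + ln (real p) * multiplicity p b / 2
             - ln (real p) * multiplicity p (gcd a b)"
        by (simp only:) (simp add: field_simps)
    qed
    also have "\<dots> = ln (real a) / 2 + ln (real b) / 2 - ln (real (gcd a b))"
      using pos ab sub P
      by (simp add: ln_eq_sum_multiplicity[of _ P] sum.distrib sum_subtractf sum_divide_distrib)
    finally show "(\<Sum>p\<in>P. ln (real p) * real (ndist (multiplicity p a) (multiplicity p b)) / 2) =
        ln (real a) / 2 + ln (real b) / 2 - ln (real (gcd a b))" .
  qed
  also have "\<dots> = card A * (\<Sum>a\<in>A. ln (real a)) - (\<Sum>a\<in>A. \<Sum>b\<in>A. ln (real (gcd a b)))"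
    by (simp add: sum.distrib sum_subtractf flip: sum_distrib_left sum_divide_distrib)
  finally show ?thesis .
qed

text \<open>The normalisation costs are summed over all integers \<open>p\<close> rather than over
  the primes occurring in \<open>A\<close>, so \<open>C\<close> depends on \<delta> alone.\<close>

proposition sum_ln_gcd_le_aux:
  fixes \<delta> :: real
  assumes \<delta>: "0 < \<delta>" "\<delta> < 1"
  shows "\<exists>C\<ge>0. \<forall>A :: nat set. finite A \<longrightarrow> A \<noteq> {} \<longrightarrow> 0 \<notin> A \<longrightarrow>
     (card A)^2 * (ln (card A) - C) \<le> (1 + \<delta>) / (1 - \<delta>) *
       (card A * (\<Sum>a\<in>A. ln (real a)) - (\<Sum>a\<in>A. \<Sum>b\<in>A. ln (real (gcd a b))))"
proof -
  have "eventually (\<lambda>p::real. 2 * p powr (- 1/2) / (1 - p powr (-1/2)) \<le> \<delta>^2 * ln p / 2) at_top"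
    using \<delta> by real_asymp
  then obtain P0 where P0: "\<And>p. p > P0 \<Longrightarrow> 2 * p powr (- 1/2) / (1 - p powr (-1/2)) \<le> \<delta>^2 * ln p / 2"
    unfolding eventually_at_top_linorder by (meson less_imp_le)
  define e where "e = (\<lambda>p::nat. (if real p \<le> P0 then 5 else 0) + 4 * real p powr (- 1 - \<delta>))"
  have e0: "e p \<ge> 0" for p by (simp add: e_def)
  have "summable (\<lambda>p::nat. real p powr (- 1 - \<delta>))"
    using \<delta> by (subst summable_real_powr_iff) auto
  moreover have "summable (\<lambda>p::nat. if real p \<le> P0 then 5 else 0 :: real)"
  proof (rule summable_finite)
    show "finite {..nat \<lceil>P0\<rceil>}" by simp
  qed (auto, linarith)
  ultimately have "summable e" unfolding e_def by (intro summable_add summable_mult)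
  define C where "C = (\<Sum>p. e p)"
  show ?thesis
  proof (intro exI[of _ C] conjI allI impI)
    show "C \<ge> 0" unfolding C_def using \<open>summable e\<close> e0 by (intro suminf_nonneg)
    fix A :: "nat set" assume A: "finite A" "A \<noteq> {}" "0 \<notin> A"
    define P where "P = (\<Union>a\<in>A. prime_factors a)"
    have P: "finite P" "\<And>p. p \<in> P \<Longrightarrow> prime p" "\<And>a. a \<in> A \<Longrightarrow> prime_factors a \<subseteq> P"
      using A by (auto simp: P_def)
    define W where "W = (\<lambda>p. \<Sum>a\<in>A. \<Sum>b\<in>A. real (ndist (multiplicity p a) (multiplicity p b)))"
    let ?\<kappa> = "(1 + \<delta>) / (1 - \<delta>)"
    have "\<forall>p\<in>P. \<exists>u :: nat \<Rightarrow> real. (\<forall>k. u k > 0) \<and> (\<forall>N. (\<Sum>k\<le>N. u k) \<le> 1) \<and>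
           card A * (\<Sum>a\<in>A. - ln (u (multiplicity p a))) \<le> ?\<kappa> * (ln p * W p / 2) + (card A)^2 * e p"
      unfolding W_def e_def
    proof (intro ballI ex_weight_prime A \<delta>)
      fix p assume "p \<in> P"
      then have "p \<ge> 2" using P(2) prime_ge_2_nat by blast
      then show "real p \<ge> 2" by simp
    qed (rule P0)
    from bchoice[OF this] obtain u :: "nat \<Rightarrow> nat \<Rightarrow> real" where
      *: "\<forall>p\<in>P. (\<forall>k. u p k > 0) \<and> (\<forall>N. (\<Sum>k\<le>N. u p k) \<le> 1) \<and>
           card A * (\<Sum>a\<in>A. - ln (u p (multiplicity p a))) \<le> ?\<kappa> * (ln p * W p / 2) + (card A)^2 * e p" ..
    have u: "\<And>p k. p \<in> P \<Longrightarrow> u p k > 0" "\<And>p N. p \<in> P \<Longrightarrow> (\<Sum>k\<le>N. u p k) \<le> 1"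
       "\<And>p. p \<in> P \<Longrightarrow> card A * (\<Sum>a\<in>A. - ln (u p (multiplicity p a))) \<le> ?\<kappa> * (ln p * W p / 2) + (card A)^2 * e p"
      using * by blast+
    have "real (card A) * ln (card A) \<le> (\<Sum>a\<in>A. - ln (\<Prod>p\<in>P. u p (multiplicity p a)))"
    proof (rule card_ln_card_le_sum_neg_ln)
      show "(\<Sum>a\<in>A. \<Prod>p\<in>P. u p (multiplicity p a)) \<le> 1"
        using A P u(1,2) by (intro sum_prod_multiplicity_le_1) (auto intro: less_imp_le)
    qed (use A P u(1) in \<open>auto intro: prod_pos\<close>)
    also have "\<dots> = (\<Sum>a\<in>A. \<Sum>p\<in>P. - ln (u p (multiplicity p a)))"
      unfolding sum_negf
    proof (intro sum.cong arg_cong[of _ _ uminus] ln_prod refl P)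
      show "u p (multiplicity p a) \<noteq> 0" if "p \<in> P" for p a using u(1)[OF that, of "multiplicity p a"] by simp
    qed
    also have "\<dots> = (\<Sum>p\<in>P. \<Sum>a\<in>A. - ln (u p (multiplicity p a)))"
      by (rule sum.swap)
    finally have "card A * (card A * ln (card A)) \<le> card A * (\<Sum>p\<in>P. \<Sum>a\<in>A. - ln (u p (multiplicity p a)))"
      by (intro mult_left_mono) auto
    also have "\<dots> = (\<Sum>p\<in>P. card A * (\<Sum>a\<in>A. - ln (u p (multiplicity p a))))"
      by (simp add: sum_distrib_left)
    also have "\<dots> \<le> (\<Sum>p\<in>P. ?\<kappa> * (ln p * W p / 2) + (card A)^2 * e p)"
      by (intro sum_mono u(3))
    also have "\<dots> = ?\<kappa> * (\<Sum>p\<in>P. ln p * W p / 2) + (card A)^2 * (\<Sum>p\<in>P. e p)"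
      by (simp only: sum.distrib sum_distrib_left)
    also have "(\<Sum>p\<in>P. ln p * W p / 2) = card A * (\<Sum>a\<in>A. ln (real a)) - (\<Sum>a\<in>A. \<Sum>b\<in>A. ln (real (gcd a b)))"
      (is "_ = ?Y") unfolding W_def using A P by (intro sum_ln_gcd_eq) auto
    finally have 1: "card A * (card A * ln (card A)) \<le> ?\<kappa> * ?Y + (card A)^2 * (\<Sum>p\<in>P. e p)" .
    have "(\<Sum>p\<in>P. e p) \<le> C" unfolding C_def
      using \<open>summable e\<close> P e0 by (intro sum_le_suminf) auto
    then have 2: "real ((card A)^2) * (\<Sum>p\<in>P. e p) \<le> real ((card A)^2) * C" by (intro mult_left_mono) auto
    have "real ((card A)^2) * (ln (card A) - C) = card A * (card A * ln (card A)) - real ((card A)^2) * C"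
      by (simp add: power2_eq_square algebra_simps)
    with 1 2 show "(card A)^2 * (ln (card A) - C) \<le> ?\<kappa> * ?Y" by linarith
  qed
qed

lemma sum_ln_gcd_le:
  fixes \<epsilon> :: real
  assumes \<epsilon>: "\<epsilon> > 0"
  shows "eventually (\<lambda>L. \<forall>A :: nat set. finite A \<longrightarrow> A \<noteq> {} \<longrightarrow> 0 \<notin> A \<longrightarrow> (\<Sum>a\<in>A. ln (real a)) \<le> L \<longrightarrow>
     (\<Sum>a\<in>A. \<Sum>b\<in>A. ln (real (gcd a b))) \<le> (1/4 + \<epsilon>) * (L^2 / ln L)) at_top"
proof -
  have "((\<lambda>\<delta>::real. (1 + \<delta>) / (1 - \<delta>) / (4 * (1 - 2 * \<delta>))) \<longlongrightarrow> 1/4) (at_right 0)"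
    by real_asymp
  then have "eventually (\<lambda>\<delta>::real. (1 + \<delta>) / (1 - \<delta>) / (4 * (1 - 2 * \<delta>)) < 1/4 + \<epsilon>) (at_right 0)"
    using \<epsilon> by (intro order_tendstoD) auto
  moreover have "eventually (\<lambda>\<delta>::real. \<delta> < 1/2) (at_right 0)" "eventually (\<lambda>\<delta>::real. \<delta> > 0) (at_right 0)"
    by real_asymp+
  ultimately have "eventually (\<lambda>\<delta>::real. (1 + \<delta>) / (1 - \<delta>) / (4 * (1 - 2 * \<delta>)) < 1/4 + \<epsilon> \<and> \<delta> < 1/2 \<and> \<delta> > 0) (at_right 0)"
    by eventually_elim auto
  then obtain \<delta> :: real where \<delta>: "(1 + \<delta>) / (1 - \<delta>) / (4 * (1 - 2 * \<delta>)) < 1/4 + \<epsilon>" "\<delta> < 1/2" "0 < \<delta>"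
    using eventually_happens[of _ "at_right (0::real)"] trivial_limit_at_right_real by blast
  define \<kappa> where "\<kappa> = (1 + \<delta>) / (1 - \<delta>)"
  have \<kappa>: "\<kappa> > 0" using \<delta> by (simp add: \<kappa>_def)
  have "\<delta> < 1" using \<delta> by simp
  from sum_ln_gcd_le_aux[OF \<delta>(3) this, folded \<kappa>_def]
  obtain C where "C \<ge> 0" and C: "\<forall>A :: nat set. finite A \<longrightarrow> A \<noteq> {} \<longrightarrow> 0 \<notin> A \<longrightarrow>
     (card A)^2 * (ln (card A) - C) \<le> \<kappa> *
       (card A * (\<Sum>a\<in>A. ln (real a)) - (\<Sum>a\<in>A. \<Sum>b\<in>A. ln (real (gcd a b))))"
    by (elim exE conjE)
  have "eventually (\<lambda>L::real. L powr (2 - \<delta>) \<le> 1/4 * (L^2 / ln L)) at_top"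
    using \<delta> by real_asymp
  moreover have "eventually (\<lambda>L::real. C \<le> \<delta> * ln L) at_top"
    using \<delta> by real_asymp
  moreover have "eventually (\<lambda>L::real. L > 1) at_top" by real_asymp
  ultimately show ?thesis
  proof eventually_elim
    case (elim L)
    have lnL: "ln L > 0" using elim by simp
    show ?case
    proof (intro allI impI)
      fix A :: "nat set"
      assume A: "finite A" "A \<noteq> {}" "0 \<notin> A" "(\<Sum>a\<in>A. ln (real a)) \<le> L"
      define t where "t = real (card A)"
      define S where "S = (\<Sum>a\<in>A. \<Sum>b\<in>A. ln (real (gcd a b)))"
      have t: "t > 0" using A by (simp add: t_def card_gt_0_iff)
      have tL: "t * (\<Sum>a\<in>A. ln (real a)) \<le> t * L" using A t by (intro mult_left_mono) auto
      show "S \<le> (1/4 + \<epsilon>) * (L^2 / ln L)"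
      proof (cases "t \<le> L powr (1 - \<delta>)")
        \<comment> \<open>A set this small is covered by \<open>gcd a b <= a\<close>. In the other
          case \<open>ln t\<close> is at least \<open>(1 - \<delta>) * ln L\<close>, and one more
          \<delta> absorbs \<open>C\<close>.\<close>
        case True
        have "S \<le> (\<Sum>a\<in>A. \<Sum>b\<in>A. ln (real a))"
          unfolding S_def
        proof (intro sum_mono)
          fix a b assume "a \<in> A" "b \<in> A"
          then have "a > 0" using A by (auto intro: Nat.gr0I)
          then show "ln (real (gcd a b)) \<le> ln (real a)"
            by (subst ln_le_cancel_iff) (auto intro: gcd_le1_nat)
        qed
        also have "\<dots> \<le> t * L" using tL by (simp add: t_def flip: sum_distrib_left)
        also have "\<dots> \<le> L powr (1 - \<delta>) * L" using True elim by (intro mult_right_mono) auto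
        also have "\<dots> = L powr (2 - \<delta>)" using elim by (simp flip: powr_mult_base add: powr_add[of _ 1 "1 - \<delta>", simplified])
        also have "\<dots> \<le> 1/4 * (L^2 / ln L)" by (rule elim)
        also have "\<dots> \<le> (1/4 + \<epsilon>) * (L^2 / ln L)" using \<epsilon> lnL by (intro mult_right_mono) auto
        finally show ?thesis .
      next
        case False
        then have "ln (L powr (1 - \<delta>)) \<le> ln t" using elim t by (subst ln_le_cancel_iff) auto
        then have "(1 - \<delta>) * ln L \<le> ln t" by (simp add: ln_powr)
        then have "(1 - 2 * \<delta>) * ln L \<le> ln t - C" using elim by (simp add: algebra_simps)
        then have "t^2 * ((1 - 2 * \<delta>) * ln L) \<le> t^2 * (ln t - C)" by (intro mult_left_mono) auto
        also have "\<dots> \<le> \<kappa> * (t * (\<Sum>a\<in>A. ln (real a)) - S)"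
          using C[rule_format, OF A(1-3)] by (simp add: t_def S_def)
        also have "\<dots> \<le> \<kappa> * (t * L - S)" using tL \<kappa> by (intro mult_left_mono) auto
        finally have 1: "t^2 * ((1 - 2 * \<delta>) * ln L) \<le> \<kappa> * (t * L - S)" .
        define h where "h = (1 - 2 * \<delta>) * ln L / \<kappa>"
        have h: "h > 0" using \<delta> \<kappa> lnL by (simp add: h_def)
        have "S \<le> t * L - t^2 * h" using 1 \<kappa> by (simp add: h_def field_simps)
        \<comment> \<open>Completing the square in \<open>t\<close>; since \<open>h\<close> is
          nearly \<open>ln L\<close>, the value at the vertex is the claimed bound.\<close>
        also have "\<dots> = L^2 / (4 * h) - (L - 2 * h * t)^2 / (4 * h)"
          using h by (simp add: field_simps power2_eq_square)
        also have "\<dots> \<le> L^2 / (4 * h)" using h by simp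
        also have "\<dots> = \<kappa> / (4 * (1 - 2 * \<delta>)) * (L^2 / ln L)" by (simp add: h_def algebra_simps)
        also have "\<dots> \<le> (1/4 + \<epsilon>) * (L^2 / ln L)"
          using \<delta> lnL unfolding \<kappa>_def by (intro mult_right_mono) auto
        finally show ?thesis .
      qed
    qed
  qed
qed

section \<open>The maxima \<open>M1\<close> and \<open>M2\<close>\<close>

lemma finite_sets_prod_le:
  "finite {A :: nat set. finite A \<and> 0 \<notin> A \<and> \<Prod>A \<le> n}"
proof (rule finite_subset)
  show "{A :: nat set. finite A \<and> 0 \<notin> A \<and> \<Prod>A \<le> n} \<subseteq> Pow {..n}"
  proof safe
    fix A :: "nat set" and a assume A: "finite A" "0 \<notin> A" "\<Prod>A \<le> n" "a \<in> A"
    have "\<Prod>A > 0" using A by (intro prod_pos) (auto intro: Nat.gr0I)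
    moreover have "a dvd \<Prod>A" using dvd_prodI[of A a "\<lambda>x. x"] A by simp
    ultimately have "a \<le> \<Prod>A" by (rule dvd_imp_le[rotated])
    then show "a \<le> n" using A by simp
  qed
qed simp

lemma M1_set:
  assumes "n \<ge> 1"
  defines "X \<equiv> {(\<Prod>a\<in>A. \<Prod>b\<in>A. gcd a b) | A :: nat set. finite A \<and> A \<noteq> {} \<and> 0 \<notin> A \<and> \<Prod>A \<le> n}"
  shows "finite X" "X \<noteq> {}"
proof -
  have "X \<subseteq> (\<lambda>A. \<Prod>a\<in>A. \<Prod>b\<in>A. gcd a b) ` {A :: nat set. finite A \<and> 0 \<notin> A \<and> \<Prod>A \<le> n}"
    by (auto simp: X_def)
  then show "finite X" by (rule finite_subset) (intro finite_imageI finite_sets_prod_le)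
  have "(\<Prod>a\<in>{1::nat}. \<Prod>b\<in>{1}. gcd a b) \<in> X" unfolding X_def using assms(1) by (intro CollectI exI[of _ "{1}"]) auto
  then show "X \<noteq> {}" by blast
qed

lemma M2_set:
  assumes "n \<ge> 1"
  defines "X \<equiv> {(\<Prod>p\<in>P. \<Prod>q\<in>P. gcd (p - 1) (q - 1)) | P :: nat set. finite P \<and> (\<forall>p\<in>P. prime p) \<and> \<Prod>P \<le> n}"
  shows "finite X" "X \<noteq> {}"
proof -
  have "X \<subseteq> (\<lambda>P. \<Prod>p\<in>P. \<Prod>q\<in>P. gcd (p - 1) (q - 1)) ` {A :: nat set. finite A \<and> 0 \<notin> A \<and> \<Prod>A \<le> n}"
    unfolding X_def using not_prime_0 by blast
  then show "finite X" by (rule finite_subset) (intro finite_imageI finite_sets_prod_le)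
  have "(\<Prod>a\<in>{}. \<Prod>b\<in>{}. gcd (a - 1) (b - 1)) \<in> X" unfolding X_def using assms(1) by (intro CollectI exI[of _ "{}"]) auto
  then show "X \<noteq> {}" by blast
qed

lemma M1_ge:
  assumes "finite A" "A \<noteq> {}" "0 \<notin> A" "\<Prod>A \<le> n"
  shows "(\<Prod>a\<in>A. \<Prod>b\<in>A. gcd a b) \<le> M1 n"
proof -
  have "\<Prod>A > 0" using assms by (intro prod_pos) (auto intro: Nat.gr0I)
  then have "n \<ge> 1" using assms by linarith
  then show ?thesis unfolding M1_def using assms by (intro Max_ge M1_set) auto
qed

lemma M1_obtain:
  assumes "n \<ge> 1"
  obtains A where "finite A" "A \<noteq> {}" "0 \<notin> A" "\<Prod>A \<le> n" "M1 n = (\<Prod>a\<in>A. \<Prod>b\<in>A. gcd a b)"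
  using Max_in[OF M1_set[OF assms]] unfolding M1_def[symmetric] by blast

lemma M2_ge:
  assumes "finite P" "\<And>p. p \<in> P \<Longrightarrow> prime p" "\<Prod>P \<le> n"
  shows "(\<Prod>p\<in>P. \<Prod>q\<in>P. gcd (p - 1) (q - 1)) \<le> M2 n"
proof -
  have "\<Prod>P > 0" using assms by (intro prod_pos) (auto intro: prime_gt_0_nat)
  then have "n \<ge> 1" using assms by linarith
  then show ?thesis unfolding M2_def using assms by (intro Max_ge M2_set) auto
qed

lemma M2_obtain:
  assumes "n \<ge> 1"
  obtains P where "finite P" "\<forall>p\<in>P. prime p" "\<Prod>P \<le> n" "M2 n = (\<Prod>p\<in>P. \<Prod>q\<in>P. gcd (p - 1) (q - 1))"
  using Max_in[OF M2_set[OF assms]] unfolding M2_def[symmetric] by blast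

lemma M1_pos: "n \<ge> 1 \<Longrightarrow> M1 n \<ge> 1"
  using M1_ge[of "{1}" n] by simp

lemma M2_pos: "n \<ge> 1 \<Longrightarrow> M2 n \<ge> 1"
  using M2_ge[of "{}" n] by simp

lemma M2_le_M1:
  assumes "n \<ge> 1"
  shows "M2 n \<le> M1 n"
proof -
  obtain P where P: "finite P" "\<forall>p\<in>P. prime p" "\<Prod>P \<le> n" "M2 n = (\<Prod>p\<in>P. \<Prod>q\<in>P. gcd (p - 1) (q - 1))"
    using M2_obtain[OF assms] .
  show ?thesis
  proof (cases "P = {}")
    \<comment> \<open>The empty set of primes is admissible for \<open>M2\<close>, whereas
      \<open>M1\<close> asks for a nonempty set.\<close>
    case True
    then show ?thesis using P(4) M1_pos[OF assms] by simp
  next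
    case False
    have gt: "p > 1" if "p \<in> P" for p using P(2) that prime_gt_1_nat by blast
    have inj: "inj_on (\<lambda>p. p - 1) P" using gt by (intro inj_onI) fastforce
    have "\<Prod>((\<lambda>p. p - 1) ` P) = (\<Prod>p\<in>P. p - 1)" by (subst prod.reindex[OF inj]) simp
    also have "\<dots> \<le> \<Prod>P" by (intro prod_mono) auto
    also have "\<dots> \<le> n" by (rule P(3))
    finally have "(\<Prod>a\<in>(\<lambda>p. p - 1) ` P. \<Prod>b\<in>(\<lambda>p. p - 1) ` P. gcd a b) \<le> M1 n"
      using P(1) False by (intro M1_ge) (auto simp: image_iff dest: gt)
    then show ?thesis by (simp add: P(4) prod.reindex[OF inj] del: One_nat_def)
  qed
qed

lemma ln_prod_gcd:
  fixes f :: "'a \<Rightarrow> nat"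
  assumes "finite A" "\<And>a. a \<in> A \<Longrightarrow> f a > 0"
  shows "ln (real (\<Prod>a\<in>A. \<Prod>b\<in>A. gcd (f a) (f b))) = (\<Sum>a\<in>A. \<Sum>b\<in>A. ln (real (gcd (f a) (f b))))"
  using assms by (simp add: ln_prod prod_pos)

lemma eventually_ln_M1_le:
  fixes \<epsilon> :: real
  assumes \<epsilon>: "\<epsilon> > 0"
  shows "eventually (\<lambda>n. ln (real (M1 n)) / lam n \<le> 1/4 + \<epsilon>) sequentially"
proof -
  have lim: "filterlim (\<lambda>n. ln (real n)) at_top sequentially" by real_asymp
  have "eventually (\<lambda>n::nat. n \<ge> 1 \<and> lam n > 0) sequentially"
    unfolding lam_def by (intro eventually_conj eventually_ge_at_top) real_asymp
  with eventually_compose_filterlim[OF sum_ln_gcd_le[OF \<epsilon>] lim] show ?thesis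
  proof eventually_elim
    case (elim n)
    obtain A where A: "finite A" "A \<noteq> {}" "0 \<notin> A" "\<Prod>A \<le> n" "M1 n = (\<Prod>a\<in>A. \<Prod>b\<in>A. gcd a b)"
      using M1_obtain elim by blast
    have pos: "a > 0" if "a \<in> A" for a using that A by (auto intro: Nat.gr0I)
    have "(\<Sum>a\<in>A. ln (real a)) = ln (real (\<Prod>A))"
      using A pos by (simp add: ln_prod)
    also have "\<dots> \<le> ln (real n)"
    proof (rule ln_mono)
      show "real (\<Prod>A) > 0" using pos by (simp add: prod_pos)
      show "real (\<Prod>A) \<le> real n" using A(4) by (simp only: of_nat_le_iff)
    qed
    finally have "(\<Sum>a\<in>A. \<Sum>b\<in>A. ln (real (gcd a b))) \<le> (1/4 + \<epsilon>) * lam n"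
      unfolding lam_def using elim A by blast
    moreover have "ln (real (M1 n)) = (\<Sum>a\<in>A. \<Sum>b\<in>A. ln (real (gcd a b)))"
      unfolding A(5) using A pos by (intro ln_prod_gcd)
    ultimately show ?case using elim by (simp add: divide_le_eq)
  qed
qed

lemma ln_M1_ge:
  fixes t :: nat
  assumes t: "t \<ge> 1" and tn: "2 * real t * ln (real t) \<le> ln (real n)" and n: "n \<ge> 1"
  shows "(real t)^2 * ln (real t) \<le> ln (real (M1 n))"
proof -
  define A where "A = (\<lambda>i. t * i) ` {1..t}"
  have inj: "inj_on (\<lambda>i. t * i) {1..t}" using t by (auto simp: inj_on_def)
  have A: "finite A" "A \<noteq> {}" "0 \<notin> A" using t by (auto simp: A_def)
  have "\<Prod>A = (\<Prod>i\<in>{1..t}. t * i)" unfolding A_def by (subst prod.reindex[OF inj]) simp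
  also have "\<dots> \<le> (\<Prod>i\<in>{1..t}. t * t)" by (intro prod_mono) auto
  also have "\<dots> = t ^ (2 * t)" by (simp add: power_mult power2_eq_square)
  also have "\<dots> \<le> n"
  proof -
    have "ln (real (t ^ (2 * t))) \<le> ln (real n)" using tn t by (simp add: ln_realpow)
    then have "real (t ^ (2 * t)) \<le> real n" using t n by (subst (asm) ln_le_cancel_iff) auto
    then show ?thesis by (simp only: of_nat_le_iff)
  qed
  finally have M: "(\<Prod>a\<in>A. \<Prod>b\<in>A. gcd a b) \<le> M1 n" using A by (intro M1_ge)
  have "card A = t" unfolding A_def by (subst card_image[OF inj]) simp
  then have "t ^ (t * t) = (\<Prod>a\<in>A. \<Prod>b\<in>A. t)" by (simp add: power_mult)
  also have "\<dots> \<le> (\<Prod>a\<in>A. \<Prod>b\<in>A. gcd a b)"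
  proof (intro prod_mono conjI)
    fix a b assume ab: "a \<in> A" "b \<in> A"
    then have "t dvd gcd a b" by (auto simp: A_def)
    moreover have "gcd a b > 0" using ab A by (auto simp: gcd_pos_nat intro!: Nat.gr0I)
    ultimately show "t \<le> gcd a b" by (rule dvd_imp_le)
  qed auto
  finally have "t ^ (t * t) \<le> M1 n" using M by linarith
  then have "ln (real (t ^ (t * t))) \<le> ln (real (M1 n))"
    using t by (intro ln_mono) (simp_all only: of_nat_le_iff of_nat_0_less_iff zero_less_power)
  then show ?thesis using t by (simp add: ln_realpow power2_eq_square)
qed

lemma eventually_ln_M1_ge:
  fixes \<epsilon> :: real
  assumes \<epsilon>: "\<epsilon> > 0"
  shows "eventually (\<lambda>n. ln (real (M1 n)) / lam n \<ge> 1/4 - \<epsilon>) sequentially"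
proof -
  have lim: "filterlim (\<lambda>n. ln (real n)) at_top sequentially" by real_asymp
  \<comment> \<open>A lower bound for the floor of \<open>L / (2 * ln L)\<close>, which is the
    number of elements used below; its smoothness makes the limit computable.\<close>
  define y where "y = (\<lambda>L::real. L / (2 * ln L) - 1)"
  have "((\<lambda>L. (y L)^2 * ln (y L) / (L^2 / ln L)) \<longlongrightarrow> (1/2)^2) at_top"
    unfolding y_def by real_asymp
  then have "eventually (\<lambda>L. (y L)^2 * ln (y L) / (L^2 / ln L) > 1/4 - \<epsilon>) at_top"
    using \<epsilon> by (intro order_tendstoD) (auto simp: power2_eq_square)
  moreover have "eventually (\<lambda>L. y L \<ge> 1) at_top" unfolding y_def by real_asymp
  moreover have "eventually (\<lambda>L::real. L \<ge> 3) at_top" by real_asymp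
  moreover have "eventually (\<lambda>L::real. ln L \<ge> 1) at_top" by real_asymp
  ultimately have "eventually (\<lambda>L. (y L)^2 * ln (y L) / (L^2 / ln L) > 1/4 - \<epsilon> \<and> y L \<ge> 1 \<and> L \<ge> 3 \<and> ln L \<ge> 1) at_top"
    by eventually_elim auto
  from eventually_compose_filterlim[OF this lim] eventually_ge_at_top[of "1::nat"]
  show ?thesis
  proof eventually_elim
    case (elim n)
    define L where "L = ln (real n)"
    have L: "L \<ge> 3" "ln L \<ge> 1" "y L \<ge> 1" "(y L)^2 * ln (y L) / (L^2 / ln L) > 1/4 - \<epsilon>"
      using elim by (auto simp: L_def)
    define t where "t = nat \<lfloor>L / (2 * ln L)\<rfloor>"
    have t: "y L \<le> real t" "real t \<le> L / (2 * ln L)" using L unfolding t_def y_def by linarith+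
    have t1: "t \<ge> 1" using t L by linarith
    have "L / (2 * ln L) \<le> L" using L by (simp add: field_simps)
    then have "ln (real t) \<le> ln L" using t t1 by (intro ln_mono) auto
    then have "2 * real t * ln (real t) \<le> 2 * (L / (2 * ln L)) * ln L"
      using t t1 L by (intro mult_mono) auto
    also have "\<dots> = L" using L by simp
    finally have "(real t)^2 * ln (real t) \<le> ln (real (M1 n))"
      using t1 elim by (intro ln_M1_ge) (auto simp: L_def)
    moreover have "(y L)^2 * ln (y L) \<le> (real t)^2 * ln (real t)"
      using t L by (intro mult_mono power_mono ln_mono) auto
    moreover have "L^2 / ln L > 0" using L by (intro divide_pos_pos) auto
    ultimately have "(y L)^2 * ln (y L) / (L^2 / ln L) \<le> ln (real (M1 n)) / (L^2 / ln L)"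
      by (intro divide_right_mono) auto
    then show ?case using L(4) unfolding lam_def L_def by linarith
  qed
qed

section \<open>The large sieve for prime moduli\<close>

text \<open>Schur's test for the Gram matrix of the vectors \<open>\<phi> i\<close>: after expanding
  the square, each \<open>norm (c i) * norm (c j)\<close> is split into half the sum of squares, and
  Hermitian symmetry reduces everything to row sums.\<close>

lemma dual_bound:
  fixes \<phi> :: "'i \<Rightarrow> nat \<Rightarrow> complex"
  assumes "\<And>i. i \<in> I \<Longrightarrow> (\<Sum>j\<in>I. norm (\<Sum>n<N. \<phi> i n * cnj (\<phi> j n))) \<le> B"
  shows "(\<Sum>n<N. (norm (\<Sum>i\<in>I. c i * \<phi> i n))\<^sup>2) \<le> B * (\<Sum>i\<in>I. (norm (c i))\<^sup>2)"
proof -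
  define D where "D = (\<lambda>i j. \<Sum>n<N. \<phi> i n * cnj (\<phi> j n))"
  have sym: "norm (D j i) = norm (D i j)" for i j
  proof -
    have "D j i = cnj (D i j)" by (simp add: D_def mult.commute)
    then show ?thesis by simp
  qed
  have "of_real (\<Sum>n<N. (norm (\<Sum>i\<in>I. c i * \<phi> i n))\<^sup>2) =
      (\<Sum>n<N. (\<Sum>i\<in>I. c i * \<phi> i n) * cnj (\<Sum>j\<in>I. c j * \<phi> j n))"
    by (simp only: of_real_sum complex_norm_square)
  also have "\<dots> = (\<Sum>n<N. \<Sum>i\<in>I. \<Sum>j\<in>I. c i * cnj (c j) * (\<phi> i n * cnj (\<phi> j n)))"
    unfolding cnj_sum sum_product by (intro sum.cong refl) (simp add: mult_ac)
  also have "\<dots> = (\<Sum>i\<in>I. \<Sum>j\<in>I. \<Sum>n<N. c i * cnj (c j) * (\<phi> i n * cnj (\<phi> j n)))"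
    by (rule trans[OF sum.swap], rule sum.cong[OF refl], rule sum.swap)
  also have "\<dots> = (\<Sum>i\<in>I. \<Sum>j\<in>I. c i * cnj (c j) * D i j)"
    by (simp only: D_def sum_distrib_left)
  finally have eq: "of_real (\<Sum>n<N. (norm (\<Sum>i\<in>I. c i * \<phi> i n))\<^sup>2) = (\<Sum>i\<in>I. \<Sum>j\<in>I. c i * cnj (c j) * D i j)" .
  have "(\<Sum>n<N. (norm (\<Sum>i\<in>I. c i * \<phi> i n))\<^sup>2) = norm (complex_of_real (\<Sum>n<N. (norm (\<Sum>i\<in>I. c i * \<phi> i n))\<^sup>2))"
    unfolding norm_of_real by (simp add: sum_nonneg)
  also have "\<dots> \<le> (\<Sum>i\<in>I. \<Sum>j\<in>I. norm (c i * cnj (c j) * D i j))"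
    unfolding eq by (rule order.trans[OF norm_sum]) (intro sum_mono norm_sum)
  also have "\<dots> \<le> (\<Sum>i\<in>I. \<Sum>j\<in>I. ((norm (c i))\<^sup>2 / 2 * norm (D i j) + (norm (c j))\<^sup>2 / 2 * norm (D j i)))"
  proof (intro sum_mono)
    fix i j
    have "norm (c i) * norm (c j) \<le> (norm (c i))\<^sup>2 / 2 + (norm (c j))\<^sup>2 / 2"
      using sum_squares_bound[of "norm (c i)" "norm (c j)"] by simp
    then have "norm (c i) * norm (c j) * norm (D i j) \<le> ((norm (c i))\<^sup>2 / 2 + (norm (c j))\<^sup>2 / 2) * norm (D i j)"
      by (intro mult_right_mono) auto
    then show "norm (c i * cnj (c j) * D i j) \<le> (norm (c i))\<^sup>2 / 2 * norm (D i j) + (norm (c j))\<^sup>2 / 2 * norm (D j i)"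
      by (simp add: norm_mult sym[of j i] distrib_right)
  qed
  also have "\<dots> = 2 * (\<Sum>i\<in>I. \<Sum>j\<in>I. (norm (c i))\<^sup>2 / 2 * norm (D i j))"
    unfolding sum.distrib by (subst (2) sum.swap) simp
  also have "\<dots> = (\<Sum>i\<in>I. (norm (c i))\<^sup>2 * (\<Sum>j\<in>I. norm (D i j)))"
    by (simp add: sum_distrib_left)
  also have "\<dots> \<le> (\<Sum>i\<in>I. (norm (c i))\<^sup>2 * B)"
    using assms unfolding D_def by (intro sum_mono mult_left_mono) auto
  finally show ?thesis by (simp add: sum_distrib_left mult.commute)
qed

text \<open>The dual inequality is applied with the conjugates of the sums \<open>S i\<close> as
  coefficients. Cauchy-Schwarz then gives \<open>T^2 <= E * B * T\<close>, and one factor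
  \<open>T\<close> cancels.\<close>

lemma large_sieve_duality:
  fixes \<phi> :: "'i \<Rightarrow> nat \<Rightarrow> complex" and a :: "nat \<Rightarrow> complex"
  assumes B: "B \<ge> 0" and "\<And>i. i \<in> I \<Longrightarrow> (\<Sum>j\<in>I. norm (\<Sum>n<N. \<phi> i n * cnj (\<phi> j n))) \<le> B"
  shows "(\<Sum>i\<in>I. (norm (\<Sum>n<N. a n * \<phi> i n))\<^sup>2) \<le> B * (\<Sum>n<N. (norm (a n))\<^sup>2)"
proof -
  define S where "S = (\<lambda>i. \<Sum>n<N. a n * \<phi> i n)"
  define T where "T = (\<Sum>i\<in>I. (norm (S i))\<^sup>2)"
  define E where "E = (\<Sum>n<N. (norm (a n))\<^sup>2)"
  define G where "G = (\<lambda>n. \<Sum>i\<in>I. cnj (S i) * \<phi> i n)"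
  have T0: "T \<ge> 0" and E0: "E \<ge> 0" by (auto simp: T_def E_def sum_nonneg)
  have "complex_of_real T = (\<Sum>i\<in>I. S i * cnj (S i))"
    by (simp only: T_def of_real_sum complex_norm_square)
  also have "\<dots> = (\<Sum>i\<in>I. \<Sum>n<N. a n * (cnj (S i) * \<phi> i n))"
    by (intro sum.cong refl) (subst S_def, simp add: sum_distrib_left sum_distrib_right mult_ac)
  also have "\<dots> = (\<Sum>n<N. a n * G n)"
    by (subst sum.swap) (simp add: G_def sum_distrib_left)
  finally have eq: "complex_of_real T = (\<Sum>n<N. a n * G n)" .
  have "T = norm (complex_of_real T)" using T0 by simp
  also have "\<dots> \<le> (\<Sum>n<N. norm (a n) * norm (G n))"
    unfolding eq by (intro sum_norm_le) (simp add: norm_mult)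
  finally have "T\<^sup>2 \<le> (\<Sum>n<N. norm (a n) * norm (G n))\<^sup>2"
    using T0 by (intro power_mono) auto
  also have "\<dots> \<le> E * (\<Sum>n<N. (norm (G n))\<^sup>2)"
    unfolding E_def by (rule Cauchy_Schwarz_ineq_sum)
  also have "\<dots> \<le> E * (B * T)"
  proof (intro mult_left_mono E0)
    have "(\<Sum>n<N. (norm (\<Sum>i\<in>I. cnj (S i) * \<phi> i n))\<^sup>2) \<le> B * (\<Sum>i\<in>I. (norm (cnj (S i)))\<^sup>2)"
      using assms(2) by (rule dual_bound)
    then show "(\<Sum>n<N. (norm (G n))\<^sup>2) \<le> B * T" by (simp add: G_def T_def)
  qed
  finally have *: "T * T \<le> (B * E) * T" by (simp add: power2_eq_square mult_ac)
  show ?thesis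
  proof (cases "T = 0")
    case False
    then show ?thesis using * T0 by (simp add: T_def S_def E_def)
  next
    case True
    moreover have "0 \<le> B * E" using E0 B by simp
    ultimately show ?thesis by (simp add: T_def S_def E_def)
  qed
qed

text \<open>At the half angle \<open>u\<close> both \<open>sin u / u\<close> and
  \<open>cos u\<close> are at least \<open>cos (pi / 4)\<close>, whose square is 1/2; the double
  angle formula combines them.\<close>

lemma sin_ge_half:
  fixes x :: real
  assumes "0 \<le> x" "x \<le> pi / 2"
  shows "x / 2 \<le> sin x"
proof (cases "x = 0")
  case False
  define u where "u = x / 2"
  have u: "0 < u" "u \<le> pi / 4" using assms False by (auto simp: u_def)
  obtain z where z: "0 < z" "z < u" "sin u - sin 0 = (u - 0) * cos z"
    using MVT2[of 0 u sin cos] u by (auto intro!: derivative_eq_intros)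
  have c: "cos (pi / 4) \<le> cos u" using u pi_gt_zero by (intro cos_monotone_0_pi_le) auto
  have "cos (pi / 4) \<le> cos z" using u z by (intro cos_monotone_0_pi_le) auto
  then have "u * cos (pi / 4) \<le> sin u" using z u by simp
  then have "u * cos (pi / 4) * cos (pi / 4) \<le> sin u * cos u"
    using c u by (intro mult_mono) (auto simp: cos_45 sin_ge_zero)
  moreover have "sin x = 2 * (sin u * cos u)" using sin_double[of u] by (simp add: u_def)
  moreover have "u * cos (pi / 4) * cos (pi / 4) = u / 2" by (simp add: cos_45 mult.assoc)
  moreover have "x = 2 * u" by (simp add: u_def)
  ultimately show ?thesis by linarith
qed simp

lemma norm_sum_cis_le:
  fixes y :: real
  assumes y: "y \<noteq> 0" "\<bar>y\<bar> \<le> 1 / 2"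
  shows "norm (\<Sum>n<N. cis (2 * pi * y) ^ n) \<le> 1 / \<bar>y\<bar>"
proof -
  define z where "z = cis (2 * pi * y)"
  have "norm (z - 1) = 2 * \<bar>sin (pi * y)\<bar>"
    using dist_exp_i_1[of "2 * pi * y"] by (simp add: z_def cis_conv_exp mult_ac)
  moreover have "\<bar>y\<bar> \<le> \<bar>sin (pi * y)\<bar>"
  proof -
    have "pi * \<bar>y\<bar> / 2 \<le> sin (pi * \<bar>y\<bar>)" using y by (intro sin_ge_half) (auto simp: mult_le_cancel_left_pos[of pi])
    moreover have "sin (pi * \<bar>y\<bar>) \<le> \<bar>sin (pi * y)\<bar>" by (cases "y \<ge> 0") (auto simp: abs_if)
    moreover have "2 * \<bar>y\<bar> \<le> pi * \<bar>y\<bar>" using pi_ge_two by (intro mult_right_mono) auto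
    ultimately show ?thesis by linarith
  qed
  ultimately have n1: "norm (z - 1) \<ge> 2 * \<bar>y\<bar>" by linarith
  then have "z \<noteq> 1" using y by auto
  then have "(\<Sum>n<N. z ^ n) = (z ^ N - 1) / (z - 1)" by (rule geometric_sum)
  also have "norm \<dots> = norm (z ^ N - 1) / norm (z - 1)" by (rule norm_divide)
  also have "\<dots> \<le> 2 / (2 * \<bar>y\<bar>)"
  proof (rule frac_le)
    show "norm (z ^ N - 1) \<le> 2"
      using norm_triangle_ineq4[of "z ^ N" 1] by (simp add: z_def norm_power)
  qed (use n1 y in auto)
  finally show ?thesis using y by (simp add: z_def)
qed

text \<open>Cells of length \<delta> contain at most one point each, so the cell index is injective
  and the sum compares with a harmonic sum.\<close>

lemma sum_inverse_separated_pos: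
  fixes y :: "'a \<Rightarrow> real" and \<delta> :: real
  assumes "finite Y" "\<delta> > 0" "\<And>i. i \<in> Y \<Longrightarrow> \<delta> \<le> y i \<and> y i \<le> \<delta> * J"
    "\<And>i j. i \<in> Y \<Longrightarrow> j \<in> Y \<Longrightarrow> i \<noteq> j \<Longrightarrow> \<bar>y i - y j\<bar> \<ge> \<delta>"
  shows "(\<Sum>i\<in>Y. 1 / y i) \<le> harm J / \<delta>"
proof -
  define f where "f = (\<lambda>i. nat \<lfloor>y i / \<delta>\<rfloor>)"
  have f: "1 \<le> f i \<and> f i \<le> J \<and> \<delta> * f i \<le> y i \<and> y i < \<delta> * (f i + 1)" if "i \<in> Y" for i
  proof -
    have 1: "1 \<le> y i / \<delta>" "y i / \<delta> \<le> J" using assms(2,3) that by (auto simp: field_simps)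
    then have "1 \<le> f i" "f i \<le> J" unfolding f_def by linarith+
    moreover have "real (f i) \<le> y i / \<delta>" "y i / \<delta> < real (f i) + 1" using 1 unfolding f_def by linarith+
    ultimately show ?thesis using assms(2) by (simp add: field_simps)
  qed
  have inj: "inj_on f Y"
  proof (rule inj_onI, rule ccontr)
    fix i j assume ij: "i \<in> Y" "j \<in> Y" "f i = f j" "i \<noteq> j"
    have "\<bar>y i - y j\<bar> \<ge> \<delta>" using assms(4) ij by blast
    moreover have "y i < \<delta> * f i + \<delta>" "\<delta> * f i \<le> y i" "y j < \<delta> * f i + \<delta>" "\<delta> * f i \<le> y j"
      using f[OF ij(1)] f[OF ij(2)] ij(3) by (auto simp: algebra_simps)
    ultimately show False by linarith
  qed
  have "(\<Sum>i\<in>Y. 1 / y i) \<le> (\<Sum>i\<in>Y. inverse (real (f i)) / \<delta>)"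
  proof (rule sum_mono)
    fix i assume i: "i \<in> Y"
    have "1 / y i \<le> 1 / (\<delta> * f i)" using f[OF i] assms(2) assms(3)[OF i]
      by (intro divide_left_mono mult_pos_pos) auto
    then show "1 / y i \<le> inverse (real (f i)) / \<delta>" by (simp add: field_simps)
  qed
  also have "\<dots> = (\<Sum>k\<in>f ` Y. inverse (real k)) / \<delta>"
    by (simp add: sum.reindex[OF inj] sum_divide_distrib)
  also have "\<dots> \<le> harm J / \<delta>"
    unfolding harm_def using f assms(2) by (intro divide_right_mono sum_mono2) auto
  finally show ?thesis .
qed

lemma sum_inverse_separated:
  fixes y :: "'a \<Rightarrow> real" and \<delta> :: real
  assumes "finite Y" "\<delta> > 0" "\<And>i. i \<in> Y \<Longrightarrow> \<delta> \<le> \<bar>y i\<bar> \<and> \<bar>y i\<bar> \<le> \<delta> * J"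
    "\<And>i j. i \<in> Y \<Longrightarrow> j \<in> Y \<Longrightarrow> i \<noteq> j \<Longrightarrow> \<bar>y i - y j\<bar> \<ge> \<delta>"
  shows "(\<Sum>i\<in>Y. 1 / \<bar>y i\<bar>) \<le> 2 * harm J / \<delta>"
proof -
  have "(\<Sum>i\<in>Y. 1 / \<bar>y i\<bar>) = (\<Sum>i\<in>{i\<in>Y. y i > 0} \<union> {i\<in>Y. \<not> y i > 0}. 1 / \<bar>y i\<bar>)"
    by (intro sum.cong) auto
  also have "\<dots> = (\<Sum>i\<in>{i\<in>Y. y i > 0}. 1 / \<bar>y i\<bar>) + (\<Sum>i\<in>{i\<in>Y. \<not> y i > 0}. 1 / \<bar>y i\<bar>)"
    using assms(1) by (intro sum.union_disjoint) auto
  also have "(\<Sum>i\<in>{i\<in>Y. y i > 0}. 1 / \<bar>y i\<bar>) = (\<Sum>i\<in>{i\<in>Y. y i > 0}. 1 / y i)"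
    by (intro sum.cong) auto
  also have "\<dots> \<le> harm J / \<delta>"
    using assms(1,2,4) by (intro sum_inverse_separated_pos) (auto dest: assms(3))
  also have "(\<Sum>i\<in>{i\<in>Y. \<not> y i > 0}. 1 / \<bar>y i\<bar>) = (\<Sum>i\<in>{i\<in>Y. \<not> y i > 0}. 1 / (- y i))"
    by (intro sum.cong) auto
  also have "\<dots> \<le> harm J / \<delta>"
    using assms(1,2) by (intro sum_inverse_separated_pos) (auto dest: assms(3,4))
  finally show ?thesis by simp
qed

text \<open>Using the Dirichlet kernel instead of a smoother one costs the harmless factor \<open>harm J\<close>.\<close>

lemma additive_large_sieve:
  fixes x :: "'i \<Rightarrow> real" and a :: "nat \<Rightarrow> complex"
  assumes I: "finite I" and \<delta>: "\<delta> > 0" "1 / 2 \<le> \<delta> * J"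
    and sep: "\<And>i j k. i \<in> I \<Longrightarrow> j \<in> I \<Longrightarrow> i \<noteq> j \<Longrightarrow> \<bar>x i - x j - of_int k\<bar> \<ge> \<delta>"
  shows "(\<Sum>i\<in>I. (norm (\<Sum>n<N. a n * cis (2 * pi * x i) ^ n))\<^sup>2) \<le> (N + 2 * harm J / \<delta>) * (\<Sum>n<N. (norm (a n))\<^sup>2)"
proof (rule large_sieve_duality)
  have "harm J \<ge> (0::real)" by (rule harm_nonneg)
  then show "0 \<le> N + 2 * harm J / \<delta>" using \<delta> by simp
next
  fix i assume i: "i \<in> I"
  \<comment> \<open>The representative of \<open>x i - x j\<close> modulo 1 that is closest to 0. It
    gives the same geometric sum and satisfies the bound 1/2 needed for the sine estimate.\<close>
  define y where "y = (\<lambda>j. x i - x j - of_int (round (x i - x j)))"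
  have half: "\<bar>y j\<bar> \<le> 1 / 2" for j
    unfolding y_def using of_int_round_abs_le[of "x i - x j"] by (simp add: abs_minus_commute)
  have y0: "\<delta> \<le> \<bar>y j\<bar>" if "j \<in> I - {i}" for j using sep[of i j] i that unfolding y_def by auto
  have cis: "cis (2 * pi * x i) ^ n * cnj (cis (2 * pi * x j) ^ n) = cis (2 * pi * y j) ^ n" for j n
  proof -
    have "cis (2 * pi * y j) = cis (2 * pi * (x i - x j)) / cis (2 * pi * of_int (round (x i - x j)))"
      unfolding cis_divide y_def by (intro arg_cong[of _ _ cis]) (simp add: algebra_simps)
    also have "\<dots> = cis (2 * pi * x i) * cnj (cis (2 * pi * x j))"
      by (subst cis_multiple_2pi) (auto simp: cis_cnj cis_mult algebra_simps)
    finally show ?thesis by (simp add: power_mult_distrib)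
  qed
  have "(\<Sum>j\<in>I. norm (\<Sum>n<N. cis (2 * pi * x i) ^ n * cnj (cis (2 * pi * x j) ^ n))) =
     norm (\<Sum>n<N. cis (2 * pi * x i) ^ n * cnj (cis (2 * pi * x i) ^ n)) +
     (\<Sum>j\<in>I - {i}. norm (\<Sum>n<N. cis (2 * pi * x i) ^ n * cnj (cis (2 * pi * x j) ^ n)))"
    using I i by (rule sum.remove)
  also have "norm (\<Sum>n<N. cis (2 * pi * x i) ^ n * cnj (cis (2 * pi * x i) ^ n)) = N"
    unfolding cis by (simp add: y_def)
  also have "(\<Sum>j\<in>I - {i}. norm (\<Sum>n<N. cis (2 * pi * x i) ^ n * cnj (cis (2 * pi * x j) ^ n)))
      \<le> (\<Sum>j\<in>I - {i}. 1 / \<bar>y j\<bar>)"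
    unfolding cis using y0 half \<delta>(1) by (intro sum_mono norm_sum_cis_le) fastforce+
  also have "\<dots> \<le> 2 * harm J / \<delta>"
  proof (rule sum_inverse_separated)
    fix j assume "j \<in> I - {i}"
    then show "\<delta> \<le> \<bar>y j\<bar> \<and> \<bar>y j\<bar> \<le> \<delta> * J" using y0 half[of j] \<delta>(2) by auto
  next
    fix j k assume jk: "j \<in> I - {i}" "k \<in> I - {i}" "j \<noteq> k"
    \<comment> \<open>The reduced differences inherit the spacing, since \<open>x i\<close> cancels
      and only an integer shift remains.\<close>
    have "y j - y k = - (x j - x k - of_int (round (x i - x k) - round (x i - x j)))"
      unfolding y_def by simp
    then show "\<delta> \<le> \<bar>y j - y k\<bar>" using sep[of j k "round (x i - x k) - round (x i - x j)"] jk by simp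
  qed (use I \<delta> in auto)
  finally show "(\<Sum>j\<in>I. norm (\<Sum>n<N. cis (2 * pi * x i) ^ n * cnj (cis (2 * pi * x j) ^ n))) \<le> N + 2 * harm J / \<delta>"
    by simp
qed

section \<open>From frequencies to residue classes\<close>

definition class_sum :: "(nat \<Rightarrow> real) \<Rightarrow> nat \<Rightarrow> nat \<Rightarrow> nat \<Rightarrow> real" where
  "class_sum f N m r = (\<Sum>n\<in>{n. n < N \<and> n mod m = r}. f n)"

definition class_var :: "(nat \<Rightarrow> real) \<Rightarrow> nat \<Rightarrow> nat \<Rightarrow> real" where
  "class_var f N m = (\<Sum>r<m. (class_sum f N m r - (\<Sum>n<N. f n) / m)\<^sup>2)"

lemma sum_group_mod:
  fixes g :: "nat \<Rightarrow> 'b :: comm_monoid_add"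
  assumes "m > 0"
  shows "(\<Sum>r<m. \<Sum>n\<in>{n. n < N \<and> n mod m = r}. g n) = (\<Sum>n<N. g n)"
proof -
  have "(\<Sum>r<m. \<Sum>n\<in>{n. n < N \<and> n mod m = r}. g n) = (\<Sum>r<m. \<Sum>n\<in>{n\<in>{..<N}. n mod m = r}. g n)"
    by (intro sum.cong) auto
  also have "\<dots> = (\<Sum>n<N. g n)" using assms by (intro sum.group) auto
  finally show ?thesis .
qed

lemma sum_cis_mod:
  fixes r s :: nat
  assumes "m > 0" "r < m" "s < m"
  shows "(\<Sum>b<m. cis (2 * pi * (real b / m)) ^ r * cnj (cis (2 * pi * (real b / m)) ^ s)) = (if r = s then of_nat m else 0)"
proof -
  define w where "w = cis (2 * pi * ((real r - real s) / m))"
  have "cis (2 * pi * (real b / m)) ^ r * cnj (cis (2 * pi * (real b / m)) ^ s) = w ^ b" for b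
    unfolding w_def Complex.DeMoivre cis_cnj cis_mult using assms by (intro arg_cong[of _ _ cis]) (simp add: field_simps)
  then have eq: "(\<Sum>b<m. cis (2 * pi * (real b / m)) ^ r * cnj (cis (2 * pi * (real b / m)) ^ s)) = (\<Sum>b<m. w ^ b)"
    by simp
  show ?thesis
  proof (cases "r = s")
    case True
    then show ?thesis unfolding eq by (simp add: w_def)
  next
    case False
    have "w \<noteq> 1"
    proof
      assume "w = 1"
      then obtain k :: int where "2 * pi * ((real r - real s) / m) = of_int k * (2 * pi)"
        unfolding w_def cis_eq_1_iff by blast
      then have "2 * pi * ((real r - real s) / m) = 2 * pi * of_int k" by (simp only: mult.commute)
      then have "(real r - real s) / m = of_int k" by (rule mult_left_cancel[THEN iffD1, rotated]) simp
      then have "real r - real s = of_int k * m" using assms by (simp add: field_simps)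
      then have "real_of_int (int r - int s) = real_of_int (k * int m)" by simp
      then have k: "int r - int s = k * int m" by (simp only: of_int_eq_iff)
      moreover have "\<bar>int r - int s\<bar> < int m" using assms by linarith
      ultimately have "\<bar>k\<bar> * int m < 1 * int m" by (simp add: abs_mult)
      then have "k = 0" using mult_less_cancel_right_pos[of "int m" "\<bar>k\<bar>" 1] assms by simp
      then show False using k False by simp
    qed
    moreover have "w ^ m = 1"
    proof -
      have "w ^ m = cis (2 * pi * (real_of_int (int r - int s)))"
        unfolding w_def Complex.DeMoivre using assms by (intro arg_cong[of _ _ cis]) (simp add: field_simps)
      also have "\<dots> = 1" by (rule cis_multiple_2pi) (rule Ints_of_int)
      finally show ?thesis .
    qed
    ultimately show ?thesis unfolding eq using False by (simp add: geometric_sum)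
  qed
qed

lemma parseval_mod:
  assumes m: "m > 0"
  shows "(\<Sum>b<m. (norm (\<Sum>n<N. of_real (f n) * cis (2 * pi * (real b / m)) ^ n))\<^sup>2) = m * (\<Sum>r<m. (class_sum f N m r)\<^sup>2)"
proof -
  define Z where "Z = class_sum f N m"
  define w where "w = (\<lambda>b. cis (2 * pi * (real b / m)))"
  have per: "w b ^ n = w b ^ (n mod m)" for b n
  proof -
    have "w b ^ m = cis (2 * pi * (real b))" unfolding w_def Complex.DeMoivre using m by (intro arg_cong[of _ _ cis]) simp
    also have "\<dots> = 1" by (rule cis_multiple_2pi) auto
    finally have "w b ^ m = 1" .
    then have "w b ^ (m * (n div m) + n mod m) = w b ^ (n mod m)"
      unfolding power_add power_mult by simp
    then show ?thesis by simp
  qed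
  have S: "(\<Sum>n<N. of_real (f n) * w b ^ n) = (\<Sum>r<m. of_real (Z r) * w b ^ r)" for b
  proof -
    have "(\<Sum>n<N. of_real (f n) * w b ^ n) = (\<Sum>r<m. \<Sum>n\<in>{n. n < N \<and> n mod m = r}. of_real (f n) * w b ^ n)"
      by (rule sum_group_mod[OF m, symmetric])
    also have "\<dots> = (\<Sum>r<m. \<Sum>n\<in>{n. n < N \<and> n mod m = r}. of_real (f n) * w b ^ r)"
      by (intro sum.cong refl arg_cong2[of _ _ _ _ "(*)"], subst per) simp
    also have "\<dots> = (\<Sum>r<m. of_real (Z r) * w b ^ r)"
      by (simp add: Z_def class_sum_def sum_distrib_right)
    finally show ?thesis .
  qed
  have "complex_of_real (\<Sum>b<m. (norm (\<Sum>n<N. of_real (f n) * w b ^ n))\<^sup>2) =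
     (\<Sum>b<m. \<Sum>r<m. \<Sum>s<m. of_real (Z r) * of_real (Z s) * (w b ^ r * cnj (w b ^ s)))"
    unfolding S of_real_sum complex_norm_square cnj_sum sum_product
    by (intro sum.cong refl) (simp add: mult_ac)
  also have "\<dots> = (\<Sum>r<m. \<Sum>s<m. \<Sum>b<m. of_real (Z r) * of_real (Z s) * (w b ^ r * cnj (w b ^ s)))"
    by (rule trans[OF sum.swap], rule sum.cong[OF refl], rule sum.swap)
  also have "\<dots> = (\<Sum>r<m. \<Sum>s<m. of_real (Z r) * of_real (Z s) * (if r = s then of_nat m else 0))"
    unfolding sum_distrib_left[symmetric] w_def using m by (intro sum.cong refl) (simp only: sum_cis_mod lessThan_iff)
  also have "\<dots> = complex_of_real (m * (\<Sum>r<m. (Z r)\<^sup>2))"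
    by (simp add: if_distrib sum.delta sum_distrib_left power2_eq_square mult_ac cong: if_cong)
  finally show ?thesis unfolding w_def Z_def of_real_eq_iff .
qed

text \<open>Parseval modulo \<open>m\<close>. Subtracting the mean over all classes, the class 0
  included, removes precisely the frequency \<open>b = 0\<close>.\<close>

lemma class_var_eq:
  assumes m: "m > 0"
  shows "m * class_var f N m = (\<Sum>b\<in>{1..<m}. (norm (\<Sum>n<N. of_real (f n) * cis (2 * pi * (real b / m)) ^ n))\<^sup>2)"
proof -
  define Z where "Z = class_sum f N m"
  define T where "T = (\<Sum>n<N. f n)"
  define G where "G = (\<lambda>b. (norm (\<Sum>n<N. of_real (f n) * cis (2 * pi * (real b / m)) ^ n))\<^sup>2)"
  have T: "(\<Sum>r<m. Z r) = T" unfolding Z_def class_sum_def T_def by (rule sum_group_mod[OF m])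
  have "class_var f N m = (\<Sum>r<m. (Z r)\<^sup>2 - 2 * (T / m) * Z r + (T / m)\<^sup>2)"
    unfolding class_var_def by (intro sum.cong refl) (simp add: power2_diff Z_def T_def)
  also have "\<dots> = (\<Sum>r<m. (Z r)\<^sup>2) - 2 * (T / m) * T + m * (T / m)\<^sup>2"
    unfolding sum.distrib sum_subtractf T[symmetric] sum_distrib_left by simp
  also have "\<dots> = (\<Sum>r<m. (Z r)\<^sup>2) - T\<^sup>2 / m"
    using m by (simp add: power2_eq_square field_simps)
  finally have "m * class_var f N m = m * (\<Sum>r<m. (Z r)\<^sup>2) - T\<^sup>2" using m by (simp add: field_simps)
  also have "m * (\<Sum>r<m. (Z r)\<^sup>2) = (\<Sum>b<m. G b)"
    unfolding Z_def G_def by (rule parseval_mod[OF m, symmetric])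
  also have "{..<m} = insert 0 {1..<m}" using m by auto
  also have "(\<Sum>b\<in>\<dots>. G b) = G 0 + (\<Sum>b\<in>{1..<m}. G b)" by (rule sum.insert) auto
  also have "G 0 = T\<^sup>2" by (simp add: G_def T_def flip: of_real_sum)
  finally show ?thesis by (simp add: G_def)
qed

definition ls_bound :: "nat \<Rightarrow> nat \<Rightarrow> real" where
  "ls_bound Q N = N + 2 * harm (Q\<^sup>2) * Q\<^sup>2"

text \<open>For prime \<open>m\<close> every \<open>b / m\<close> with \<open>0 < b < m\<close> is
  in lowest terms. Fractions from different moduli therefore never agree modulo 1, and with
  denominators at most \<open>Q\<close> they are at least \<open>1 / Q^2\<close> apart, because the
  integer numerator \<open>z\<close> of the difference is nonzero.\<close>

lemma large_sieve_class_var: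
  assumes M: "finite M" "\<And>m. m \<in> M \<Longrightarrow> prime m \<and> m \<le> Q"
  shows "(\<Sum>m\<in>M. m * class_var f N m) \<le> ls_bound Q N * (\<Sum>n<N. (f n)\<^sup>2)"
proof (cases "M = {}")
  case True
  have "harm (Q\<^sup>2) \<ge> (0::real)" by (rule harm_nonneg)
  then show ?thesis using True by (simp add: ls_bound_def sum_nonneg)
next
  case False
  then have Q: "Q > 0" using M(2) prime_gt_0_nat by fastforce
  define I where "I = Sigma M (\<lambda>m. {1..<m})"
  define x where "x = (\<lambda>(m::nat, b::nat). real b / m)"
  have "(\<Sum>m\<in>M. m * class_var f N m) =
     (\<Sum>m\<in>M. \<Sum>b\<in>{1..<m}. (norm (\<Sum>n<N. of_real (f n) * cis (2 * pi * (real b / m)) ^ n))\<^sup>2)"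
    using M(2) prime_gt_0_nat by (intro sum.cong refl class_var_eq) blast
  also have "\<dots> = (\<Sum>i\<in>I. (norm (\<Sum>n<N. of_real (f n) * cis (2 * pi * x i) ^ n))\<^sup>2)"
    unfolding I_def x_def using M(1) by (subst sum.Sigma) (auto simp: case_prod_unfold)
  also have "\<dots> \<le> (N + 2 * harm (Q\<^sup>2) / (1 / Q\<^sup>2)) * (\<Sum>n<N. (norm (complex_of_real (f n)))\<^sup>2)"
  proof (rule additive_large_sieve)
    show "finite I" unfolding I_def using M(1) by blast
    show "1 / 2 \<le> 1 / real (Q\<^sup>2) * real (Q\<^sup>2)" "1 / real (Q\<^sup>2) > 0" using Q by auto
  next
    fix i j :: "nat \<times> nat" and k :: int
    assume ij: "i \<in> I" "j \<in> I" "i \<noteq> j"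
    obtain m b where i: "i = (m, b)" by (cases i)
    obtain m' b' where j: "j = (m', b')" by (cases j)
    have m: "m \<in> M" "prime m" "m \<le> Q" "0 < b" "b < m" using ij i M(2) by (auto simp: I_def)
    have m': "m' \<in> M" "prime m'" "m' \<le> Q" "0 < b'" "b' < m'" using ij j M(2) by (auto simp: I_def)
    define z where "z = int b * m' - int b' * m - k * (int m * int m')"
    have "z \<noteq> 0"
    proof
      assume z: "z = 0"
      show False
      proof (cases "m = m'")
        case True
        then have "int m * (int b - int b' - k * int m) = 0" using z by (simp add: z_def algebra_simps)
        then have k: "int b - int b' = k * int m" using m by simp
        moreover have "\<bar>int b - int b'\<bar> < int m" using m m' True by linarith
        ultimately have "\<bar>k\<bar> * int m < 1 * int m" by (simp add: abs_mult)
        then have "k = 0" using mult_less_cancel_right_pos[of "int m" "\<bar>k\<bar>" 1] m by simp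
        then show False using k ij(3) i j True by simp
      next
        case False
        have "int b * int m' = int m * (int b' + k * int m')" using z by (simp add: z_def algebra_simps)
        then have "int m dvd int b * int m'" by simp
        then have "m dvd b * m'" by (simp flip: of_nat_mult)
        moreover have "\<not> m dvd m'" using False m m' primes_dvd_imp_eq by blast
        ultimately have "m dvd b" using m(2) by (simp add: prime_dvd_mult_iff)
        then show False using m by (simp add: nat_dvd_not_less)
      qed
    qed
    then have "\<bar>z\<bar> \<ge> 1" by linarith
    then have "real_of_int 1 \<le> real_of_int \<bar>z\<bar>" by (simp only: of_int_le_iff)
    then have z1: "1 \<le> \<bar>real_of_int z\<bar>" by simp
    have mm: "real m * real m' \<le> real (Q\<^sup>2)" unfolding power2_eq_square of_nat_mult
      using m m' by (intro mult_mono) auto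
    have pos: "real m * real m' > 0" using m m' by simp
    have "x i - x j - of_int k = real_of_int z / (real m * real m')"
      using m m' by (simp add: x_def i j z_def field_simps)
    then have "\<bar>x i - x j - of_int k\<bar> = \<bar>real_of_int z\<bar> / (real m * real m')"
      using pos by (simp add: abs_divide)
    also have "\<dots> \<ge> 1 / (real m * real m')" using z1 pos by (intro divide_right_mono) auto
    also have "1 / (real m * real m') \<ge> 1 / real (Q\<^sup>2)" using mm pos by (intro divide_left_mono) (use Q in auto)
    finally show "1 / real (Q\<^sup>2) \<le> \<bar>x i - x j - of_int k\<bar>" by simp
  qed
  also have "\<dots> = ls_bound Q N * (\<Sum>n<N. (f n)\<^sup>2)" by (simp add: ls_bound_def)
  finally show ?thesis .
qed

section \<open>Bilinear sums over residue classes\<close>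

text \<open>Summing \<open>f n * wt m n\<close> measures how far the residue class of 1 deviates from the average
  reduced residue class modulo \<open>m\<close>.\<close>

definition wt :: "nat \<Rightarrow> nat \<Rightarrow> real" where
  "wt m n = of_bool (n mod m = 1) - of_bool (\<not> m dvd n) / (real m - 1)"

lemma wt_mod: "wt m (n mod m) = wt m n"
  by (simp add: wt_def dvd_mod_iff)

lemma sum_wt_period:
  assumes m: "prime m"
  shows "(\<Sum>c<m. wt m c) = 0" "(\<Sum>c<m. \<bar>wt m c\<bar>) \<le> 2"
proof -
  have m2: "m \<ge> 2" using m by (rule prime_ge_2_nat)
  have 1: "(\<Sum>c<m. of_bool (c mod m = 1) :: real) = 1"
  proof -
    have "(\<Sum>c<m. of_bool (c mod m = 1) :: real) = (\<Sum>c<m. if c = 1 then 1 else 0)"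
      by (intro sum.cong) auto
    also have "\<dots> = 1" using m2 by (subst sum.delta) auto
    finally show ?thesis .
  qed
  have 2: "(\<Sum>c<m. of_bool (\<not> m dvd c) / (real m - 1)) = 1"
  proof -
    have "(\<Sum>c<m. of_bool (\<not> m dvd c) / (real m - 1)) = (\<Sum>c\<in>{1..<m}. 1 / (real m - 1))"
      by (intro sum.mono_neutral_cong_right) (auto simp: not_le dest: nat_dvd_not_less)
    also have "\<dots> = 1" using m2 by (simp add: of_nat_diff)
    finally show ?thesis .
  qed
  show "(\<Sum>c<m. wt m c) = 0" unfolding wt_def sum_subtractf 1 2 by simp
  have "(\<Sum>c<m. \<bar>wt m c\<bar>) \<le> (\<Sum>c<m. of_bool (c mod m = 1) + of_bool (\<not> m dvd c) / (real m - 1))"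
    using m2 by (intro sum_mono) (auto simp: wt_def)
  also have "\<dots> = 2" unfolding sum.distrib 1 2 by simp
  finally show "(\<Sum>c<m. \<bar>wt m c\<bar>) \<le> 2" .
qed

text \<open>If \<open>m dvd d\<close>, all weights vanish; otherwise multiplication by
  \<open>d\<close> permutes the residues and the sum over one period returns.\<close>

lemma sum_wt_row:
  assumes m: "prime m"
  shows "(\<Sum>b<m. wt m (d * b)) = 0" "(\<Sum>b<m. \<bar>wt m (d * b)\<bar>) \<le> 2"
proof -
  have m2: "m \<ge> 2" using m by (rule prime_ge_2_nat)
  have "(\<Sum>b<m. wt m (d * b)) = 0 \<and> (\<Sum>b<m. \<bar>wt m (d * b)\<bar>) \<le> 2"
  proof (cases "m dvd d")
    case True
    then have "wt m (d * b) = 0" for b using m2 by (auto simp: wt_def dvd_imp_mod_0)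
    then show ?thesis by simp
  next
    case False
    then have cop: "coprime d m" using m prime_imp_coprime coprime_commute by blast
    have inj: "inj_on (\<lambda>b. d * b mod m) {..<m}"
    proof (rule inj_onI)
      fix x y assume xy: "x \<in> {..<m}" "y \<in> {..<m}" "d * x mod m = d * y mod m"
      then have "[d * x = d * y] (mod m)" by (simp add: cong_def)
      then have "[x = y] (mod m)" using cong_mult_lcancel_nat[OF cop] by blast
      then show "x = y" using xy by (simp add: cong_def)
    qed
    have bij: "bij_betw (\<lambda>b. d * b mod m) {..<m} {..<m}"
    proof -
      have "(\<lambda>b. d * b mod m) ` {..<m} = {..<m}"
        using m2 by (intro endo_inj_surj inj) auto
      then show ?thesis using inj by (simp add: bij_betw_def)
    qed
    have eq: "(\<Sum>b<m. g (wt m (d * b))) = (\<Sum>c<m. g (wt m c))" for g :: "real \<Rightarrow> real"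
    proof -
      have "(\<Sum>b<m. g (wt m (d * b))) = (\<Sum>b<m. g (wt m (d * b mod m)))" by (simp add: wt_mod)
      also have "\<dots> = (\<Sum>c<m. g (wt m c))" by (rule sum.reindex_bij_betw[OF bij])
      finally show ?thesis .
    qed
    show ?thesis using eq[of "\<lambda>x. x"] eq[of abs] sum_wt_period[OF m] by simp
  qed
  then show "(\<Sum>b<m. wt m (d * b)) = 0" "(\<Sum>b<m. \<bar>wt m (d * b)\<bar>) \<le> 2" by auto
qed

lemma sum_sqrt_mult_le:
  fixes x y :: "'a \<Rightarrow> real"
  assumes "\<And>i. i \<in> I \<Longrightarrow> 0 \<le> x i" "\<And>i. i \<in> I \<Longrightarrow> 0 \<le> y i"
  shows "(\<Sum>i\<in>I. sqrt (x i) * sqrt (y i)) \<le> sqrt (\<Sum>i\<in>I. x i) * sqrt (\<Sum>i\<in>I. y i)"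
proof -
  have "(\<Sum>i\<in>I. sqrt (x i) * sqrt (y i))\<^sup>2 \<le> (\<Sum>i\<in>I. (sqrt (x i))\<^sup>2) * (\<Sum>i\<in>I. (sqrt (y i))\<^sup>2)"
    by (rule Cauchy_Schwarz_ineq_sum)
  also have "\<dots> = (\<Sum>i\<in>I. x i) * (\<Sum>i\<in>I. y i)" using assms by simp
  finally have "sqrt ((\<Sum>i\<in>I. sqrt (x i) * sqrt (y i))\<^sup>2) \<le> sqrt (\<dots>)" by (rule real_sqrt_le_mono)
  then show ?thesis by (simp add: real_sqrt_mult abs_if split: if_splits)
qed

text \<open>On residue classes \<open>wt m (a * b)\<close> is a matrix whose rows and columns sum to
  zero, so \<open>A\<close> and \<open>B\<close> may be replaced by their deviations from the mean.
  Absolute row and column sums are at most 2, and Schur's test bounds the form by the two variances.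
  This does the work of expanding in characters.\<close>

lemma bilinear_wt_bound:
  assumes m: "prime m"
  shows "\<bar>\<Sum>k<N1. \<Sum>l<N2. \<alpha> k * \<beta> l * wt m (k * l)\<bar> \<le> 2 * (sqrt (class_var \<alpha> N1 m) * sqrt (class_var \<beta> N2 m))"
proof -
  have m0: "m > 0" using m by (rule prime_gt_0_nat)
  define A where "A = class_sum \<alpha> N1 m"
  define B where "B = class_sum \<beta> N2 m"
  define A' where "A' = (\<lambda>a. A a - (\<Sum>n<N1. \<alpha> n) / m)"
  define B' where "B' = (\<lambda>b. B b - (\<Sum>n<N2. \<beta> n) / m)"
  have w_mod: "wt m (k * l) = wt m ((k mod m) * (l mod m))" for k l
    by (metis wt_mod mod_mult_eq)
  have inner: "(\<Sum>l<N2. \<beta> l * wt m (k * l)) = (\<Sum>b<m. B b * wt m ((k mod m) * b))" for k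
  proof -
    have "(\<Sum>l<N2. \<beta> l * wt m (k * l)) = (\<Sum>b<m. \<Sum>l\<in>{l. l < N2 \<and> l mod m = b}. \<beta> l * wt m (k * l))"
      by (rule sum_group_mod[OF m0, symmetric])
    also have "\<dots> = (\<Sum>b<m. \<Sum>l\<in>{l. l < N2 \<and> l mod m = b}. \<beta> l * wt m ((k mod m) * b))"
      by (intro sum.cong refl) (subst w_mod, auto)
    finally show ?thesis by (simp add: B_def class_sum_def sum_distrib_right)
  qed
  have "(\<Sum>k<N1. \<Sum>l<N2. \<alpha> k * \<beta> l * wt m (k * l)) = (\<Sum>k<N1. \<alpha> k * (\<Sum>b<m. B b * wt m ((k mod m) * b)))"
    unfolding inner[symmetric] by (simp add: sum_distrib_left mult.assoc)
  also have "\<dots> = (\<Sum>a<m. \<Sum>k\<in>{k. k < N1 \<and> k mod m = a}. \<alpha> k * (\<Sum>b<m. B b * wt m ((k mod m) * b)))"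
    by (rule sum_group_mod[OF m0, symmetric])
  also have "\<dots> = (\<Sum>a<m. \<Sum>k\<in>{k. k < N1 \<and> k mod m = a}. \<alpha> k * (\<Sum>b<m. B b * wt m (a * b)))"
    by (intro sum.cong refl) auto
  also have "\<dots> = (\<Sum>a<m. A a * (\<Sum>b<m. B b * wt m (a * b)))"
    by (simp add: A_def class_sum_def sum_distrib_right)
  also have "\<dots> = (\<Sum>a<m. A a * (\<Sum>b<m. B' b * wt m (a * b)))"
  proof (rule sum.cong[OF refl], rule arg_cong2[of _ _ _ _ "(*)", OF refl])
    fix a
    have "(\<Sum>b<m. B b * wt m (a * b)) = (\<Sum>b<m. B' b * wt m (a * b) + (\<Sum>n<N2. \<beta> n) / m * wt m (a * b))"
      by (intro sum.cong refl) (simp add: B'_def algebra_simps)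
    also have "\<dots> = (\<Sum>b<m. B' b * wt m (a * b)) + (\<Sum>n<N2. \<beta> n) / m * (\<Sum>b<m. wt m (a * b))"
      by (simp only: sum.distrib sum_distrib_left)
    finally show "(\<Sum>b<m. B b * wt m (a * b)) = (\<Sum>b<m. B' b * wt m (a * b))"
      by (simp add: sum_wt_row[OF m])
  qed
  also have "\<dots> = (\<Sum>b<m. B' b * (\<Sum>a<m. A a * wt m (b * a)))"
    unfolding sum_distrib_left by (subst sum.swap) (simp add: mult_ac)
  also have "\<dots> = (\<Sum>b<m. B' b * (\<Sum>a<m. A' a * wt m (b * a)))"
  proof (rule sum.cong[OF refl], rule arg_cong2[of _ _ _ _ "(*)", OF refl])
    fix b
    have "(\<Sum>a<m. A a * wt m (b * a)) = (\<Sum>a<m. A' a * wt m (b * a) + (\<Sum>n<N1. \<alpha> n) / m * wt m (b * a))"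
      by (intro sum.cong refl) (simp add: A'_def algebra_simps)
    also have "\<dots> = (\<Sum>a<m. A' a * wt m (b * a)) + (\<Sum>n<N1. \<alpha> n) / m * (\<Sum>a<m. wt m (b * a))"
      by (simp only: sum.distrib sum_distrib_left)
    finally show "(\<Sum>a<m. A a * wt m (b * a)) = (\<Sum>a<m. A' a * wt m (b * a))"
      by (simp add: sum_wt_row[OF m])
  qed
  also have "\<dots> = (\<Sum>(b, a)\<in>{..<m} \<times> {..<m}. B' b * A' a * wt m (b * a))"
    by (simp add: sum.cartesian_product sum_distrib_left mult.assoc)
  also have "\<bar>\<dots>\<bar> \<le> (\<Sum>(b, a)\<in>{..<m} \<times> {..<m}. \<bar>B' b * A' a * wt m (b * a)\<bar>)"
    by (rule order.trans[OF sum_abs]) (simp add: case_prod_unfold)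
  also have "\<dots> = (\<Sum>p\<in>{..<m} \<times> {..<m}. sqrt ((B' (fst p))\<^sup>2 * \<bar>wt m (fst p * snd p)\<bar>) * sqrt ((A' (snd p))\<^sup>2 * \<bar>wt m (fst p * snd p)\<bar>))"
    by (intro sum.cong refl) (auto simp: real_sqrt_mult abs_mult)
  also have "\<dots> \<le> sqrt (\<Sum>p\<in>{..<m} \<times> {..<m}. (B' (fst p))\<^sup>2 * \<bar>wt m (fst p * snd p)\<bar>) *
       sqrt (\<Sum>p\<in>{..<m} \<times> {..<m}. (A' (snd p))\<^sup>2 * \<bar>wt m (fst p * snd p)\<bar>)"
    by (rule sum_sqrt_mult_le) auto
  also have "\<dots> \<le> sqrt (2 * class_var \<beta> N2 m) * sqrt (2 * class_var \<alpha> N1 m)"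
  proof (intro mult_mono real_sqrt_le_mono)
    have "(\<Sum>p\<in>{..<m} \<times> {..<m}. (B' (fst p))\<^sup>2 * \<bar>wt m (fst p * snd p)\<bar>) = (\<Sum>b<m. (B' b)\<^sup>2 * (\<Sum>a<m. \<bar>wt m (b * a)\<bar>))"
      by (simp add: sum_distrib_left sum.cartesian_product case_prod_unfold)
    also have "\<dots> \<le> (\<Sum>b<m. (B' b)\<^sup>2 * 2)"
      by (intro sum_mono mult_left_mono sum_wt_row m) auto
    finally show "(\<Sum>p\<in>{..<m} \<times> {..<m}. (B' (fst p))\<^sup>2 * \<bar>wt m (fst p * snd p)\<bar>) \<le> 2 * class_var \<beta> N2 m"
      by (simp add: class_var_def B'_def B_def sum_distrib_left mult.commute)
    have "(\<Sum>p\<in>{..<m} \<times> {..<m}. (A' (snd p))\<^sup>2 * \<bar>wt m (fst p * snd p)\<bar>) = (\<Sum>b<m. \<Sum>a<m. (A' a)\<^sup>2 * \<bar>wt m (b * a)\<bar>)"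
      by (simp add: sum.cartesian_product case_prod_unfold)
    also have "\<dots> = (\<Sum>a<m. (A' a)\<^sup>2 * (\<Sum>b<m. \<bar>wt m (a * b)\<bar>))"
      by (subst sum.swap) (simp add: sum_distrib_left mult.commute)
    also have "\<dots> \<le> (\<Sum>a<m. (A' a)\<^sup>2 * 2)"
      by (intro sum_mono mult_left_mono sum_wt_row m) auto
    finally show "(\<Sum>p\<in>{..<m} \<times> {..<m}. (A' (snd p))\<^sup>2 * \<bar>wt m (fst p * snd p)\<bar>) \<le> 2 * class_var \<alpha> N1 m"
      by (simp add: class_var_def A'_def A_def sum_distrib_left mult.commute)
  qed (auto simp: class_var_def sum_nonneg)
  also have "\<dots> = 2 * (sqrt (class_var \<alpha> N1 m) * sqrt (class_var \<beta> N2 m))"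
    by (simp add: real_sqrt_mult)
  finally show ?thesis .
qed

lemma class_var_nonneg: "class_var f N m \<ge> 0"
  by (simp add: class_var_def sum_nonneg)

lemma ls_bound_nonneg: "ls_bound Q N \<ge> 0"
  unfolding ls_bound_def using harm_nonneg[where 'a = real] by simp

text \<open>The sieve inequality carries the weight \<open>m\<close>, so \<open>R <= m\<close> gains
  a factor \<open>1 / R\<close>; Cauchy-Schwarz over the moduli joins the two variances.\<close>

lemma bilinear_large_sieve:
  fixes R :: real
  assumes M: "finite M" "\<And>m. m \<in> M \<Longrightarrow> prime m \<and> R \<le> m \<and> m \<le> Q" and R: "R > 0"
  shows "(\<Sum>m\<in>M. \<bar>\<Sum>k<N1. \<Sum>l<N2. \<alpha> k * \<beta> l * wt m (k * l)\<bar>)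
     \<le> 2 / R * (sqrt (ls_bound Q N1 * ls_bound Q N2) * (sqrt (\<Sum>k<N1. (\<alpha> k)\<^sup>2) * sqrt (\<Sum>l<N2. (\<beta> l)\<^sup>2)))"
proof -
  have var: "(\<Sum>m\<in>M. class_var f N m) \<le> ls_bound Q N * (\<Sum>n<N. (f n)\<^sup>2) / R" for f N
  proof -
    have "R * (\<Sum>m\<in>M. class_var f N m) \<le> (\<Sum>m\<in>M. m * class_var f N m)"
      unfolding sum_distrib_left using M class_var_nonneg by (intro sum_mono mult_right_mono) auto
    also have "\<dots> \<le> ls_bound Q N * (\<Sum>n<N. (f n)\<^sup>2)" using M by (intro large_sieve_class_var) auto
    finally show ?thesis using R by (simp add: field_simps)
  qed
  have "(\<Sum>m\<in>M. \<bar>\<Sum>k<N1. \<Sum>l<N2. \<alpha> k * \<beta> l * wt m (k * l)\<bar>)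
      \<le> (\<Sum>m\<in>M. 2 * (sqrt (class_var \<alpha> N1 m) * sqrt (class_var \<beta> N2 m)))"
    using M by (intro sum_mono bilinear_wt_bound) auto
  also have "\<dots> \<le> 2 * (sqrt (\<Sum>m\<in>M. class_var \<alpha> N1 m) * sqrt (\<Sum>m\<in>M. class_var \<beta> N2 m))"
    unfolding sum_distrib_left[symmetric]
    by (intro mult_left_mono sum_sqrt_mult_le) (auto intro: class_var_nonneg)
  also have "\<dots> \<le> 2 * (sqrt (ls_bound Q N1 * (\<Sum>k<N1. (\<alpha> k)\<^sup>2) / R) * sqrt (ls_bound Q N2 * (\<Sum>l<N2. (\<beta> l)\<^sup>2) / R))"
    using R by (intro mult_left_mono mult_mono real_sqrt_le_mono var) (auto intro!: divide_nonneg_nonneg mult_nonneg_nonneg sum_nonneg class_var_nonneg ls_bound_nonneg)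
  also have "\<dots> = 2 / R * (sqrt (ls_bound Q N1 * ls_bound Q N2) * (sqrt (\<Sum>k<N1. (\<alpha> k)\<^sup>2) * sqrt (\<Sum>l<N2. (\<beta> l)\<^sup>2)))"
    using R by (simp add: real_sqrt_mult real_sqrt_divide)
  finally show ?thesis .
qed

text \<open>The highest binary digit in which \<open>l\<close> and \<open>y\<close> differ separates the variables in the condition
  \<open>l < y\<close> at the cost of only \<open>J\<close> terms.\<close>

lemma less_iff_binary_digit:
  fixes l y :: nat
  assumes "l < 2 ^ J" "y < 2 ^ J"
  shows "(\<Sum>j<J. of_bool (odd (y div 2 ^ j) \<and> l div 2 ^ j + 1 = y div 2 ^ j)) = (of_bool (l < y) :: real)"
  using assms
proof (induction J arbitrary: l y)
  case (Suc J)
  have "(\<Sum>j<Suc J. of_bool (odd (y div 2 ^ j) \<and> l div 2 ^ j + 1 = y div 2 ^ j) :: real) =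
     of_bool (odd y \<and> l + 1 = y) + (\<Sum>j<J. of_bool (odd ((y div 2) div 2 ^ j) \<and> (l div 2) div 2 ^ j + 1 = (y div 2) div 2 ^ j))"
    by (simp add: sum.lessThan_Suc_shift div_mult2_eq del: sum.lessThan_Suc)
  also have "\<dots> = of_bool (odd y \<and> l + 1 = y) + of_bool (l div 2 < y div 2)"
    using Suc.prems by (subst Suc.IH) auto
  also have "\<dots> = of_bool (l < y)"
  proof -
    have "l < y \<longleftrightarrow> (odd y \<and> l + 1 = y) \<or> l div 2 < y div 2"
      "\<not> ((odd y \<and> l + 1 = y) \<and> l div 2 < y div 2)" by presburger+
    then show ?thesis by auto
  qed
  finally show ?case .
qed simp

text \<open>For each digit position \<open>j\<close> the condition \<open>l < y k\<close> becomes a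
  sum over \<open>c\<close> of products of a condition on \<open>k\<close> and one on
  \<open>l\<close>. For fixed \<open>j\<close>, each \<open>k\<close> and each \<open>l\<close>
  belongs to at most one \<open>c\<close>, so Cauchy-Schwarz over \<open>c\<close> restores the full
  norms. Only the number \<open>J\<close> of digit positions is lost, not the number of
  blocks.\<close>

lemma bilinear_cutoff:
  fixes R :: real
  assumes M: "finite M" "\<And>m. m \<in> M \<Longrightarrow> prime m \<and> R \<le> m \<and> m \<le> Q" and R: "R > 0"
    and y: "\<And>k. y k < 2 ^ J" and N2: "N2 \<le> 2 ^ J"
  shows "(\<Sum>m\<in>M. \<bar>\<Sum>k<N1. \<Sum>l<N2. \<alpha> k * \<beta> l * of_bool (l < y k) * wt m (k * l)\<bar>)
     \<le> J * (2 / R * (sqrt (ls_bound Q N1 * ls_bound Q N2) * (sqrt (\<Sum>k<N1. (\<alpha> k)\<^sup>2) * sqrt (\<Sum>l<N2. (\<beta> l)\<^sup>2))))"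
proof -
  define \<alpha>' where "\<alpha>' = (\<lambda>j c k. \<alpha> k * of_bool (odd c \<and> y k div 2 ^ j = c))"
  define \<beta>' where "\<beta>' = (\<lambda>j c l. \<beta> l * of_bool (l div 2 ^ j + 1 = c))"
  define C where "C = {..(2::nat) ^ J}"
  define K where "K = 2 / R * sqrt (ls_bound Q N1 * ls_bound Q N2)"
  have K: "K \<ge> 0" unfolding K_def
    using R by (intro mult_nonneg_nonneg real_sqrt_ge_zero ls_bound_nonneg) auto
  have split: "\<alpha> k * \<beta> l * of_bool (l < y k) * t = (\<Sum>j<J. \<Sum>c\<in>C. \<alpha>' j c k * \<beta>' j c l * t)" if "l < N2" for k l t
  proof -
    have yC: "y k div 2 ^ j \<in> C" for j
      unfolding C_def using y[of k] by (auto intro: order.trans[OF div_le_dividend])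
    have "(\<Sum>c\<in>C. \<alpha>' j c k * \<beta>' j c l) = \<alpha> k * \<beta> l * of_bool (odd (y k div 2 ^ j) \<and> l div 2 ^ j + 1 = y k div 2 ^ j)" for j
    proof -
      have "(\<Sum>c\<in>C. \<alpha>' j c k * \<beta>' j c l) = (\<Sum>c\<in>C. if c = y k div 2 ^ j then \<alpha> k * \<beta> l * of_bool (odd (y k div 2 ^ j) \<and> l div 2 ^ j + 1 = y k div 2 ^ j) else 0)"
        by (intro sum.cong refl) (auto simp: \<alpha>'_def \<beta>'_def)
      also have "\<dots> = \<alpha> k * \<beta> l * of_bool (odd (y k div 2 ^ j) \<and> l div 2 ^ j + 1 = y k div 2 ^ j)"
        using yC by (subst sum.delta) (auto simp: C_def)
      finally show ?thesis .
    qed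
    then have "(\<Sum>j<J. \<Sum>c\<in>C. \<alpha>' j c k * \<beta>' j c l * t) =
       \<alpha> k * \<beta> l * t * (\<Sum>j<J. of_bool (odd (y k div 2 ^ j) \<and> l div 2 ^ j + 1 = y k div 2 ^ j))"
      by (simp only: sum_distrib_right[symmetric] sum_distrib_left[symmetric] mult_ac)
    also have "(\<Sum>j<J. of_bool (odd (y k div 2 ^ j) \<and> l div 2 ^ j + 1 = y k div 2 ^ j) :: real) = of_bool (l < y k)"
      using that N2 y by (intro less_iff_binary_digit) auto
    finally show ?thesis by (simp add: mult_ac)
  qed
  have "(\<Sum>m\<in>M. \<bar>\<Sum>k<N1. \<Sum>l<N2. \<alpha> k * \<beta> l * of_bool (l < y k) * wt m (k * l)\<bar>) =
     (\<Sum>m\<in>M. \<bar>\<Sum>j<J. \<Sum>c\<in>C. \<Sum>k<N1. \<Sum>l<N2. \<alpha>' j c k * \<beta>' j c l * wt m (k * l)\<bar>)"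
  proof (rule sum.cong[OF refl], rule arg_cong[of _ _ abs])
    fix m
    have "(\<Sum>k<N1. \<Sum>l<N2. \<alpha> k * \<beta> l * of_bool (l < y k) * wt m (k * l)) =
      (\<Sum>k<N1. \<Sum>l<N2. \<Sum>j<J. \<Sum>c\<in>C. \<alpha>' j c k * \<beta>' j c l * wt m (k * l))"
      by (intro sum.cong refl split) auto
    also have "\<dots> = (\<Sum>k<N1. \<Sum>j<J. \<Sum>c\<in>C. \<Sum>l<N2. \<alpha>' j c k * \<beta>' j c l * wt m (k * l))"
      by (rule sum.cong[OF refl], rule trans[OF sum.swap], rule sum.cong[OF refl], rule sum.swap)
    also have "\<dots> = (\<Sum>j<J. \<Sum>c\<in>C. \<Sum>k<N1. \<Sum>l<N2. \<alpha>' j c k * \<beta>' j c l * wt m (k * l))"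
      by (rule trans[OF sum.swap], rule sum.cong[OF refl], rule sum.swap)
    finally show "(\<Sum>k<N1. \<Sum>l<N2. \<alpha> k * \<beta> l * of_bool (l < y k) * wt m (k * l)) =
      (\<Sum>j<J. \<Sum>c\<in>C. \<Sum>k<N1. \<Sum>l<N2. \<alpha>' j c k * \<beta>' j c l * wt m (k * l))" .
  qed
  also have "\<dots> \<le> (\<Sum>m\<in>M. \<Sum>j<J. \<Sum>c\<in>C. \<bar>\<Sum>k<N1. \<Sum>l<N2. \<alpha>' j c k * \<beta>' j c l * wt m (k * l)\<bar>)"
    by (rule sum_mono, rule order.trans[OF sum_abs], rule sum_mono, rule sum_abs)
  also have "\<dots> = (\<Sum>j<J. \<Sum>c\<in>C. \<Sum>m\<in>M. \<bar>\<Sum>k<N1. \<Sum>l<N2. \<alpha>' j c k * \<beta>' j c l * wt m (k * l)\<bar>)"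
    by (rule trans[OF sum.swap], rule sum.cong[OF refl], rule sum.swap)
  also have "\<dots> \<le> (\<Sum>j<J. \<Sum>c\<in>C. K * (sqrt (\<Sum>k<N1. (\<alpha>' j c k)\<^sup>2) * sqrt (\<Sum>l<N2. (\<beta>' j c l)\<^sup>2)))"
    by (intro sum_mono order.trans[OF bilinear_large_sieve[OF M R]]) (simp_all add: K_def)
  also have "\<dots> \<le> (\<Sum>j<J. K * (sqrt (\<Sum>k<N1. (\<alpha> k)\<^sup>2) * sqrt (\<Sum>l<N2. (\<beta> l)\<^sup>2)))"
  proof (rule sum_mono)
    fix j
    have 1: "(\<Sum>c\<in>C. \<Sum>k<N1. (\<alpha>' j c k)\<^sup>2) \<le> (\<Sum>k<N1. (\<alpha> k)\<^sup>2)"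
    proof (subst sum.swap, rule sum_mono)
      fix k
      have "(\<Sum>c\<in>C. (\<alpha>' j c k)\<^sup>2) \<le> (\<Sum>c\<in>C. if c = y k div 2 ^ j then (\<alpha> k)\<^sup>2 else 0)"
        by (intro sum_mono) (auto simp: \<alpha>'_def)
      also have "\<dots> \<le> (\<alpha> k)\<^sup>2" by (subst sum.delta) (auto simp: C_def)
      finally show "(\<Sum>c\<in>C. (\<alpha>' j c k)\<^sup>2) \<le> (\<alpha> k)\<^sup>2" .
    qed
    have 2: "(\<Sum>c\<in>C. \<Sum>l<N2. (\<beta>' j c l)\<^sup>2) \<le> (\<Sum>l<N2. (\<beta> l)\<^sup>2)"
    proof (subst sum.swap, rule sum_mono)
      fix l
      have "(\<Sum>c\<in>C. (\<beta>' j c l)\<^sup>2) \<le> (\<Sum>c\<in>C. if c = l div 2 ^ j + 1 then (\<beta> l)\<^sup>2 else 0)"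
        by (intro sum_mono) (auto simp: \<beta>'_def)
      also have "\<dots> \<le> (\<beta> l)\<^sup>2" by (subst sum.delta) (auto simp: C_def)
      finally show "(\<Sum>c\<in>C. (\<beta>' j c l)\<^sup>2) \<le> (\<beta> l)\<^sup>2" .
    qed
    have "(\<Sum>c\<in>C. sqrt (\<Sum>k<N1. (\<alpha>' j c k)\<^sup>2) * sqrt (\<Sum>l<N2. (\<beta>' j c l)\<^sup>2))
        \<le> sqrt (\<Sum>c\<in>C. \<Sum>k<N1. (\<alpha>' j c k)\<^sup>2) * sqrt (\<Sum>c\<in>C. \<Sum>l<N2. (\<beta>' j c l)\<^sup>2)"
      by (intro sum_sqrt_mult_le sum_nonneg) auto
    also have "\<dots> \<le> sqrt (\<Sum>k<N1. (\<alpha> k)\<^sup>2) * sqrt (\<Sum>l<N2. (\<beta> l)\<^sup>2)"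
      using 1 2 by (intro mult_mono real_sqrt_le_mono) (auto simp: sum_nonneg)
    finally show "(\<Sum>c\<in>C. K * (sqrt (\<Sum>k<N1. (\<alpha>' j c k)\<^sup>2) * sqrt (\<Sum>l<N2. (\<beta>' j c l)\<^sup>2)))
        \<le> K * (sqrt (\<Sum>k<N1. (\<alpha> k)\<^sup>2) * sqrt (\<Sum>l<N2. (\<beta> l)\<^sup>2))"
      unfolding sum_distrib_left[symmetric] using K by (intro mult_left_mono)
  qed
  also have "\<dots> = J * (K * (sqrt (\<Sum>k<N1. (\<alpha> k)\<^sup>2) * sqrt (\<Sum>l<N2. (\<beta> l)\<^sup>2)))"
    by simp
  finally show ?thesis by (simp only: K_def mult.assoc)
qed

section \<open>Vaughan's identity\<close>

definition mu :: "nat \<Rightarrow> real" where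
  "mu n = (if squarefree n then (- 1) ^ card (prime_factors n) else 0)"

lemma mu_1 [simp]: "mu (Suc 0) = 1"
  by (simp add: mu_def)

lemma abs_mu_le: "\<bar>mu n\<bar> \<le> 1"
  by (simp add: mu_def power_abs)

lemma mu_prime_mult:
  assumes p: "prime p" and d: "d > 0"
  shows "mu (p * d) = (if p dvd d then 0 else - mu d)"
proof (cases "p dvd d")
  case True
  then have "p ^ 2 dvd p * d" by (auto simp: power2_eq_square)
  then have "\<not> squarefree (p * d)"
    using p not_prime_unit unfolding squarefree_def by blast
  then show ?thesis using True by (simp add: mu_def)
next
  case False
  then have cop: "coprime p d" using p by (rule prime_imp_coprime[rotated])
  have "prime_factors (p * d) = insert p (prime_factors d)"
    using p d by (simp add: prime_factors_product prime_prime_factors)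
  moreover have "p \<notin> prime_factors d" using False by auto
  ultimately have "card (prime_factors (p * d)) = Suc (card (prime_factors d))" by simp
  moreover have "squarefree (p * d) \<longleftrightarrow> squarefree d"
    using squarefree_mult_coprime[OF cop] squarefree_multD(2)[of p d] squarefree_prime[OF p] by blast
  ultimately show ?thesis using False by (simp add: mu_def)
qed

text \<open>Fix a prime \<open>p\<close> dividing \<open>n\<close>. A divisor \<open>d\<close> prime
  to \<open>p\<close> cancels against \<open>p * d\<close>, and the remaining multiples of
  \<open>p\<close> are divisible by its square, so \<open>mu\<close> vanishes there.\<close>

lemma sum_mu_divisors:
  assumes n: "n > 0"
  shows "(\<Sum>d | d dvd n. mu d) = of_bool (n = 1)"
proof (cases "n = 1")
  case False
  then obtain p where p: "prime p" "p dvd n" using prime_factor_nat by blast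
  have fin: "finite {d. d dvd n}" using n by simp
  have pos: "d > 0" if "d dvd n" for d using that n by (auto intro: Nat.gr0I)
  have "(\<Sum>d | d dvd n. mu d) = (\<Sum>d\<in>{d. d dvd n \<and> p dvd d} \<union> {d. d dvd n \<and> \<not> p dvd d}. mu d)"
    by (intro sum.cong) auto
  also have "\<dots> = (\<Sum>d\<in>{d. d dvd n \<and> p dvd d}. mu d) + (\<Sum>d\<in>{d. d dvd n \<and> \<not> p dvd d}. mu d)"
    using fin by (intro sum.union_disjoint) auto
  also have "(\<Sum>d\<in>{d. d dvd n \<and> p dvd d}. mu d) = (\<Sum>d\<in>(*) p ` {d. d dvd n \<and> \<not> p dvd d}. mu d)"
  proof (rule sum.mono_neutral_right)
    show "(*) p ` {d. d dvd n \<and> \<not> p dvd d} \<subseteq> {d. d dvd n \<and> p dvd d}"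
    proof safe
      fix d assume d: "d dvd n" "\<not> p dvd d"
      have "coprime p d" using prime_imp_coprime[OF p(1) d(2)] .
      then show "p * d dvd n" using d p by (intro divides_mult) auto
    qed auto
    show "\<forall>d\<in>{d. d dvd n \<and> p dvd d} - (*) p ` {d. d dvd n \<and> \<not> p dvd d}. mu d = 0"
    proof
      fix d assume d: "d \<in> {d. d dvd n \<and> p dvd d} - (*) p ` {d. d dvd n \<and> \<not> p dvd d}"
      then obtain e where e: "d = p * e" by auto
      have "e dvd n" using d e by (auto intro: dvd_trans[OF dvd_triv_right])
      then have "p dvd e" using d e by auto
      then show "mu d = 0" using mu_prime_mult[OF p(1) pos[OF \<open>e dvd n\<close>]] by (simp add: e)
    qed
  qed (use fin in auto)
  also have "\<dots> = (\<Sum>d\<in>{d. d dvd n \<and> \<not> p dvd d}. mu (p * d))"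
    using p by (subst sum.reindex) (auto simp: inj_on_def)
  also have "\<dots> = - (\<Sum>d\<in>{d. d dvd n \<and> \<not> p dvd d}. mu d)"
    unfolding sum_negf[symmetric] using pos by (intro sum.cong) (auto simp: mu_prime_mult[OF p(1)])
  finally show ?thesis using False by simp
qed simp

lemma sum_divisors_hyperbola:
  fixes F :: "nat \<Rightarrow> nat \<Rightarrow> real"
  shows "(\<Sum>n\<in>{1..x}. \<Sum>d | d dvd n. F d (n div d)) = (\<Sum>d\<in>{1..x}. \<Sum>e\<in>{1..x}. of_bool (d * e \<le> x) * F d e)"
proof -
  have "(\<Sum>n\<in>{1..x}. \<Sum>d | d dvd n. F d (n div d)) = (\<Sum>(n, d)\<in>Sigma {1..x} (\<lambda>n. {d. d dvd n}). F d (n div d))"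
    by (subst sum.Sigma) auto
  also have "\<dots> = (\<Sum>(d, e)\<in>{p\<in>{1..x} \<times> {1..x}. fst p * snd p \<le> x}. F d e)"
  proof (rule sum.reindex_bij_witness[of _ "\<lambda>(d, e). (d * e, d)" "\<lambda>(n, d). (d, n div d)"])
    fix a assume a: "a \<in> Sigma {1..x} (\<lambda>n. {d. d dvd n})"
    obtain n d where nd: "a = (n, d)" by (cases a)
    obtain e where e: "n = d * e" using a nd by auto
    have pos: "d > 0" "e > 0" using a nd e by (auto intro: Nat.gr0I)
    have "d * e \<le> x" using a nd e by auto
    moreover have "d \<le> d * e" "e \<le> d * e" using pos by auto
    ultimately have le: "d \<le> x" "e \<le> x" by linarith+
    show "(case case a of (n, d) \<Rightarrow> (d, n div d) of (d, e) \<Rightarrow> (d * e, d)) = a"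
      "(case a of (n, d) \<Rightarrow> (d, n div d)) \<in> {p \<in> {1..x} \<times> {1..x}. fst p * snd p \<le> x}"
      "(case case a of (n, d) \<Rightarrow> (d, n div d) of (d, e) \<Rightarrow> F d e) = (case a of (n, d) \<Rightarrow> F d (n div d))"
      using pos le a e by (auto simp: nd)
  qed auto
  also have "\<dots> = (\<Sum>p\<in>{1..x} \<times> {1..x}. of_bool (fst p * snd p \<le> x) * F (fst p) (snd p))"
    by (intro sum.mono_neutral_cong_left) auto
  also have "\<dots> = (\<Sum>d\<in>{1..x}. \<Sum>e\<in>{1..x}. of_bool (d * e \<le> x) * F d e)"
    by (simp only: sum.cartesian_product case_prod_unfold)
  finally show ?thesis .
qed

lemma sum_divisors_assoc:
  fixes f g :: "nat \<Rightarrow> real"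
  assumes n: "n > 0"
  shows "(\<Sum>d | d dvd n. f d * (\<Sum>l | l dvd n div d. g l)) = (\<Sum>l | l dvd n. g l * (\<Sum>d | d dvd n div l. f d))"
proof -
  have fin: "finite {d. d dvd n}" using n by simp
  have *: "(\<Sum>d | d dvd n. f d * (\<Sum>l | l dvd n div d. g l)) = (\<Sum>d | d dvd n. \<Sum>l | l dvd n. of_bool (d * l dvd n) * (f d * g l))"
    for f g :: "nat \<Rightarrow> real"
  proof (intro sum.cong refl)
    fix d assume "d \<in> {d. d dvd n}"
    then have d: "d dvd n" "d > 0" using n by (auto intro: Nat.gr0I)
    have iff: "l dvd n div d \<longleftrightarrow> d * l dvd n" for l
      using d by (metis dvd_div_iff_mult mult.commute not_gr0)
    have "(\<Sum>l | l dvd n div d. g l) = (\<Sum>l | l dvd n. of_bool (d * l dvd n) * g l)"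
      using fin by (intro sum.mono_neutral_cong_left) (auto simp: iff intro: dvd_trans[OF dvd_triv_right])
    then show "f d * (\<Sum>l | l dvd n div d. g l) = (\<Sum>l | l dvd n. of_bool (d * l dvd n) * (f d * g l))"
      by (simp add: sum_distrib_left mult_ac)
  qed
  show ?thesis unfolding * by (subst sum.swap) (simp add: mult_ac)
qed

text \<open>The convolution of 1 with \<open>mu\<close> cut off at \<open>U\<close>: the coefficient
  of the bilinear part of Vaughan's identity.\<close>

definition theta :: "nat \<Rightarrow> nat \<Rightarrow> real" where
  "theta U k = (\<Sum>d | d dvd k. mu d * of_bool (d \<le> U))"

lemma theta_eq_0:
  assumes "1 < k" "k \<le> U"
  shows "theta U k = 0"
proof -
  have "theta U k = (\<Sum>d | d dvd k. mu d)" unfolding theta_def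
    using assms by (intro sum.cong refl) (auto dest!: dvd_imp_le)
  then show ?thesis using assms by (simp add: sum_mu_divisors)
qed

lemma abs_theta_le: "\<bar>theta U k\<bar> \<le> card {d. d dvd k}"
proof -
  have "\<bar>theta U k\<bar> \<le> (\<Sum>d | d dvd k. 1)"
    unfolding theta_def by (rule order.trans[OF sum_abs]) (rule sum_mono, use abs_mu_le in \<open>auto simp: abs_mult\<close>)
  then show ?thesis by simp
qed

text \<open>In the first sum, with \<open>l dvd e\<close>, the product \<open>d * e\<close> is
  regrouped as \<open>k * l\<close> with \<open>d dvd k\<close>, which collects
  \<open>theta U k\<close>. The part \<open>k = 1\<close> is the left side and the parts
  \<open>1 < k <= U\<close> vanish. What remains is bilinear with both variables long:
  \<open>k > U\<close>, and \<open>l > V\<close> by the cutoff in \<open>L\<close>.\<close>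

lemma vaughan:
  fixes g :: "nat \<Rightarrow> real" and x U V :: nat
  assumes U: "U \<ge> 1" "x \<ge> 1"
  defines "L \<equiv> (\<lambda>l. mangoldt l * of_bool (V < l) :: real)"
  shows "(\<Sum>n\<in>{1..x}. L n * g n) =
     (\<Sum>d\<in>{1..x}. \<Sum>e\<in>{1..x}. of_bool (d * e \<le> x) * (mu d * of_bool (d \<le> U) * (\<Sum>l | l dvd e. L l) * g (d * e)))
     - (\<Sum>k\<in>{U<..x}. \<Sum>l\<in>{1..x}. of_bool (k * l \<le> x) * (theta U k * L l * g (k * l)))"
proof -
  define T1 where "T1 = (\<Sum>d\<in>{1..x}. \<Sum>e\<in>{1..x}. of_bool (d * e \<le> x) * (mu d * of_bool (d \<le> U) * (\<Sum>l | l dvd e. L l) * g (d * e)))"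
  define G where "G = (\<lambda>k. \<Sum>l\<in>{1..x}. of_bool (k * l \<le> x) * (theta U k * L l * g (k * l)))"
  have "T1 = (\<Sum>n\<in>{1..x}. \<Sum>d | d dvd n. mu d * of_bool (d \<le> U) * (\<Sum>l | l dvd n div d. L l) * g (d * (n div d)))"
    unfolding T1_def by (rule sum_divisors_hyperbola[symmetric])
  also have "\<dots> = (\<Sum>n\<in>{1..x}. (\<Sum>d | d dvd n. (mu d * of_bool (d \<le> U)) * (\<Sum>l | l dvd n div d. L l)) * g n)"
    unfolding sum_distrib_right by (intro sum.cong refl) simp
  also have "\<dots> = (\<Sum>n\<in>{1..x}. (\<Sum>l | l dvd n. L l * theta U (n div l)) * g n)"
    unfolding theta_def by (intro sum.cong refl arg_cong2[of _ _ _ _ "(*)"] sum_divisors_assoc) auto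
  also have "\<dots> = (\<Sum>n\<in>{1..x}. \<Sum>l | l dvd n. theta U (n div l) * L l * g ((n div l) * l))"
    unfolding sum_distrib_right by (intro sum.cong refl) simp
  also have "\<dots> = (\<Sum>l\<in>{1..x}. \<Sum>k\<in>{1..x}. of_bool (l * k \<le> x) * (theta U k * L l * g (k * l)))"
    by (rule sum_divisors_hyperbola)
  also have "\<dots> = (\<Sum>k\<in>{1..x}. G k)"
    unfolding G_def by (subst sum.swap) (simp add: mult.commute)
  also have "\<dots> = G 1 + (\<Sum>k\<in>{2..x}. G k)"
  proof -
    have "{1..x} = insert 1 {2..x}" using U by auto
    then show ?thesis by simp
  qed
  also have "(\<Sum>k\<in>{2..x}. G k) = (\<Sum>k\<in>{U<..x}. G k)"
    using U by (intro sum.mono_neutral_right) (auto simp: G_def theta_eq_0)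
  also have "G 1 = (\<Sum>n\<in>{1..x}. L n * g n)"
  proof -
    have "theta U 1 = 1" using U by (simp add: theta_def)
    then show ?thesis unfolding G_def by (intro sum.cong refl) simp
  qed
  finally show ?thesis unfolding T1_def G_def by simp
qed

text \<open>Makes the type I coefficients accessible: a smooth logarithm minus a sum over short
  \<open>l\<close>.\<close>

lemma sum_mangoldt_gt:
  assumes e: "e > 0"
  shows "(\<Sum>l | l dvd e. mangoldt l * of_bool (V < l)) = ln (real e) - (\<Sum>l | l dvd e. mangoldt l * of_bool (l \<le> V))"
proof -
  have "ln (real e) = (\<Sum>l | l dvd e. mangoldt l)" using e by (simp add: mangoldt_sum)
  also have "\<dots> = (\<Sum>l | l dvd e. mangoldt l * of_bool (V < l) + mangoldt l * of_bool (l \<le> V))"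
    by (intro sum.cong refl) auto
  finally show ?thesis by (simp add: sum.distrib)
qed

section \<open>Mean square of the divisor function\<close>

lemma card_multiples_le:
  assumes l: "(l::nat) > 0"
  shows "card ({1..K} \<inter> {k. l dvd k}) \<le> K div l"
proof -
  have "{1..K} \<inter> {k. l dvd k} \<subseteq> (*) l ` {1..K div l}"
  proof
    fix k assume k: "k \<in> {1..K} \<inter> {k. l dvd k}"
    then obtain e where e: "k = l * e" by auto
    have "e \<ge> 1" using k e by (cases e) auto
    moreover have "e \<le> K div l" using k e l by (simp add: less_eq_div_iff_mult_less_eq mult.commute)
    ultimately show "k \<in> (*) l ` {1..K div l}" using e by auto
  qed
  then have "card ({1..K} \<inter> {k. l dvd k}) \<le> card ((*) l ` {1..K div l})" by (intro card_mono) auto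
  also have "\<dots> \<le> K div l" by (rule order.trans[OF card_image_le]) auto
  finally show ?thesis .
qed

text \<open>The square counts pairs \<open>(a, b)\<close> of divisors of \<open>k\<close>, and at
  most \<open>K / lcm a b\<close> values of \<open>k\<close> are common multiples. With
  \<open>a = g * a'\<close>, \<open>b = g * b'\<close> and \<open>g = gcd a b\<close> the lcm is
  \<open>g * a' * b'\<close>; forgetting that \<open>a'\<close> and \<open>b'\<close> are coprime
  leaves three harmonic sums.\<close>

lemma sum_card_divisors_sq_le:
  "(\<Sum>k\<in>{1..K}. (real (card {d. d dvd k}))\<^sup>2) \<le> K * harm K ^ 3"
proof -
  have dk: "real (card {d. d dvd k}) = (\<Sum>d\<in>{1..K}. of_bool (d dvd k))" if "k \<in> {1..K}" for k
  proof -
    have "d \<in> {1..K}" if "d dvd k" for d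
      using dvd_imp_le[OF that] dvd_pos_nat[OF _ that] \<open>k \<in> {1..K}\<close> by fastforce
    then have "{d. d dvd k} = {1..K} \<inter> {d. d dvd k}" by blast
    moreover have "(\<Sum>d\<in>{1..K}. of_bool (d dvd k) :: real) = card ({1..K} \<inter> {d. d dvd k})" by simp
    ultimately show ?thesis by simp
  qed
  have "(\<Sum>k\<in>{1..K}. (real (card {d. d dvd k}))\<^sup>2) =
      (\<Sum>k\<in>{1..K}. \<Sum>a\<in>{1..K}. \<Sum>b\<in>{1..K}. of_bool (a dvd k \<and> b dvd k))"
    by (intro sum.cong refl) (simp only: dk power2_eq_square sum_product of_bool_conj)
  also have "\<dots> = (\<Sum>a\<in>{1..K}. \<Sum>b\<in>{1..K}. \<Sum>k\<in>{1..K}. of_bool (a dvd k \<and> b dvd k))"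
    by (rule trans[OF sum.swap], rule sum.cong[OF refl], rule sum.swap)
  also have "\<dots> \<le> (\<Sum>a\<in>{1..K}. \<Sum>b\<in>{1..K}. real K / real (lcm a b))"
  proof (intro sum_mono)
    fix a b assume ab: "a \<in> {1..K}" "b \<in> {1..K}"
    define l where "l = lcm a b"
    have l: "l > 0" using ab by (auto simp: l_def intro!: lcm_pos_nat)
    have "(\<Sum>k\<in>{1..K}. of_bool (a dvd k \<and> b dvd k)) = real (card ({1..K} \<inter> {k. l dvd k}))"
      by (simp add: l_def)
    also have "card ({1..K} \<inter> {k. l dvd k}) \<le> K div l" by (rule card_multiples_le[OF l])
    also have "real (K div l) \<le> real K / real l" by (rule of_nat_div_le_of_nat)
    finally show "(\<Sum>k\<in>{1..K}. of_bool (a dvd k \<and> b dvd k)) \<le> real K / real (lcm a b)" by (simp add: l_def)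
  qed
  also have "\<dots> = (\<Sum>p\<in>{1..K} \<times> {1..K}. real K / real (lcm (fst p) (snd p)))"
    by (simp add: sum.cartesian_product case_prod_unfold)
  also have "\<dots> \<le> (\<Sum>(g, a, b)\<in>{1..K} \<times> {1..K} \<times> {1..K}. real K * (1 / real g * (1 / real a * (1 / real b))))"
  proof -
    define f where "f = (\<lambda>p :: nat \<times> nat. (gcd (fst p) (snd p), fst p div gcd (fst p) (snd p), snd p div gcd (fst p) (snd p)))"
    have inj: "inj_on f ({1..K} \<times> {1..K})"
    proof (rule inj_on_inverseI[of _ "\<lambda>(g, a, b). (g * a, g * b)"])
      fix p assume "p \<in> {1..K} \<times> {1..K}"
      then show "(case f p of (g, a, b) \<Rightarrow> (g * a, g * b)) = p" by (auto simp: f_def)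
    qed
    have "(\<Sum>p\<in>{1..K} \<times> {1..K}. real K / real (lcm (fst p) (snd p))) =
       (\<Sum>p\<in>{1..K} \<times> {1..K}. (\<lambda>(g, a, b). real K * (1 / real g * (1 / real a * (1 / real b)))) (f p))"
    proof (intro sum.cong refl)
      fix p :: "nat \<times> nat" assume p: "p \<in> {1..K} \<times> {1..K}"
      obtain a b where ab: "p = (a, b)" by (cases p)
      define g where "g = gcd a b"
      obtain a' where a': "a = g * a'" using gcd_dvd1[of a b] unfolding g_def by (elim dvdE)
      obtain b' where b': "b = g * b'" using gcd_dvd2[of a b] unfolding g_def by (elim dvdE)
      have pos: "g > 0" "a' > 0" "b' > 0" using p ab a' b' by (auto intro: Nat.gr0I)
      have "lcm a b * g = a * b" unfolding g_def by (metis mult.commute prod_gcd_lcm_nat)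
      moreover have "a * b = (g * a' * b') * g" by (subst a', subst b') (simp add: mult_ac)
      ultimately have "lcm a b * g = (g * a' * b') * g" by simp
      then have "lcm a b = g * a' * b'" using pos by simp
      moreover have "a div g = a'" "b div g = b'" using pos a' b' by auto
      ultimately show "real K / real (lcm (fst p) (snd p)) = (\<lambda>(g, a, b). real K * (1 / real g * (1 / real a * (1 / real b)))) (f p)"
        unfolding f_def ab by (simp flip: g_def)
    qed
    also have "\<dots> = (\<Sum>(g, a, b)\<in>f ` ({1..K} \<times> {1..K}). real K * (1 / real g * (1 / real a * (1 / real b))))"
      by (subst sum.reindex[OF inj]) (simp only: comp_def)
    also have "\<dots> \<le> (\<Sum>(g, a, b)\<in>{1..K} \<times> {1..K} \<times> {1..K}. real K * (1 / real g * (1 / real a * (1 / real b))))"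
    proof (rule sum_mono2)
      show "f ` ({1..K} \<times> {1..K}) \<subseteq> {1..K} \<times> {1..K} \<times> {1..K}"
      proof
        fix z assume "z \<in> f ` ({1..K} \<times> {1..K})"
        then obtain p where p: "p \<in> {1..K} \<times> {1..K}" "z = f p" by blast
        obtain a b where "p = (a, b)" by (cases p)
        with p have ab: "a \<in> {1..K}" "b \<in> {1..K}" "z = f (a, b)" by simp_all
        define g where "g = gcd a b"
        have g: "g dvd a" "g dvd b" "g > 0" using ab by (auto simp: g_def gcd_pos_nat)
        have "g \<le> a" "g \<le> b" using g ab by (auto intro!: dvd_imp_le)
        moreover from this g(3) have "a div g > 0" "b div g > 0" by (simp_all add: div_greater_zero_iff)
        moreover have "a div g \<le> K" "b div g \<le> K"
          using ab(1,2) by (auto intro: order.trans[OF div_le_dividend])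
        moreover have "z = (g, a div g, b div g)" using ab(3) by (simp add: f_def g_def)
        ultimately show "z \<in> {1..K} \<times> {1..K} \<times> {1..K}" using ab(1,2) g(3) by auto
      qed
    qed auto
    finally show ?thesis .
  qed
  also have "\<dots> = (\<Sum>g\<in>{1..K}. \<Sum>a\<in>{1..K}. \<Sum>b\<in>{1..K}. real K * (1 / real g * (1 / real a * (1 / real b))))"
    by (simp add: sum.cartesian_product)
  also have "\<dots> = K * harm K ^ 3"
    unfolding sum_distrib_left[symmetric] sum_distrib_right[symmetric]
    by (simp add: harm_def power3_eq_cube inverse_eq_divide mult_ac)
  finally show ?thesis .
qed

section \<open>Chebyshev-type bounds\<close>

lemma sum_of_bool_mult_le:
  fixes f :: "nat \<Rightarrow> real"
  assumes d0: "0 < d"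
  shows "(\<Sum>e\<in>{1..N}. of_bool (d * e \<le> N) * f e) = (\<Sum>e\<in>{1..N div d}. f e)"
proof -
  have iff: "e \<le> N \<and> d * e \<le> N \<longleftrightarrow> e \<le> N div d" for e
  proof -
    have "e \<le> N" if "e \<le> N div d" using that div_le_dividend[of N d] by (rule order.trans)
    then show ?thesis
      using less_eq_div_iff_mult_less_eq[OF d0, of e N] unfolding mult.commute[of e d] by blast
  qed
  have "{1..N} \<inter> {e. d * e \<le> N} = {1..N div d}"
    unfolding set_eq_iff Int_iff mem_Collect_eq atLeastAtMost_iff using iff by blast
  then show ?thesis by simp
qed

lemma sum_ln_eq_sum_mangoldt:
  "(\<Sum>n\<in>{1..N}. ln (real n)) = (\<Sum>d\<in>{1..N}. mangoldt d * real (N div d))"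
proof -
  have "(\<Sum>n\<in>{1..N}. ln (real n)) = (\<Sum>n\<in>{1..N}. \<Sum>d | d dvd n. mangoldt d)"
    by (intro sum.cong refl) (simp add: mangoldt_sum)
  also have "\<dots> = (\<Sum>d\<in>{1..N}. \<Sum>e\<in>{1..N}. of_bool (d * e \<le> N) * mangoldt d)"
    by (rule sum_divisors_hyperbola)
  also have "\<dots> = (\<Sum>d\<in>{1..N}. mangoldt d * real (N div d))"
    by (intro sum.cong refl) (subst sum_of_bool_mult_le, auto)
  finally show ?thesis .
qed

text \<open>Chebyshev's argument: \<open>2 * n div d - 2 * (n div d)\<close> is at most 1, so the
  sum dominates the logarithm of the central binomial coefficient. With \<open>ln 2 >= 2/3\<close>
  and \<open>ln (2 * n) <= n\<close> at least \<open>n / 3\<close> is left.\<close>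

lemma psi_ge:
  assumes n: "n > 0"
  shows "(\<Sum>d\<in>{1..2*n}. mangoldt d :: real) \<ge> real (2 * n) / 8"
proof -
  have lnfact: "ln (fact k :: real) = (\<Sum>i\<in>{1..k}. ln (real i))" for k
    unfolding fact_prod of_nat_prod by (subst ln_prod) auto
  have div: "(\<Sum>d\<in>{1..n}. mangoldt d * real (n div d)) = (\<Sum>d\<in>{1..2*n}. mangoldt d * real (n div d) :: real)"
    by (rule sum.mono_neutral_left) auto
  have "real ((2 * n) choose n) = fact (2 * n) / (fact n * fact n)"
    by (subst binomial_fact) auto
  then have "ln (real ((2 * n) choose n)) = ln (fact (2 * n) :: real) - 2 * ln (fact n :: real)"
    by (simp add: ln_div ln_mult)
  also have "\<dots> = (\<Sum>d\<in>{1..2*n}. mangoldt d * real (2 * n div d)) - 2 * (\<Sum>d\<in>{1..2*n}. mangoldt d * real (n div d))"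
    unfolding lnfact sum_ln_eq_sum_mangoldt div by simp
  also have "\<dots> = (\<Sum>d\<in>{1..2*n}. mangoldt d * (real (2 * n div d) - 2 * real (n div d)))"
    by (simp add: sum_subtractf right_diff_distrib sum_distrib_left mult_ac)
  also have "\<dots> \<le> (\<Sum>d\<in>{1..2*n}. mangoldt d * 1)"
  proof (intro sum_mono mult_left_mono mangoldt_nonneg)
    fix d assume d: "d \<in> {1..2*n}"
    have "n < d * (n div d + 1)" using d dividend_less_times_div[of d n] by simp
    then have "2 * n < (2 * (n div d + 1)) * d" by (simp add: mult_ac)
    then have "2 * n div d < 2 * (n div d + 1)" by (rule less_mult_imp_div_less)
    then have "2 * n div d \<le> 2 * (n div d) + 1" by simp
    then have "real (2 * n div d) \<le> real (2 * (n div d) + 1)" by (simp only: of_nat_le_iff)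
    then show "real (2 * n div d) - 2 * real (n div d) \<le> 1" by simp
  qed
  finally have 1: "ln (real ((2 * n) choose n)) \<le> (\<Sum>d\<in>{1..2*n}. mangoldt d)" by simp
  have "4 ^ n / (2 * real n) \<le> real ((2 * n) choose n)"
    using central_binomial_lower_bound[OF n] by simp
  then have "ln (4 ^ n / (2 * real n)) \<le> ln (real ((2 * n) choose n))"
    using n by (intro ln_mono) auto
  moreover have "ln (4 ^ n / (2 * real n)) = 2 * real n * ln 2 - ln (2 * real n)"
  proof -
    have "ln (4::real) = 2 * ln 2" using ln_realpow[of "2::real" 2] by simp
    then show ?thesis using n by (simp add: ln_div ln_realpow)
  qed
  moreover have "ln (2 * real n) \<le> real n"
  proof -
    have "ln (real n) \<le> real n - 1" using n by (intro ln_le_minus_one) simp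
    moreover have "ln (2::real) \<le> 1" using ln_le_minus_one[of "2::real"] by simp
    ultimately show ?thesis using n by (simp add: ln_mult)
  qed
  moreover have "2 * real n * ln 2 \<ge> 2 * real n * (2 / 3)"
    using ln2_ge_two_thirds by (intro mult_left_mono) auto
  ultimately show ?thesis using 1 by simp
qed

text \<open>A proper prime power \<open>p ^ j\<close> up to \<open>y^2\<close> has
  \<open>p <= y\<close> and \<open>j < J\<close>, so there are at most \<open>y * J\<close> of
  them.\<close>

lemma sum_mangoldt_le_card_primes:
  fixes A :: "nat set"
  assumes A: "A \<subseteq> {1..y\<^sup>2}" and J: "y\<^sup>2 < 2 ^ J" and y: "y \<ge> 1"
  shows "(\<Sum>n\<in>A. mangoldt n) \<le> (real (card {p\<in>A. prime p}) + real y * J) * ln (real (y\<^sup>2))"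
proof -
  have fin: "finite A" using A by (rule finite_subset) simp
  define B where "B = {n\<in>A. primepow n}"
  have "(\<Sum>n\<in>A. mangoldt n :: real) = (\<Sum>n\<in>B. mangoldt n)"
    unfolding B_def using fin by (intro sum.mono_neutral_right) (auto simp: mangoldt_def)
  also have "\<dots> \<le> (\<Sum>n\<in>B. ln (real (y\<^sup>2)))"
  proof (rule sum_mono)
    fix n assume "n \<in> B"
    then have n: "1 \<le> n" "n \<le> y\<^sup>2" using A by (auto simp: B_def)
    have "mangoldt n \<le> ln (real n)" using n by (intro mangoldt_le) auto
    also have "real n \<le> real (y\<^sup>2)" using n by (simp only: of_nat_le_iff)
    then have "ln (real n) \<le> ln (real (y\<^sup>2))" using n by (intro ln_mono) auto
    finally show "mangoldt n \<le> ln (real (y\<^sup>2))" .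
  qed
  also have "\<dots> = card B * ln (real (y\<^sup>2))" by simp
  also have "\<dots> \<le> (real (card {p\<in>A. prime p}) + real y * J) * ln (real (y\<^sup>2))"
  proof (rule mult_right_mono)
    have "B \<subseteq> {p\<in>A. prime p} \<union> (\<lambda>(p, j). p ^ j) ` ({1..y} \<times> {..<J})"
    proof
      fix n assume n: "n \<in> B"
      then obtain p j where pj: "prime p" "j > 0" "n = p ^ j"
        unfolding B_def primepow_def by blast
      have nA: "n \<in> A" "n \<le> y\<^sup>2" using n A by (auto simp: B_def)
      show "n \<in> {p\<in>A. prime p} \<union> (\<lambda>(p, j). p ^ j) ` ({1..y} \<times> {..<J})"
      proof (cases "j = 1")
        case True
        then show ?thesis using pj nA by auto
      next
        case False
        have p2: "p \<ge> 2" using pj(1) by (rule prime_ge_2_nat)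
        have "p ^ 2 \<le> p ^ j" using False pj(2) p2 by (intro power_increasing) auto
        then have "p\<^sup>2 \<le> y\<^sup>2" using nA(2) unfolding pj(3) by (rule order.trans)
        then have "p \<le> y" by (simp add: power2_nat_le_eq_le)
        moreover have "2 ^ j \<le> p ^ j" using p2 by (intro power_mono) auto
        then have "(2::nat) ^ j < 2 ^ J" using nA pj J by linarith
        then have "j < J" by simp
        ultimately show ?thesis using pj p2 by auto
      qed
    qed
    then have "card B \<le> card ({p\<in>A. prime p} \<union> (\<lambda>(p, j). p ^ j) ` ({1..y} \<times> {..<J}))"
      using fin by (intro card_mono) auto
    also have "\<dots> \<le> card {p\<in>A. prime p} + card ((\<lambda>(p, j). p ^ j) ` ({1..y} \<times> {..<J}))"
      by (rule card_Un_le)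
    also have "card ((\<lambda>(p, j). p ^ j) ` ({1..y} \<times> {..<J})) \<le> card ({1..y} \<times> {..<J})"
      by (rule card_image_le) simp
    finally have "card B \<le> card {p\<in>A. prime p} + y * J" by simp
    then have "real (card B) \<le> real (card {p\<in>A. prime p} + y * J)" by (simp only: of_nat_le_iff)
    then show "real (card B) \<le> real (card {p\<in>A. prime p}) + real y * J" by simp
    show "0 \<le> ln (real (y\<^sup>2))" using y by simp
  qed
  finally show ?thesis .
qed

lemma harm_power2_le: "harm (2 ^ a) \<le> real a + 1"
proof (induction a)
  case (Suc a)
  have "harm (2 ^ Suc a) = harm (2 ^ a) + (\<Sum>k\<in>{2 ^ a<..(2::nat) ^ Suc a}. inverse (real k))"
  proof -
    have "{1..2 ^ Suc a} = {1..2 ^ a} \<union> {2 ^ a<..(2::nat) ^ Suc a}" by auto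
    then show ?thesis unfolding harm_def by (simp only:) (rule sum.union_disjoint, auto)
  qed
  also have "(\<Sum>k\<in>{2 ^ a<..(2::nat) ^ Suc a}. inverse (real k)) \<le> (\<Sum>k\<in>{2 ^ a<..(2::nat) ^ Suc a}. inverse (2 ^ a))"
  proof (intro sum_mono le_imp_inverse_le)
    fix k :: nat assume "k \<in> {2 ^ a<..(2::nat) ^ Suc a}"
    then have "2 ^ a \<le> k" by simp
    then have "real (2 ^ a) \<le> real k" by (simp only: of_nat_le_iff)
    then show "2 ^ a \<le> real k" by simp
  qed auto
  also have "\<dots> = 1" by simp
  finally show ?case using Suc by simp
qed (simp add: harm_expand)

section \<open>Type I and type II sums\<close>

text \<open>A full period contributes zero, so periods are peeled off until at most one is left. The
  bound is independent of the length, which is all the equidistribution that type I sums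
  require.\<close>

lemma abs_sum_wt_le:
  assumes m: "prime m"
  shows "\<bar>\<Sum>e<N. wt m (d * e)\<bar> \<le> 2"
proof (induction N rule: less_induct)
  case (less N)
  have m0: "m > 0" using m by (rule prime_gt_0_nat)
  show ?case
  proof (cases "N \<le> m")
    case True
    have "\<bar>\<Sum>e<N. wt m (d * e)\<bar> \<le> (\<Sum>e<N. \<bar>wt m (d * e)\<bar>)" by (rule sum_abs)
    also have "\<dots> \<le> (\<Sum>e<m. \<bar>wt m (d * e)\<bar>)" using True by (intro sum_mono2) auto
    also have "\<dots> \<le> 2" by (rule sum_wt_row[OF m])
    finally show ?thesis .
  next
    case False
    then have "(\<Sum>e<N. wt m (d * e)) = (\<Sum>e\<in>{..<m} \<union> {m..<m + (N - m)}. wt m (d * e))"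
      by (intro sum.cong) auto
    also have "\<dots> = (\<Sum>e<m. wt m (d * e)) + (\<Sum>e\<in>{m..<m + (N - m)}. wt m (d * e))"
      by (rule sum.union_disjoint) auto
    also have "(\<Sum>e\<in>{m..<m + (N - m)}. wt m (d * e)) = (\<Sum>e<N - m. wt m (d * (e + m)))"
      by (rule sum.reindex_bij_witness[of _ "\<lambda>e. e + m" "\<lambda>e. e - m"]) auto
    also have "\<dots> = (\<Sum>e<N - m. wt m (d * e))"
    proof (intro sum.cong refl)
      fix e
      have "d * (e + m) mod m = d * e mod m" by (simp add: distrib_left)
      then show "wt m (d * (e + m)) = wt m (d * e)" using wt_mod by metis
    qed
    finally have "(\<Sum>e<N. wt m (d * e)) = (\<Sum>e<N - m. wt m (d * e))"
      by (simp add: sum_wt_row[OF m])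
    then show ?thesis using less.IH[of "N - m"] False m0 by simp
  qed
qed

lemma abs_sum_wt_le':
  assumes m: "prime m"
  shows "\<bar>\<Sum>e\<in>{1..y}. wt m (d * e)\<bar> \<le> 2"
proof -
  have m2: "m \<ge> 2" using m by (rule prime_ge_2_nat)
  have "(\<Sum>e<Suc y. wt m (d * e)) = (\<Sum>e\<in>{1..y}. wt m (d * e))"
    using m2 by (intro sum.mono_neutral_right) (auto simp: wt_def not_le)
  then show ?thesis using abs_sum_wt_le[OF m, where N = "Suc y" and d = d] by (simp only:)
qed

text \<open>Partial summation, with the induction running on the difference from
  \<open>ln y * F y\<close>. Up to sign its increments are \<open>(ln (y + 1) - ln y) * F y\<close>,
  and their bounds telescope.\<close>

lemma abs_sum_ln_mult_le:
  fixes f :: "nat \<Rightarrow> real"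
  assumes B: "\<And>n. \<bar>\<Sum>e\<in>{1..n}. f e\<bar> \<le> B"
  shows "y \<ge> 1 \<Longrightarrow> \<bar>\<Sum>e\<in>{1..y}. ln (real e) * f e\<bar> \<le> 2 * B * ln (real y)"
proof -
  define F where "F = (\<lambda>n. \<Sum>e\<in>{1..n}. f e)"
  assume y: "y \<ge> 1"
  then have "\<bar>(\<Sum>e\<in>{1..y}. ln (real e) * f e) - ln (real y) * F y\<bar> \<le> B * ln (real y)"
  proof (induction y rule: dec_induct)
    case (step y)
    have "ln (real y) \<le> ln (real (Suc y))" using step by (intro ln_mono) auto
    then have d: "0 \<le> ln (real (Suc y)) - ln (real y)" by simp
    have F: "F (Suc y) = F y + f (Suc y)" by (simp add: F_def)
    have "(\<Sum>e\<in>{1..Suc y}. ln (real e) * f e) - ln (real (Suc y)) * F (Suc y) =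
        ((\<Sum>e\<in>{1..y}. ln (real e) * f e) - ln (real y) * F y) - (ln (real (Suc y)) - ln (real y)) * F y"
      unfolding F by (simp add: algebra_simps)
    also have "\<bar>\<dots>\<bar> \<le> B * ln (real y) + (ln (real (Suc y)) - ln (real y)) * B"
    proof (rule order.trans[OF abs_triangle_ineq4 add_mono])
      show "\<bar>(ln (real (Suc y)) - ln (real y)) * F y\<bar> \<le> (ln (real (Suc y)) - ln (real y)) * B"
        unfolding abs_mult using B[of y] d by (simp only: abs_of_nonneg F_def mult_left_mono)
    qed (rule step.IH)
    finally show ?case by (simp add: algebra_simps)
  qed (simp add: F_def)
  moreover have "\<bar>ln (real y) * F y\<bar> \<le> B * ln (real y)"
  proof -
    have "\<bar>F y\<bar> * ln (real y) \<le> B * ln (real y)"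
      using B[of y] y unfolding F_def by (intro mult_right_mono) auto
    then show ?thesis using y by (simp add: abs_mult mult.commute)
  qed
  ultimately show ?thesis by linarith
qed

lemma mangoldt_le_ln:
  assumes "1 \<le> n" "n \<le> x"
  shows "mangoldt n \<le> ln (real x)"
proof -
  have "mangoldt n \<le> ln (real n)" using assms by (intro mangoldt_le) auto
  also have "\<dots> \<le> ln (real x)" using assms by (intro ln_mono) auto
  finally show ?thesis .
qed

text \<open>For fixed \<open>d\<close>, partial summation on the logarithm costs
  \<open>4 * ln x\<close>, and each of the at most \<open>V\<close> short values \<open>l\<close>
  costs \<open>2 * ln x\<close>. Neither the length of the sums nor \<open>m\<close> enters.\<close>

lemma type_I_bound:
  fixes m x U V :: nat
  assumes m: "prime m" and x: "x \<ge> 1"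
  defines "L \<equiv> (\<lambda>l. mangoldt l * of_bool (V < l) :: real)"
  shows "\<bar>\<Sum>d\<in>{1..x}. \<Sum>e\<in>{1..x}. of_bool (d * e \<le> x) * (mu d * of_bool (d \<le> U) * (\<Sum>l | l dvd e. L l) * wt m (d * e))\<bar>
     \<le> U * ((4 + 2 * V) * ln (real x))"
proof -
  have lnx: "ln (real x) \<ge> 0" using x by simp
  have inner: "\<bar>\<Sum>e\<in>{1..x}. of_bool (d * e \<le> x) * ((\<Sum>l | l dvd e. L l) * wt m (d * e))\<bar> \<le> (4 + 2 * V) * ln (real x)"
    if d: "d \<in> {1..x}" for d
  proof -
    define y where "y = x div d"
    have y: "1 \<le> y" "y \<le> x" using d by (auto simp: y_def div_greater_zero_iff Suc_le_eq)
    have "(\<Sum>e\<in>{1..x}. of_bool (d * e \<le> x) * ((\<Sum>l | l dvd e. L l) * wt m (d * e))) = (\<Sum>e\<in>{1..y}. (\<Sum>l | l dvd e. L l) * wt m (d * e))"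
      unfolding y_def using d by (intro sum_of_bool_mult_le) auto
    also have "\<dots> = (\<Sum>e\<in>{1..y}. ln (real e) * wt m (d * e) - (\<Sum>l | l dvd e. mangoldt l * of_bool (l \<le> V)) * wt m (d * e))"
      unfolding L_def by (intro sum.cong refl) (subst sum_mangoldt_gt, auto simp: left_diff_distrib)
    also have "\<dots> = (\<Sum>e\<in>{1..y}. ln (real e) * wt m (d * e)) - (\<Sum>e\<in>{1..y}. \<Sum>l | l dvd e. mangoldt l * of_bool (l \<le> V) * wt m (d * (l * (e div l))))"
      unfolding sum_subtractf sum_distrib_right by (intro arg_cong2[of _ _ _ _ "(-)"] sum.cong refl) simp
    also have "(\<Sum>e\<in>{1..y}. \<Sum>l | l dvd e. mangoldt l * of_bool (l \<le> V) * wt m (d * (l * (e div l)))) =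
       (\<Sum>l\<in>{1..y}. \<Sum>e\<in>{1..y}. of_bool (l * e \<le> y) * (mangoldt l * of_bool (l \<le> V) * wt m (d * (l * e))))"
      by (rule sum_divisors_hyperbola)
    also have "\<dots> = (\<Sum>l\<in>{1..y}. mangoldt l * of_bool (l \<le> V) * (\<Sum>e\<in>{1..y div l}. wt m ((d * l) * e)))"
      by (intro sum.cong refl) (subst sum_of_bool_mult_le, auto simp: sum_distrib_left mult.assoc)
    finally have eq: "(\<Sum>e\<in>{1..x}. of_bool (d * e \<le> x) * ((\<Sum>l | l dvd e. L l) * wt m (d * e))) =
      (\<Sum>e\<in>{1..y}. ln (real e) * wt m (d * e)) - (\<Sum>l\<in>{1..y}. mangoldt l * of_bool (l \<le> V) * (\<Sum>e\<in>{1..y div l}. wt m ((d * l) * e)))" .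
    have "\<bar>\<Sum>e\<in>{1..y}. ln (real e) * wt m (d * e)\<bar> \<le> 2 * 2 * ln (real y)"
      using y by (intro abs_sum_ln_mult_le abs_sum_wt_le' m)
    also have "\<dots> \<le> 4 * ln (real x)" using y by simp
    finally have 1: "\<bar>\<Sum>e\<in>{1..y}. ln (real e) * wt m (d * e)\<bar> \<le> 4 * ln (real x)" .
    have "\<bar>\<Sum>l\<in>{1..y}. mangoldt l * of_bool (l \<le> V) * (\<Sum>e\<in>{1..y div l}. wt m ((d * l) * e))\<bar> \<le>
      (\<Sum>l\<in>{1..y}. ln (real x) * of_bool (l \<le> V) * 2)"
    proof (rule order.trans[OF sum_abs], rule sum_mono)
      fix l assume l: "l \<in> {1..y}"
      have "\<bar>mangoldt l * of_bool (l \<le> V) * (\<Sum>e\<in>{1..y div l}. wt m ((d * l) * e))\<bar> =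
        mangoldt l * of_bool (l \<le> V) * \<bar>\<Sum>e\<in>{1..y div l}. wt m ((d * l) * e)\<bar>"
        by (simp add: abs_mult)
      also have "\<dots> \<le> ln (real x) * of_bool (l \<le> V) * 2"
        using l y lnx by (intro mult_mono mangoldt_le_ln abs_sum_wt_le' m) (auto simp: mangoldt_nonneg)
      finally show "\<bar>mangoldt l * of_bool (l \<le> V) * (\<Sum>e\<in>{1..y div l}. wt m ((d * l) * e))\<bar> \<le> ln (real x) * of_bool (l \<le> V) * 2" .
    qed
    also have "\<dots> = 2 * ln (real x) * card ({1..y} \<inter> {l. l \<le> V})"
      by (simp flip: sum_distrib_left sum_distrib_right)
    also have "\<dots> \<le> 2 * ln (real x) * V"
    proof -
      have "card ({1..y} \<inter> {l. l \<le> V}) \<le> card {1..V}" by (intro card_mono) auto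
      then show ?thesis using lnx by (intro mult_left_mono) auto
    qed
    finally have 2: "\<bar>\<Sum>l\<in>{1..y}. mangoldt l * of_bool (l \<le> V) * (\<Sum>e\<in>{1..y div l}. wt m ((d * l) * e))\<bar> \<le> 2 * ln (real x) * V" .
    have "(4 + 2 * V) * ln (real x) = 4 * ln (real x) + 2 * ln (real x) * V" by (simp add: algebra_simps)
    then show ?thesis unfolding eq using 1 2 by linarith
  qed
  have "\<bar>\<Sum>d\<in>{1..x}. \<Sum>e\<in>{1..x}. of_bool (d * e \<le> x) * (mu d * of_bool (d \<le> U) * (\<Sum>l | l dvd e. L l) * wt m (d * e))\<bar>
      = \<bar>\<Sum>d\<in>{1..x}. mu d * of_bool (d \<le> U) * (\<Sum>e\<in>{1..x}. of_bool (d * e \<le> x) * ((\<Sum>l | l dvd e. L l) * wt m (d * e)))\<bar>"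
    unfolding sum_distrib_left[where A = "{1..x}"]
    by (rule arg_cong[of _ _ abs]) (intro sum.cong refl, simp add: mult_ac)
  also have "\<dots> \<le> (\<Sum>d\<in>{1..x}. of_bool (d \<le> U) * ((4 + 2 * V) * ln (real x)))"
  proof (rule order.trans[OF sum_abs], rule sum_mono)
    fix d assume d: "d \<in> {1..x}"
    have "\<bar>mu d\<bar> * of_bool (d \<le> U) * \<bar>\<Sum>e\<in>{1..x}. of_bool (d * e \<le> x) * ((\<Sum>l | l dvd e. L l) * wt m (d * e))\<bar>
       \<le> 1 * of_bool (d \<le> U) * ((4 + 2 * V) * ln (real x))"
      using lnx d by (intro mult_mono abs_mu_le inner) auto
    then show "\<bar>mu d * of_bool (d \<le> U) * (\<Sum>e\<in>{1..x}. of_bool (d * e \<le> x) * ((\<Sum>l | l dvd e. L l) * wt m (d * e)))\<bar>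
       \<le> of_bool (d \<le> U) * ((4 + 2 * V) * ln (real x))" by (simp add: abs_mult)
  qed
  also have "\<dots> = card ({1..x} \<inter> {d. d \<le> U}) * ((4 + 2 * V) * ln (real x))"
    unfolding sum_distrib_right[symmetric] by simp
  also have "\<dots> \<le> U * ((4 + 2 * V) * ln (real x))"
  proof -
    have "card ({1..x} \<inter> {d. d \<le> U}) \<le> card {1..U}" by (intro card_mono) auto
    then show ?thesis using lnx by (intro mult_right_mono) auto
  qed
  finally show ?thesis .
qed

section \<open>Dyadic decomposition of the type II sum\<close>

lemma sum_dyadic:
  fixes f :: "nat \<Rightarrow> real"
  shows "(\<Sum>i<J. \<Sum>k<2 ^ Suc i. of_bool (2 ^ i \<le> k) * f k) = (\<Sum>k\<in>{1..<2 ^ J}. f k)"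
proof (induction J)
  case (Suc J)
  have "(\<Sum>k<2 ^ Suc J. of_bool (2 ^ J \<le> k) * f k) = (\<Sum>k\<in>{2 ^ J..<2 ^ Suc J}. f k)"
    by (intro sum.mono_neutral_cong_right) auto
  moreover have "(\<Sum>k\<in>{1..<2 ^ J}. f k) + (\<Sum>k\<in>{2 ^ J..<2 ^ Suc J}. f k) = (\<Sum>k\<in>{1..<2 ^ Suc J}. f k)"
    by (rule sum.atLeastLessThan_concat) auto
  ultimately show ?case using Suc by simp
qed simp

text \<open>The range of \<open>l\<close> now depends only on the dyadic block of \<open>k\<close>,
  and the hyperbola survives as \<open>l < x div k + 1\<close>, the shape that
  \<open>bilinear_cutoff\<close> accepts.\<close>

lemma type_II_dyadic:
  fixes x U V :: nat and g :: "nat \<Rightarrow> real"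
  assumes J: "2 * (x + 1) \<le> (2::nat) ^ J" and U: "U \<ge> 1"
  defines "L \<equiv> (\<lambda>l. mangoldt l * of_bool (V < l) :: real)"
  shows "(\<Sum>k\<in>{U<..x}. \<Sum>l\<in>{1..x}. of_bool (k * l \<le> x) * (theta U k * L l * g (k * l))) =
    (\<Sum>i<J. \<Sum>k<2 ^ Suc i. \<Sum>l<x div 2 ^ i + 1.
       (theta U k * of_bool (U < k \<and> 2 ^ i \<le> k)) * L l * of_bool (l < x div k + 1) * g (k * l))"
proof -
  have L0: "L 0 = 0" by (simp add: L_def)
  define G where "G = (\<lambda>k. of_bool (U < k) * (\<Sum>l\<in>{1..x div k}. theta U k * L l * g (k * l)))"
  have "(\<Sum>i<J. \<Sum>k<2 ^ Suc i. \<Sum>l<x div 2 ^ i + 1.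
       (theta U k * of_bool (U < k \<and> 2 ^ i \<le> k)) * L l * of_bool (l < x div k + 1) * g (k * l)) =
     (\<Sum>i<J. \<Sum>k<2 ^ Suc i. of_bool (2 ^ i \<le> k) * G k)"
  proof (rule sum.cong[OF refl], rule sum.cong[OF refl])
    fix i k :: nat
    show "(\<Sum>l<x div 2 ^ i + 1. (theta U k * of_bool (U < k \<and> 2 ^ i \<le> k)) * L l * of_bool (l < x div k + 1) * g (k * l)) =
       of_bool (2 ^ i \<le> k) * G k"
    proof (cases "2 ^ i \<le> k \<and> U < k")
      case True
      then have "x div k \<le> x div 2 ^ i" by (intro div_le_mono2) auto
      then have "(\<Sum>l<x div 2 ^ i + 1. (theta U k * of_bool (U < k \<and> 2 ^ i \<le> k)) * L l * of_bool (l < x div k + 1) * g (k * l)) =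
         (\<Sum>l\<in>{1..x div k}. theta U k * L l * g (k * l))"
        using True L0 by (intro sum.mono_neutral_cong_right) (auto simp: not_le)
      then show ?thesis using True by (simp add: G_def)
    qed (auto simp: G_def)
  qed
  also have "\<dots> = (\<Sum>k\<in>{1..<2 ^ J}. G k)" by (rule sum_dyadic)
  also have "\<dots> = (\<Sum>k\<in>{U<..x}. G k)"
  proof (rule sum.mono_neutral_right)
    have "x < 2 * (x + 1)" by simp
    also note J
    finally have "x < 2 ^ J" .
    then show "{U<..x} \<subseteq> {1..<2 ^ J}" by auto
    show "\<forall>k\<in>{1..<2 ^ J} - {U<..x}. G k = 0" by (auto simp: G_def not_le)
  qed auto
  also have "\<dots> = (\<Sum>k\<in>{U<..x}. \<Sum>l\<in>{1..x}. of_bool (k * l \<le> x) * (theta U k * L l * g (k * l)))"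
    by (intro sum.cong refl) (subst sum_of_bool_mult_le, auto simp: G_def)
  finally show ?thesis by simp
qed

lemma ls_bound_le:
  fixes T :: real
  assumes "real N \<le> 2 * T" "harm (Q\<^sup>2) \<le> real J" "J \<ge> 1" "T \<ge> 0"
  shows "ls_bound Q N \<le> 2 * real J * (T + real (Q\<^sup>2))"
proof -
  have "real N \<le> 2 * real J * T"
  proof -
    have "1 * T \<le> real J * T" using assms by (intro mult_right_mono) auto
    then show ?thesis using assms(1) by simp
  qed
  moreover have "2 * harm (Q\<^sup>2) * real (Q\<^sup>2) \<le> 2 * real J * real (Q\<^sup>2)"
    using assms(2) by (intro mult_right_mono mult_left_mono) auto
  ultimately show ?thesis unfolding ls_bound_def by (simp add: distrib_left)
qed

text \<open>In a block with \<open>k\<close> of size \<open>K\<close> and \<open>l\<close> up to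
  about \<open>T = x / K\<close>, the sieve factors multiply to \<open>(K + Q^2) * (T + Q^2)\<close>
  and the coefficient norms to about \<open>K * T = x\<close>. As only blocks with
  \<open>K <= x / V\<close> and \<open>T <= 2 * x / U\<close> matter, the first product is at most
  \<open>Y\<close>. Long variables on both sides are essential here.\<close>

lemma type_II_bound:
  fixes R Y :: real and x U V Q J :: nat
  assumes M: "finite M" "\<And>m. m \<in> M \<Longrightarrow> prime m \<and> R \<le> m \<and> m \<le> Q" and R: "R > 0"
    and J: "2 * (x + 1) \<le> (2::nat) ^ J" "harm (Q\<^sup>2) \<le> real J" "ln (real x) \<le> J" and x: "x \<ge> 1" and U: "U \<ge> 1" and V: "V \<ge> 1"
  defines "L \<equiv> (\<lambda>l. mangoldt l * of_bool (V < l) :: real)"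
  defines "Y \<equiv> real x + real (Q\<^sup>2) * x / V + 2 * real (Q\<^sup>2) * x / U + real (Q\<^sup>2) * real (Q\<^sup>2)"
  shows "(\<Sum>m\<in>M. \<bar>\<Sum>k\<in>{U<..x}. \<Sum>l\<in>{1..x}. of_bool (k * l \<le> x) * (theta U k * L l * wt m (k * l))\<bar>)
     \<le> 8 * real J ^ 6 * sqrt (x * Y) / R"
proof -
  have J1: "J \<ge> 1" using J(1) x by (cases J) auto
  have Y0: "Y \<ge> 0" unfolding Y_def by (intro add_nonneg_nonneg divide_nonneg_nonneg mult_nonneg_nonneg) auto
  have lnx: "ln (real x) \<ge> 0" using x by simp
  define \<alpha> where "\<alpha> = (\<lambda>i k. theta U k * of_bool (U < k \<and> 2 ^ i \<le> k))"
  have "x + 1 < 2 * (x + 1)" by simp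
  also note J(1)
  finally have small: "x + 1 < 2 ^ J" .
  have "(\<Sum>m\<in>M. \<bar>\<Sum>k\<in>{U<..x}. \<Sum>l\<in>{1..x}. of_bool (k * l \<le> x) * (theta U k * L l * wt m (k * l))\<bar>) =
     (\<Sum>m\<in>M. \<bar>\<Sum>i<J. \<Sum>k<2 ^ Suc i. \<Sum>l<x div 2 ^ i + 1. \<alpha> i k * L l * of_bool (l < x div k + 1) * wt m (k * l)\<bar>)"
    unfolding \<alpha>_def L_def by (intro sum.cong refl arg_cong[of _ _ abs] type_II_dyadic J U)
  also have "\<dots> \<le> (\<Sum>m\<in>M. \<Sum>i<J. \<bar>\<Sum>k<2 ^ Suc i. \<Sum>l<x div 2 ^ i + 1. \<alpha> i k * L l * of_bool (l < x div k + 1) * wt m (k * l)\<bar>)"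
    by (rule sum_mono, rule sum_abs)
  also have "\<dots> = (\<Sum>i<J. \<Sum>m\<in>M. \<bar>\<Sum>k<2 ^ Suc i. \<Sum>l<x div 2 ^ i + 1. \<alpha> i k * L l * of_bool (l < x div k + 1) * wt m (k * l)\<bar>)"
    by (rule sum.swap)
  also have "\<dots> \<le> (\<Sum>i<J. 8 * real J ^ 5 * sqrt (x * Y) / R)"
  proof (rule sum_mono)
    fix i assume "i \<in> {..<J}"
    define K where "K = (2::nat) ^ i"
    define N1 where "N1 = (2::nat) ^ Suc i"
    define N2 where "N2 = x div K + 1"
    have N1K: "N1 = 2 * K" by (simp add: N1_def K_def)
    have K0: "K > 0" by (simp add: K_def)
    define E1 where "E1 = (\<Sum>k<N1. (\<alpha> i k)\<^sup>2)"
    define E2 where "E2 = (\<Sum>l<N2. (L l)\<^sup>2)"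
    have "y div k + 1 \<le> y + 1" for y k :: nat by simp
    then have cut: "x div k + 1 < (2::nat) ^ J" for k using small by (meson order.strict_trans1)
    have "(\<Sum>m\<in>M. \<bar>\<Sum>k<N1. \<Sum>l<N2. \<alpha> i k * L l * of_bool (l < x div k + 1) * wt m (k * l)\<bar>)
       \<le> J * (2 / R * (sqrt (ls_bound Q N1 * ls_bound Q N2) * (sqrt E1 * sqrt E2)))"
      unfolding E1_def E2_def
      by (rule bilinear_cutoff[OF M R]) (use cut in \<open>auto simp: N2_def less_imp_le\<close>)
    also have "\<dots> = 2 * real J / R * sqrt (ls_bound Q N1 * ls_bound Q N2 * (E1 * E2))"
      by (simp add: real_sqrt_mult)
    also have "\<dots> \<le> 2 * real J / R * sqrt (16 * real J ^ 8 * (x * Y))"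
    proof (intro mult_left_mono real_sqrt_le_mono)
      show "ls_bound Q N1 * ls_bound Q N2 * (E1 * E2) \<le> 16 * real J ^ 8 * (x * Y)"
      proof (cases "N1 \<le> U + 1 \<or> x div K \<le> V")
        \<comment> \<open>Empty blocks: \<open>k < N1 <= U + 1\<close> leaves no
          \<open>k > U\<close>, and \<open>l <= x div K <= V\<close> leaves no
          \<open>l > V\<close>.\<close>
        case True
        then have "E1 * E2 = 0"
        proof
          assume "N1 \<le> U + 1"
          then have "E1 = 0" unfolding E1_def \<alpha>_def by (intro sum.neutral) auto
          then show ?thesis by simp
        next
          assume "x div K \<le> V"
          then have "E2 = 0" unfolding E2_def L_def N2_def by (intro sum.neutral) auto
          then show ?thesis by simp
        qed
        moreover have "0 \<le> 16 * real J ^ 8 * (x * Y)" using Y0 by (intro mult_nonneg_nonneg) auto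
        ultimately show ?thesis by (simp only: mult_zero_right)
      next
        case False
        then have UK: "U \<le> 2 * K" and VK: "V \<le> x div K" using N1K by auto
        have "V * K \<le> x"
          using VK K0 by (simp add: less_eq_div_iff_mult_less_eq)
        then have VKx: "real V * real K \<le> real x" by (metis of_nat_le_iff of_nat_mult)
        have V1: "real V \<ge> 1" using V by simp
        have "1 * real K \<le> real V * real K" using V1 by (intro mult_right_mono) auto
        then have Kx: "real K \<le> real x" using VKx by simp
        define T where "T = real x / real K"
        have T1: "T \<ge> 1" using Kx K0 by (simp add: T_def)
        have "real (x div K) \<le> T" unfolding T_def by (rule of_nat_div_le_of_nat)
        then have N2T: "real N2 \<le> 2 * T" using T1 by (simp add: N2_def)
        have l1: "ls_bound Q N1 \<le> 2 * real J * (real K + real (Q\<^sup>2))"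
          using J J1 N1K by (intro ls_bound_le) auto
        have l2: "ls_bound Q N2 \<le> 2 * real J * (T + real (Q\<^sup>2))"
          using J J1 N2T T1 by (intro ls_bound_le) auto
        have hN1: "harm N1 \<le> real J"
        proof -
          have "2 ^ i \<le> x" using Kx unfolding K_def by (simp only: of_nat_le_iff)
          then have "2 ^ Suc i < 2 * (x + 1)" by simp
          also note J(1)
          finally have "Suc i < J" by (rule power_less_imp_less_exp[rotated]) simp
          then show ?thesis using harm_power2_le[of "Suc i"] unfolding N1_def by linarith
        qed
        have e1: "E1 \<le> 2 * real K * real J ^ 3"
        proof -
          have "E1 \<le> (\<Sum>k\<in>{1..N1}. (real (card {d. d dvd k}))\<^sup>2)"
            unfolding E1_def
          proof (rule order.trans[OF _ sum_mono2])
            show "(\<Sum>k<N1. (\<alpha> i k)\<^sup>2) \<le> (\<Sum>k\<in>{1..<N1}. (real (card {d. d dvd k}))\<^sup>2)"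
            proof (rule order.trans[OF eq_refl sum_mono])
              show "(\<Sum>k<N1. (\<alpha> i k)\<^sup>2) = (\<Sum>k\<in>{1..<N1}. (\<alpha> i k)\<^sup>2)"
                by (intro sum.mono_neutral_right) (auto simp: \<alpha>_def not_le)
              fix k
              have "\<bar>\<alpha> i k\<bar> \<le> real (card {d. d dvd k})"
                using abs_theta_le[of U k] by (auto simp: \<alpha>_def abs_mult)
              then have "\<bar>\<alpha> i k\<bar> ^ 2 \<le> (real (card {d. d dvd k}))\<^sup>2" by (intro power_mono) auto
              then show "(\<alpha> i k)\<^sup>2 \<le> (real (card {d. d dvd k}))\<^sup>2" by simp
            qed
          qed auto
          also have "\<dots> \<le> N1 * harm N1 ^ 3" by (rule sum_card_divisors_sq_le)
          also have "\<dots> \<le> N1 * real J ^ 3"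
            using hN1 harm_nonneg[of N1, where 'a = real] by (intro mult_left_mono power_mono) auto
          finally show ?thesis by (simp add: N1K)
        qed
        have e2: "E2 \<le> 2 * T * real J ^ 2"
        proof -
          have "E2 \<le> (\<Sum>l<N2. (real J)\<^sup>2)"
            unfolding E2_def
          proof (rule sum_mono)
            fix l assume l: "l \<in> {..<N2}"
            have "L l \<le> real J"
            proof (cases "l = 0")
              case False
              have "l \<le> x" using l div_le_dividend[of x K] unfolding N2_def lessThan_iff by linarith
              then have "mangoldt l \<le> ln (real x)" using False by (intro mangoldt_le_ln) auto
              then have "mangoldt l \<le> real J" using J(3) by linarith
              then show ?thesis by (auto simp: L_def)
            qed (simp add: L_def)
            then show "(L l)\<^sup>2 \<le> (real J)\<^sup>2"
              by (intro power_mono) (auto simp: L_def mangoldt_nonneg)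
          qed
          also have "\<dots> = real N2 * (real J)\<^sup>2" by simp
          also have "\<dots> \<le> (2 * T) * (real J)\<^sup>2" using N2T by (intro mult_right_mono) auto
          finally show ?thesis by simp
        qed
        have E0: "E1 \<ge> 0" "E2 \<ge> 0" by (auto simp: E1_def E2_def sum_nonneg)
        have "ls_bound Q N1 * ls_bound Q N2 * (E1 * E2) \<le>
          (2 * real J * (real K + real (Q\<^sup>2))) * (2 * real J * (T + real (Q\<^sup>2))) * ((2 * real K * real J ^ 3) * (2 * T * real J ^ 2))"
          using l1 l2 e1 e2 E0 ls_bound_nonneg T1
          by (intro mult_mono mult_nonneg_nonneg) auto
        also have "\<dots> = 16 * real J ^ 7 * ((real K * T) * (real K * T + real (Q\<^sup>2) * real K + real (Q\<^sup>2) * T + real (Q\<^sup>2) * real (Q\<^sup>2)))"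
        proof -
          have "(2 * j * (k + q)) * (2 * j * (t + q)) * ((2 * k * j ^ 3) * (2 * t * j ^ 2)) =
              16 * j ^ 7 * ((k * t) * (k * t + q * k + q * t + q * q))" for j k t q :: real
            by (simp add: algebra_simps power_numeral_reduce)
          then show ?thesis .
        qed
        also have "real K * T = x" using K0 by (simp add: T_def)
        also have "16 * real J ^ 7 * (x * (x + real (Q\<^sup>2) * K + real (Q\<^sup>2) * T + real (Q\<^sup>2) * real (Q\<^sup>2))) \<le> 16 * real J ^ 8 * (x * Y)"
        proof (rule mult_mono)
          \<comment> \<open>Two factors \<open>J\<close> stem from the sieve, three from the divisor
            function and two from \<open>mangoldt\<close>. The total 7 is rounded up to 8 so that
            the square root is again a power.\<close>
          show "16 * real J ^ 7 \<le> 16 * real J ^ 8" using J1 by (intro mult_left_mono power_increasing) auto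
          have "real K \<le> real x / real V" using VKx V1 by (simp add: field_simps)
          then have 1: "real (Q\<^sup>2) * K \<le> real (Q\<^sup>2) * (real x / real V)" by (intro mult_left_mono) auto
          have "real U \<le> 2 * real K" using UK by (metis of_nat_le_iff of_nat_mult of_nat_numeral)
          then have "real x * real U \<le> real x * (2 * real K)" by (intro mult_left_mono) auto
          then have "T \<le> 2 * real x / real U" using K0 U unfolding T_def by (simp add: field_simps)
          then have 2: "real (Q\<^sup>2) * T \<le> real (Q\<^sup>2) * (2 * real x / real U)" by (intro mult_left_mono) auto
          have "x + real (Q\<^sup>2) * K + real (Q\<^sup>2) * T + real (Q\<^sup>2) * real (Q\<^sup>2) \<le> Y"
            using 1 2 unfolding Y_def by (simp add: mult.left_commute)
          then show "x * (x + real (Q\<^sup>2) * K + real (Q\<^sup>2) * T + real (Q\<^sup>2) * real (Q\<^sup>2)) \<le> x * Y"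
            by (intro mult_left_mono) auto
        qed (use T1 in auto)
        finally show ?thesis .
      qed
    qed (use R in auto)
    also have "sqrt (16 * real J ^ 8 * (x * Y)) = 4 * real J ^ 4 * sqrt (x * Y)"
    proof -
      have "16 * real J ^ 8 = (4 * real J ^ 4)\<^sup>2" by (simp add: power_mult_distrib flip: power_mult)
      then have "sqrt (16 * real J ^ 8) = \<bar>4 * real J ^ 4\<bar>" by (simp only: real_sqrt_abs)
      then show ?thesis by (simp add: real_sqrt_mult)
    qed
    also have "2 * real J / R * (4 * real J ^ 4 * sqrt (x * Y)) = 8 * real J ^ 5 * sqrt (x * Y) / R"
      by (simp add: power_numeral_reduce)
    finally show "(\<Sum>m\<in>M. \<bar>\<Sum>k<2 ^ Suc i. \<Sum>l<x div 2 ^ i + 1. \<alpha> i k * L l * of_bool (l < x div k + 1) * wt m (k * l)\<bar>)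
       \<le> 8 * real J ^ 5 * sqrt (x * Y) / R"
      unfolding N1_def N2_def K_def .
  qed
  also have "\<dots> = 8 * real J ^ 6 * sqrt (x * Y) / R" by (simp add: power_numeral_reduce)
  finally show ?thesis .
qed

section \<open>Moduli with many primes congruent to 1\<close>

text \<open>The discarded \<open>n\<close> are at most \<open>V\<close> small ones and
  \<open>x / m\<close> multiples of \<open>m\<close>, each weighing at most
  \<open>J\<close>.\<close>

lemma sum_mangoldt_coprime_ge:
  fixes x V m J :: nat
  assumes m: "m > 0" and J: "ln (real x) \<le> J"
  shows "(\<Sum>n\<in>{1..x}. mangoldt n * of_bool (V < n) * of_bool (\<not> m dvd n)) \<ge>
    (\<Sum>n\<in>{1..x}. mangoldt n) - real J * V - real J * (x / m)"
proof -
  have le: "mangoldt n \<le> real J" if "n \<in> {1..x}" for n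
    using mangoldt_le_ln[of n x] that J by auto
  have "(\<Sum>n\<in>{1..x}. mangoldt n :: real) \<le> (\<Sum>n\<in>{1..x}. mangoldt n * of_bool (V < n) * of_bool (\<not> m dvd n)
      + real J * of_bool (n \<le> V) + real J * of_bool (m dvd n))"
  proof (rule sum_mono)
    fix n assume "n \<in> {1..x}"
    then have "mangoldt n \<le> real J" by (rule le)
    moreover have "0 \<le> (mangoldt n :: real)" by (rule mangoldt_nonneg)
    ultimately show "mangoldt n \<le> mangoldt n * of_bool (V < n) * of_bool (\<not> m dvd n)
      + real J * of_bool (n \<le> V) + real J * of_bool (m dvd n)" by (auto simp: not_le)
  qed
  also have "\<dots> = (\<Sum>n\<in>{1..x}. mangoldt n * of_bool (V < n) * of_bool (\<not> m dvd n))
      + real J * card ({1..x} \<inter> {n. n \<le> V}) + real J * card ({1..x} \<inter> {n. m dvd n})"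
    unfolding sum.distrib by (simp flip: sum_distrib_left)
  also have "\<dots> \<le> (\<Sum>n\<in>{1..x}. mangoldt n * of_bool (V < n) * of_bool (\<not> m dvd n)) + real J * V + real J * (x / m)"
  proof (intro add_mono mult_left_mono order.refl)
    have "card ({1..x} \<inter> {n. n \<le> V}) \<le> card {1..V}" by (intro card_mono) auto
    then show "real (card ({1..x} \<inter> {n. n \<le> V})) \<le> real V" by simp
    have "real (card ({1..x} \<inter> {n. m dvd n})) \<le> real (x div m)"
      using card_multiples_le[OF m, of x] by (simp only: of_nat_le_iff)
    also have "\<dots> \<le> real x / real m" by (rule of_nat_div_le_of_nat)
    finally show "real (card ({1..x} \<inter> {n. m dvd n})) \<le> real x / real m" .
  qed auto
  finally show ?thesis by simp
qed

text \<open>Every parameter is a power of \<open>q\<close>. All logarithms are then at most \<open>J\<close>, and the powers of \<open>J\<close>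
  in the error terms are absorbed by a saving of one factor \<open>q\<close>.\<close>

lemma exists_modulus_aux:
  fixes s r q J :: nat
  assumes s: "s \<ge> 2" and r: "r \<ge> 1" and q: "q = 2 ^ r" and J: "J = r * (8 * s + 4) + 2"
    and big: "1000000 * real J ^ 10 \<le> real q"
  shows "\<exists>m. q ^ (4 * s - 1) \<le> m \<and> q ^ (4 * s) \<le> card {p. prime p \<and> p \<le> q ^ (8 * s + 4) \<and> p mod m = 1}"
proof -
  \<comment> \<open>Here \<open>Q = U^2\<close>, \<open>x = Q^2 * q^4\<close> and
    \<open>Rn = Q / q\<close>. If \<open>x\<close> were \<open>Q^2 * q^a\<close>, the main term per
    modulus would grow like \<open>q^a\<close> and the mean type II error like
    \<open>q^(a/2 + 1)\<close>, the extra \<open>q\<close> coming from \<open>Rn\<close>. The choice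
    \<open>a = 4\<close> leaves one factor \<open>q\<close>.\<close>
  define x where "x = q ^ (8 * s + 4)"
  define U where "U = q ^ (2 * s)"
  define Q where "Q = q ^ (4 * s)"
  define Rn where "Rn = q ^ (4 * s - 1)"
  define c where "c = real q"
  define u where "u = real U"
  define j where "j = real J"
  have q2: "q \<ge> 2" using r unfolding q by (metis one_le_numeral power_increasing power_one_right)
  have j2: "j \<ge> 2" unfolding j_def J by simp
  have jpow: "j ^ k \<le> j ^ 10" if "k \<le> 10" for k using that j2 by (intro power_increasing) auto
  have cbig: "1000000 * j ^ k \<le> c" if "k \<le> 10" for k
    using big jpow[OF that] unfolding c_def j_def by linarith
  have c1: "1000000 * j \<le> c" using cbig[of 1] by simp
  have c2: "1000000 * j\<^sup>2 \<le> c" using cbig[of 2] by simp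
  have c0: "c \<ge> 2" using q2 by (simp add: c_def)
  have U1: "U \<ge> 1" using q2 by (simp add: U_def)
  have Qeq: "Q = U\<^sup>2" by (simp add: Q_def U_def mult.commute flip: power_mult)
  have xeq: "x = (Q * q\<^sup>2)\<^sup>2"
  proof -
    have "(Q * q\<^sup>2)\<^sup>2 = q ^ ((4 * s + 2) * 2)" by (simp only: Q_def power_add[symmetric] power_mult[symmetric])
    also have "(4 * s + 2) * 2 = 8 * s + 4" by simp
    finally show ?thesis by (simp add: x_def)
  qed
  have Rq: "Rn * q = Q"
  proof -
    have "Rn * q = q ^ Suc (4 * s - 1)" by (simp add: Rn_def)
    also have "Suc (4 * s - 1) = 4 * s" using s by simp
    finally show ?thesis by (simp add: Q_def)
  qed
  have Qu: "real Q = u\<^sup>2" by (simp add: Qeq u_def)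
  have xu: "real x = u ^ 4 * c ^ 4" by (simp add: xeq Qeq u_def c_def power_mult_distrib flip: power_mult)
  have Ru: "real Rn = u\<^sup>2 / c"
  proof -
    have "real Rn * c = u\<^sup>2" unfolding Qu[symmetric] Rq[symmetric] c_def by simp
    then show ?thesis using c0 by (simp add: field_simps)
  qed
  \<comment> \<open>This needs \<open>s >= 2\<close>; it makes \<open>u ^ 8\<close>, that is
    \<open>Q ^ 4\<close>, the dominant size in the type II bound.\<close>
  have uc: "c ^ 4 \<le> u"
  proof -
    have "q ^ 4 \<le> q ^ (2 * s)" using s q2 by (intro power_increasing) auto
    then have "real (q ^ 4) \<le> real (q ^ (2 * s))" by (simp only: of_nat_le_iff)
    then show ?thesis by (simp add: u_def U_def c_def)
  qed
  have cu: "c \<le> u"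
  proof -
    have "c ^ 1 \<le> c ^ 4" using c0 by (intro power_increasing) auto
    then show ?thesis using uc by simp
  qed
  have u1: "u \<ge> 1" using cu c0 by linarith
  have x1: "x \<ge> 1" using q2 by (simp add: x_def)
  \<comment> \<open>The summand 2 in \<open>J\<close> gives this factor 4, which leaves room for
    \<open>2 * (x + 1)\<close>.\<close>
  have x2J: "4 * x = (2::nat) ^ J"
  proof -
    have "x = 2 ^ (r * (8 * s + 4))" by (simp only: x_def q power_mult)
    then show ?thesis by (simp only: J power_add) simp
  qed
  have J1: "2 * (x + 1) \<le> (2::nat) ^ J" unfolding x2J[symmetric] using x1 by simp
  have J2: "harm (Q\<^sup>2) \<le> real J"
  proof -
    have "Q\<^sup>2 = 2 ^ (r * (8 * s))"
    proof -
      have "Q\<^sup>2 = 2 ^ (r * (4 * s) * 2)" by (simp only: Q_def q power_mult)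
      also have "r * (4 * s) * 2 = r * (8 * s)" by simp
      finally show ?thesis .
    qed
    then have "harm (Q\<^sup>2) \<le> real (r * (8 * s)) + 1" using harm_power2_le[of "r * (8 * s)"] by simp
    also have "\<dots> \<le> real J" unfolding J by (simp add: distrib_left)
    finally show ?thesis .
  qed
  have lnJ: "ln (real n) \<le> j" if "1 \<le> n" "n \<le> x" for n
  proof -
    have "n \<le> 2 ^ J" using that unfolding x2J[symmetric] by linarith
    then have "real n \<le> real (2 ^ J)" by (simp only: of_nat_le_iff)
    then have "real n \<le> 2 ^ J" by simp
    then have "ln (real n) \<le> ln (2 ^ J)" using that by (intro ln_mono) auto
    also have "\<dots> = real J * ln 2" by (simp add: ln_realpow)
    also have "\<dots> \<le> real J * 1" using ln_le_minus_one[of "2::real"] by (intro mult_left_mono) auto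
    finally show ?thesis by (simp add: j_def)
  qed
  have lnx: "ln (real x) \<le> real J" using lnJ[of x] x1 by (simp add: j_def)
  have psi: "(\<Sum>d\<in>{1..n}. mangoldt d :: real) \<ge> real n / 8" if "even n" "n > 0" for n
    using psi_ge[of "n div 2"] that by (auto elim!: evenE)
  have evenq: "even (q ^ k)" if "k > 0" for k using that r by (simp add: q)
  define M where "M = {m. prime m \<and> Rn \<le> m \<and> m \<le> Q}"
  have M: "finite M" "\<And>m. m \<in> M \<Longrightarrow> prime m \<and> real Rn \<le> real m \<and> m \<le> Q"
    unfolding M_def by (auto intro: finite_subset[of _ "{..Q}"])
  have Rpos: "real Rn > 0" using q2 by (simp add: Rn_def)

  \<comment> \<open>Chebyshev's bound up to \<open>Q\<close>. The primes below
    \<open>Rn = Q / q\<close> are counted trivially, and they and the prime powers each take away at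
    most a quarter of \<open>u^2 / 8\<close>.\<close>
  have card_M: "u\<^sup>2 / (16 * j) \<le> card M"
  proof -
    define P where "P = {p\<in>{1..Q}. prime p}"
    have "real Q / 8 \<le> (\<Sum>d\<in>{1..Q}. mangoldt d)"
      using psi[of Q] evenq[of "4 * s"] s q2 by (simp add: Q_def)
    also have "\<dots> \<le> (real (card P) + real U * J) * ln (real (U\<^sup>2))"
    proof -
      have "U\<^sup>2 < 2 ^ J"
      proof -
        have "Q \<le> x" unfolding Q_def x_def using q2 by (intro power_increasing) auto
        then show ?thesis unfolding x2J[symmetric] Qeq[symmetric] using x1 by linarith
      qed
      then show ?thesis unfolding P_def Qeq using U1 by (intro sum_mangoldt_le_card_primes) auto
    qed
    also have "\<dots> \<le> (real (card P) + real U * J) * j"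
    proof (intro mult_left_mono)
      have "Q \<le> x" unfolding Q_def x_def using q2 by (intro power_increasing) auto
      moreover have "1 \<le> Q" using q2 by (simp add: Q_def)
      ultimately show "ln (real (U\<^sup>2)) \<le> j" unfolding Qeq[symmetric] by (intro lnJ)
    qed auto
    finally have 1: "u\<^sup>2 / 8 \<le> (card P + u * j) * j" by (simp add: Qu u_def j_def)
    have "card P \<le> card (M \<union> {..<Rn})"
      using M(1) by (intro card_mono) (auto simp: P_def M_def)
    also have "\<dots> \<le> card M + card {..<Rn}" by (rule card_Un_le)
    finally have "card P \<le> card M + Rn" by simp
    then have "real (card P) \<le> real (card M + Rn)" by (simp only: of_nat_le_iff)
    then have "real (card P) \<le> card M + u\<^sup>2 / c" by (simp add: Ru)
    then have "(card P + u * j) * j \<le> (card M + u\<^sup>2 / c + u * j) * j" using j2 by (intro mult_right_mono) auto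
    also have "\<dots> = card M * j + u\<^sup>2 * j / c + u * j\<^sup>2" by (simp add: algebra_simps power2_eq_square)
    finally have 2: "u\<^sup>2 / 8 \<le> card M * j + u\<^sup>2 * j / c + u * j\<^sup>2" using 1 by linarith
    have "u\<^sup>2 * (32 * j) \<le> u\<^sup>2 * c" using c1 j2 by (intro mult_left_mono) auto
    then have 3: "u\<^sup>2 * j / c \<le> u\<^sup>2 / 32" using c0 by (simp add: field_simps)
    have "u * (32 * j\<^sup>2) \<le> u * u" using c2 cu u1 zero_le_power2[of j] by (intro mult_left_mono) linarith+
    then have 4: "u * j\<^sup>2 \<le> u\<^sup>2 / 32" by (simp add: power2_eq_square)
    have "u\<^sup>2 / 16 \<le> card M * j" using 2 3 4 by linarith
    then show ?thesis using j2 by (simp add: field_simps)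
  qed
  have cardM0: "real (card M) > 0"
  proof -
    have "u\<^sup>2 / (16 * j) > 0" using u1 j2 by (intro divide_pos_pos) auto
    then show ?thesis using card_M by linarith
  qed

  define L where "L = (\<lambda>l. mangoldt l * of_bool (U < l) :: real)"
  define T1 where "T1 = (\<lambda>m. \<Sum>d\<in>{1..x}. \<Sum>e\<in>{1..x}. of_bool (d * e \<le> x) * (mu d * of_bool (d \<le> U) * (\<Sum>l | l dvd e. L l) * wt m (d * e)))"
  define T2 where "T2 = (\<lambda>m. \<Sum>k\<in>{U<..x}. \<Sum>l\<in>{1..x}. of_bool (k * l \<le> x) * (theta U k * L l * wt m (k * l)))"
  define S where "S = (\<lambda>m. \<Sum>n\<in>{1..x}. L n * of_bool (n mod m = 1))"
  define P where "P = (\<lambda>m. \<Sum>n\<in>{1..x}. L n * of_bool (\<not> m dvd n))"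
  have SP: "S m - P m / (real m - 1) = T1 m - T2 m" for m
  proof -
    have "(\<Sum>n\<in>{1..x}. L n * wt m n) = S m - P m / (real m - 1)"
      unfolding S_def P_def sum_divide_distrib sum_subtractf[symmetric]
      by (intro sum.cong refl) (simp add: wt_def right_diff_distrib)
    moreover have "(\<Sum>n\<in>{1..x}. L n * wt m n) = T1 m - T2 m"
      unfolding L_def T1_def T2_def using U1 x1 by (rule vaughan)
    ultimately show ?thesis by simp
  qed
  \<comment> \<open>Both cutoffs in Vaughan's identity are \<open>U\<close>, so type I costs about
    \<open>U^2 = Q\<close>, against a main term of order \<open>x / Q = Q * q^4\<close>.\<close>
  have T1: "\<bar>T1 m\<bar> \<le> 6 * u\<^sup>2 * j" if "m \<in> M" for m
  proof -
    have "\<bar>T1 m\<bar> \<le> U * ((4 + 2 * U) * ln (real x))"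
      unfolding T1_def L_def using M(2)[OF that] x1 by (intro type_I_bound) auto
    also have "\<dots> \<le> u * ((6 * u) * j)"
      unfolding u_def using U1 lnx x1 by (intro mult_left_mono mult_mono) (auto simp: j_def)
    finally show ?thesis by (simp add: power2_eq_square mult_ac)
  qed
  have T2: "(\<Sum>m\<in>M. \<bar>T2 m\<bar>) \<le> 24 * j ^ 6 * u ^ 4 * c ^ 3"
  proof -
    define Y where "Y = real x + real (Q\<^sup>2) * x / U + 2 * real (Q\<^sup>2) * x / U + real (Q\<^sup>2) * real (Q\<^sup>2)"
    have "(\<Sum>m\<in>M. \<bar>T2 m\<bar>) \<le> 8 * real J ^ 6 * sqrt (x * Y) / real Rn"
      unfolding T2_def L_def Y_def by (rule type_II_bound[OF M Rpos J1 J2 lnx x1 U1 U1])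
    also have "\<dots> \<le> 8 * j ^ 6 * (3 * u ^ 6 * c\<^sup>2) / (u\<^sup>2 / c)"
      unfolding Ru j_def[symmetric]
    proof (intro divide_right_mono mult_left_mono)
      \<comment> \<open>By \<open>uc\<close> all terms are at most multiples of
        \<open>u ^ 8\<close>, and 5 is then rounded up to the square 9.\<close>
      have "Y = u ^ 4 * c ^ 4 + 3 * u ^ 7 * c ^ 4 + u ^ 8"
        unfolding Y_def of_nat_power Qu xu u_def[symmetric] using u1
        by (simp add: power_numeral_reduce)
      also have "\<dots> \<le> 5 * u ^ 8"
      proof -
        have "u ^ 4 * c ^ 4 \<le> u ^ 4 * u" using uc by (intro mult_left_mono) auto
        also have "\<dots> = u ^ 5" by (simp add: power_numeral_reduce)
        also have "\<dots> \<le> u ^ 8" using u1 by (intro power_increasing) auto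
        finally have a: "u ^ 4 * c ^ 4 \<le> u ^ 8" .
        have "u ^ 7 * c ^ 4 \<le> u ^ 7 * u" using uc u1 by (intro mult_left_mono) auto
        also have "\<dots> = u ^ 8" by (simp add: power_numeral_reduce)
        finally show ?thesis using a by linarith
      qed
      finally have "x * Y \<le> (u ^ 4 * c ^ 4) * (5 * u ^ 8)"
        unfolding xu by (intro mult_left_mono) auto
      also have "\<dots> \<le> (3 * u ^ 6 * c\<^sup>2)\<^sup>2"
      proof -
        have "(3 * u ^ 6 * c\<^sup>2)\<^sup>2 = 9 * (u ^ 12 * c ^ 4)" by (simp add: power_mult_distrib flip: power_mult)
        moreover have "(u ^ 4 * c ^ 4) * (5 * u ^ 8) = 5 * (u ^ 12 * c ^ 4)" by (simp add: power_numeral_reduce)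
        moreover have "u ^ 12 * c ^ 4 \<ge> 0" by simp
        ultimately show ?thesis by linarith
      qed
      finally show "sqrt (x * Y) \<le> 3 * u ^ 6 * c\<^sup>2"
        using u1 c0 by (intro real_le_lsqrt) auto
    qed (use j2 c0 in auto)
    also have "\<dots> = 24 * j ^ 6 * u ^ 4 * c ^ 3"
      using u1 c0 by (simp add: power_numeral_reduce)
    finally show ?thesis .
  qed
  \<comment> \<open>The full sum is at least \<open>x / 8\<close>; the discarded terms cost
    \<open>x / 32\<close> twice, and \<open>m - 1\<close> is at most \<open>u^2\<close>.\<close>
  have P: "P m / (real m - 1) \<ge> u\<^sup>2 * c ^ 4 / 16" if "m \<in> M" for m
  proof -
    have m: "prime m" "real Rn \<le> real m" "m \<le> Q" using M(2)[OF that] by auto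
    then have m2: "m \<ge> 2" using prime_ge_2_nat by blast
    have "real x / 8 \<le> (\<Sum>n\<in>{1..x}. mangoldt n)"
    proof -
      have "even x" unfolding x_def by (rule evenq) simp
      then show ?thesis using psi[of x] x1 by simp
    qed
    moreover have "P m \<ge> (\<Sum>n\<in>{1..x}. mangoldt n) - j * u - j * (real x / real m)"
      unfolding P_def L_def j_def u_def using m2 lnx by (intro sum_mangoldt_coprime_ge) auto
    moreover have "j * u \<le> real x / 32"
    proof -
      have "32 * j * u \<le> c * u" using c1 j2 u1 by (intro mult_right_mono) auto
      also have "\<dots> \<le> c ^ 4 * u ^ 4"
        using power_increasing[of 1 4 c] power_increasing[of 1 4 u] c0 u1 by (intro mult_mono) auto
      finally show ?thesis by (simp add: xu mult_ac)
    qed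
    moreover have "j * (real x / real m) \<le> real x / 32"
    proof -
      have "real x / real m \<le> real x / (u\<^sup>2 / c)"
        using m(2) Rpos m2 unfolding Ru by (intro divide_left_mono mult_pos_pos) auto
      also have "\<dots> = u\<^sup>2 * c ^ 5" using u1 c0 by (simp add: xu power_numeral_reduce)
      finally have "j * (real x / real m) \<le> j * (u\<^sup>2 * c ^ 5)" using j2 by (intro mult_left_mono) auto
      also have "\<dots> = (j * c) * (u\<^sup>2 * c ^ 4)" by (simp add: power_numeral_reduce)
      also have "\<dots> \<le> (u\<^sup>2 / 32) * (u\<^sup>2 * c ^ 4)"
      proof (intro mult_right_mono)
        have "32 * j \<le> u" using c1 cu j2 by linarith
        then have "(32 * j) * c \<le> u * u" using cu c0 j2 u1 by (intro mult_mono) auto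
        then show "j * c \<le> u\<^sup>2 / 32" by (simp add: power2_eq_square)
      qed (use c0 in auto)
      also have "\<dots> = real x / 32" by (simp add: xu power_numeral_reduce)
      finally show ?thesis .
    qed
    ultimately have Pm: "P m \<ge> real x / 16" by linarith
    have "u\<^sup>2 * c ^ 4 / 16 = (real x / 16) / u\<^sup>2" using u1 by (simp add: xu power_numeral_reduce)
    also have "\<dots> \<le> P m / (real m - 1)"
    proof (intro frac_le)
      have "real m \<le> real Q" using m by simp
      then show "real m - 1 \<le> u\<^sup>2" using Qu by linarith
    qed (use Pm m2 in auto)
    finally show ?thesis .
  qed
  have "(\<Sum>m\<in>M. u\<^sup>2 * c ^ 4 / 32) \<le> (\<Sum>m\<in>M. S m)"
  proof -
    have "(\<Sum>m\<in>M. u\<^sup>2 * c ^ 4 / 16 - 6 * u\<^sup>2 * j) - (\<Sum>m\<in>M. \<bar>T2 m\<bar>) \<le> (\<Sum>m\<in>M. S m)"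
      unfolding sum_subtractf[symmetric]
    proof (rule sum_mono)
      fix m assume m: "m \<in> M"
      show "u\<^sup>2 * c ^ 4 / 16 - 6 * u\<^sup>2 * j - \<bar>T2 m\<bar> \<le> S m"
        using SP[of m] T1[OF m] P[OF m] by linarith
    qed
    moreover have "(\<Sum>m\<in>M. \<bar>T2 m\<bar>) \<le> card M * (384 * j ^ 7 * u\<^sup>2 * c ^ 3)"
    proof -
      \<comment> \<open>Dividing by the lower bound for \<open>card M\<close> turns the total error
        into an error per modulus, one factor \<open>c\<close> below the main term up to powers of
        \<open>j\<close>.\<close>
      have "24 * j ^ 6 * u ^ 4 * c ^ 3 = (u\<^sup>2 / (16 * j)) * (384 * j ^ 7 * u\<^sup>2 * c ^ 3)"
        using j2 by (simp add: power_numeral_reduce)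
      also have "\<dots> \<le> card M * (384 * j ^ 7 * u\<^sup>2 * c ^ 3)"
        using card_M j2 c0 by (intro mult_right_mono) auto
      finally show ?thesis using T2 by linarith
    qed
    moreover have "u\<^sup>2 * c ^ 4 / 32 \<le> u\<^sup>2 * c ^ 4 / 16 - 6 * u\<^sup>2 * j - 384 * j ^ 7 * u\<^sup>2 * c ^ 3"
    proof -
      have "j ^ 1 * 1 \<le> j ^ 7 * c ^ 3" using j2 c0 by (intro mult_mono power_increasing one_le_power) auto
      then have "j \<le> j ^ 7 * c ^ 3" by (simp only: power_one_right mult_1_right)
      then have "6 * j + 384 * (j ^ 7 * c ^ 3) \<le> 390 * (j ^ 7 * c ^ 3)" by linarith
      \<comment> \<open>This is the factor of \<open>q\<close> that was saved: it must exceed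
        \<open>390 * 32 * j ^ 7\<close>, which \<open>cbig\<close> grants.\<close>
      also have "\<dots> \<le> (c / 32) * c ^ 3"
        using cbig[of 7] c0 j2 zero_le_power[of j 7] unfolding mult.assoc[symmetric] by (intro mult_right_mono) auto
      also have "\<dots> = c ^ 4 / 32" by (simp add: power_numeral_reduce)
      finally have "u\<^sup>2 * (6 * j + 384 * (j ^ 7 * c ^ 3)) \<le> u\<^sup>2 * (c ^ 4 / 32)" by (intro mult_left_mono) auto
      then show ?thesis by (simp add: algebra_simps)
    qed
    then have "card M * (u\<^sup>2 * c ^ 4 / 32) \<le> card M * (u\<^sup>2 * c ^ 4 / 16 - 6 * u\<^sup>2 * j - 384 * j ^ 7 * u\<^sup>2 * c ^ 3)"
      by (intro mult_left_mono) auto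
    ultimately show ?thesis by (simp add: right_diff_distrib)
  qed
  then obtain m where m: "m \<in> M" "u\<^sup>2 * c ^ 4 / 32 \<le> S m"
  proof -
    assume *: "(\<Sum>m\<in>M. u\<^sup>2 * c ^ 4 / 32) \<le> (\<Sum>m\<in>M. S m)"
    have "\<exists>m\<in>M. u\<^sup>2 * c ^ 4 / 32 \<le> S m"
    proof (rule ccontr)
      assume "\<not> ?thesis"
      then have "(\<Sum>m\<in>M. S m) < (\<Sum>m\<in>M. u\<^sup>2 * c ^ 4 / 32)"
        using cardM0 M(1) by (intro sum_strict_mono) (auto simp: not_le)
      then show False using * by simp
    qed
    then show thesis using that by blast
  qed
  define A where "A = {n\<in>{1..x}. n mod m = 1}"
  define w where "w = Q * q\<^sup>2"
  have xw: "x = w\<^sup>2" by (simp add: xeq w_def)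
  have wu: "real w = u\<^sup>2 * c\<^sup>2" by (simp add: w_def Qeq u_def c_def)
  have "S m \<le> (\<Sum>n\<in>A. mangoldt n)"
  proof -
    have "S m \<le> (\<Sum>n\<in>{1..x}. if n mod m = 1 then mangoldt n else 0)"
      unfolding S_def L_def by (intro sum_mono) (auto simp: mangoldt_nonneg)
    also have "\<dots> = (\<Sum>n\<in>A. mangoldt n)"
      unfolding A_def by (rule sum.inter_filter[symmetric]) simp
    finally show ?thesis .
  qed
  also have "\<dots> \<le> (real (card {p\<in>A. prime p}) + real w * J) * ln (real (w\<^sup>2))"
  proof (rule sum_mangoldt_le_card_primes)
    show "A \<subseteq> {1..w\<^sup>2}" unfolding xw[symmetric] A_def by auto
    show "w\<^sup>2 < 2 ^ J" unfolding xw[symmetric] x2J[symmetric] using x1 by linarith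
    show "w \<ge> 1" using q2 by (simp add: w_def Q_def)
  qed
  also have "\<dots> \<le> (real (card {p\<in>A. prime p}) + u\<^sup>2 * c\<^sup>2 * j) * j"
    unfolding wu j_def[symmetric] using lnx u1 c0 j2
    by (intro mult_left_mono) (auto simp: xw[symmetric] j_def)
  finally have "u\<^sup>2 * c ^ 4 / 32 \<le> (real (card {p\<in>A. prime p}) + u\<^sup>2 * c\<^sup>2 * j) * j"
    using m(2) by linarith
  \<comment> \<open>With only \<open>u^2 = Q\<close> primes, even after adding all proper prime
    powers, at most \<open>w * j\<close> with \<open>w\<close> the root of \<open>x\<close>, the sum
    could not exceed the lower bound found for \<open>S m\<close>.\<close>
  moreover have "(u\<^sup>2 + u\<^sup>2 * c\<^sup>2 * j) * j \<le> u\<^sup>2 * c ^ 4 / 32"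
  proof -
    have "1 \<le> c\<^sup>2 * j" using c0 j2 one_le_power[of c 2] mult_mono[of 1 "c\<^sup>2" 1 j] by simp
    then have "1 + c\<^sup>2 * j \<le> 2 * (c\<^sup>2 * j)" by linarith
    then have "(1 + c\<^sup>2 * j) * j \<le> (2 * (c\<^sup>2 * j)) * j" using j2 by (intro mult_right_mono) auto
    also have "\<dots> = c\<^sup>2 * (2 * j\<^sup>2)" by (simp add: power2_eq_square)
    also have "\<dots> \<le> c\<^sup>2 * (c\<^sup>2 / 32)"
    proof (intro mult_left_mono)
      have "64 * j\<^sup>2 \<le> c" using c2 zero_le_power2[of j] by linarith
      also have "c \<le> c\<^sup>2" using c0 by (simp add: power2_eq_square)
      finally show "2 * j\<^sup>2 \<le> c\<^sup>2 / 32" by simp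
    qed auto
    also have "\<dots> = c ^ 4 / 32" by (simp add: power_numeral_reduce)
    finally have "u\<^sup>2 * ((1 + c\<^sup>2 * j) * j) \<le> u\<^sup>2 * (c ^ 4 / 32)" by (intro mult_left_mono) auto
    then show ?thesis by (simp add: algebra_simps)
  qed
  ultimately have "(u\<^sup>2 + u\<^sup>2 * c\<^sup>2 * j) * j \<le> (real (card {p\<in>A. prime p}) + u\<^sup>2 * c\<^sup>2 * j) * j" by linarith
  then have "u\<^sup>2 \<le> real (card {p\<in>A. prime p})" using j2 by simp
  then have "real Q \<le> real (card {p\<in>A. prime p})" by (simp add: Qu)
  then have "Q \<le> card {p\<in>A. prime p}" by (simp only: of_nat_le_iff)
  also have "{p\<in>A. prime p} = {p. prime p \<and> p \<le> x \<and> p mod m = 1}"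
    unfolding A_def by (auto dest: prime_gt_0_nat simp: Suc_le_eq)
  finally have "Q \<le> card {p. prime p \<and> p \<le> x \<and> p mod m = 1}" .
  moreover have "Rn \<le> m" using m(1) by (simp add: M_def)
  ultimately show ?thesis unfolding Rn_def Q_def x_def by blast
qed

section \<open>The limits\<close>

lemma eventually_exists_modulus:
  assumes s: "s \<ge> 2"
  shows "eventually (\<lambda>r::nat. \<exists>m. (2 ^ r) ^ (4 * s - 1) \<le> m \<and>
    (2 ^ r) ^ (4 * s) \<le> card {p. prime p \<and> p \<le> (2 ^ r) ^ (8 * s + 4) \<and> p mod m = (1::nat)}) sequentially"
proof -
  define c where "c = real (8 * s + 4)"
  have "c > 0" by (simp add: c_def)
  then have "eventually (\<lambda>r::nat. 1000000 * (real r * c + 2) ^ 10 \<le> 2 ^ r) sequentially" by real_asymp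
  with eventually_ge_at_top[of 1] show ?thesis
  proof eventually_elim
    case (elim r)
    show ?case
    proof (rule exists_modulus_aux[OF s _ refl refl])
      show "1000000 * real (r * (8 * s + 4) + 2) ^ 10 \<le> real (2 ^ r)"
        using elim by (simp add: c_def add.commute)
    qed (use elim in auto)
  qed
qed

text \<open>With \<open>t = card P\<close> and \<open>L\<close> the logarithm of the product, all
  \<open>t^2\<close> gcds are multiples of \<open>m\<close>, while
  \<open>t <= L <= t * ln x\<close>. The left inequality serves \<open>ln L\<close> in the
  numerator, the right one \<open>L^2\<close> in the denominator.\<close>

lemma M2_ratio_ge:
  fixes P :: "nat set" and m x :: nat
  assumes P: "finite P" "\<And>p. p \<in> P \<Longrightarrow> prime p \<and> p \<le> x \<and> p mod m = 1"
    and m: "m \<ge> 2" and t: "card P \<ge> 2"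
  shows "ln m * ln (card P) / (ln x)\<^sup>2 \<le> ln (real (M2 (\<Prod>P))) / lam (\<Prod>P)" and "card P \<le> \<Prod>P"
proof -
  define n where "n = \<Prod>P"
  define L where "L = ln (real n)"
  define t where "t = real (card P)"
  have t2: "t \<ge> 2" using \<open>card P \<ge> 2\<close> by (simp add: t_def)
  \<comment> \<open>The residue 1 excludes \<open>p = m\<close> as well as \<open>p < m\<close>, so
    \<open>p\<close> exceeds \<open>m >= 2\<close>.\<close>
  have dvd: "m dvd p - 1" and p3: "p \<ge> 3" if "p \<in> P" for p
  proof -
    have p: "prime p" "p mod m = 1" using P(2)[OF that] by auto
    then have "p \<noteq> m" using m by auto
    moreover have "\<not> p < m" using p prime_gt_1_nat by fastforce
    ultimately show "p \<ge> 3" using m by linarith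
    show "m dvd p - 1" using p(2) by (metis dvd_minus_mod)
  qed
  have pos: "0 < p" "0 < p - 1" if "p \<in> P" for p using p3[OF that] by simp_all
  have n0: "n > 0" unfolding n_def by (intro prod_pos pos)
  have L_eq: "L = (\<Sum>p\<in>P. ln (real p))"
    unfolding L_def n_def of_nat_prod using P(1) by (intro ln_prod) (auto dest: pos)
  \<comment> \<open>Since \<open>p >= 3\<close> and 3 exceeds \<open>exp 1\<close>, each prime
    contributes at least 1 to \<open>L\<close>.\<close>
  have Lt: "t \<le> L"
  proof -
    have "(\<Sum>p\<in>P. 1) \<le> L" unfolding L_eq
    proof (rule sum_mono)
      fix p assume "p \<in> P"
      from p3[OF this] have "3 \<le> real p" by simp
      then have "exp 1 \<le> real p" using exp_le by linarith
      then have "ln (exp 1) \<le> ln (real p)" by (intro ln_mono) auto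
      then show "1 \<le> ln (real p)" by simp
    qed
    then show ?thesis by (simp add: t_def)
  qed
  have Lx: "L \<le> t * ln x"
  proof -
    have "L \<le> (\<Sum>p\<in>P. ln (real x))" unfolding L_eq
    proof (rule sum_mono)
      fix p assume "p \<in> P"
      from P(2)[OF this] pos[OF this] show "ln (real p) \<le> ln (real x)" by (intro ln_mono) auto
    qed
    then show ?thesis by (simp add: t_def)
  qed
  have "real (card P) \<le> real n"
  proof -
    have "t \<le> L" by (rule Lt)
    also have "L \<le> n - 1" unfolding L_def using n0 by (intro ln_le_minus_one[THEN order.trans]) auto
    finally show ?thesis unfolding t_def using n0 by linarith
  qed
  then show "card P \<le> \<Prod>P" by (simp only: n_def of_nat_le_iff)
  have lnM: "t\<^sup>2 * ln m \<le> ln (real (M2 n))"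
  proof -
    have "t\<^sup>2 * ln m = (\<Sum>p\<in>P. \<Sum>q\<in>P. ln (real m))" by (simp add: t_def power2_eq_square)
    also have "\<dots> \<le> (\<Sum>p\<in>P. \<Sum>q\<in>P. ln (real (gcd (p - 1) (q - 1))))"
    proof (intro sum_mono)
      fix p q assume pq: "p \<in> P" "q \<in> P"
      have "m dvd gcd (p - 1) (q - 1)" using dvd pq by simp
      moreover have "gcd (p - 1) (q - 1) > 0" using p3[OF pq(1)] by (simp add: gcd_pos_nat)
      ultimately have "m \<le> gcd (p - 1) (q - 1)" by (rule dvd_imp_le)
      then show "ln (real m) \<le> ln (real (gcd (p - 1) (q - 1)))" using m by (intro ln_mono) auto
    qed
    also have "\<dots> = ln (real (\<Prod>p\<in>P. \<Prod>q\<in>P. gcd (p - 1) (q - 1)))"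
      using P(1) pos(2) by (rule ln_prod_gcd[symmetric])
    also have "\<dots> \<le> ln (real (M2 n))"
    proof (rule ln_mono)
      have "(\<Prod>p\<in>P. \<Prod>q\<in>P. gcd (p - 1) (q - 1)) \<le> M2 n" using P by (intro M2_ge) (auto simp: n_def)
      then show "real (\<Prod>p\<in>P. \<Prod>q\<in>P. gcd (p - 1) (q - 1)) \<le> real (M2 n)" by (simp only: of_nat_le_iff)
      have "(\<Prod>p\<in>P. \<Prod>q\<in>P. gcd (p - 1) (q - 1)) > 0"
      proof (intro prod_pos)
        fix p q assume "p \<in> P"
        from pos(2)[OF this] show "0 < gcd (p - 1) (q - 1)" by (simp add: gcd_pos_nat)
      qed
      then show "0 < real (\<Prod>p\<in>P. \<Prod>q\<in>P. gcd (p - 1) (q - 1))" by (simp only: of_nat_0_less_iff)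
    qed
    finally show ?thesis .
  qed
  have L2: "L \<ge> 2" using Lt t2 by linarith
  have lnm: "ln (real m) > 0" "ln t > 0" using m t2 by auto
  have "ln m * ln (card P) / (ln x)\<^sup>2 = (t\<^sup>2 * ln m) * ln t / (t * ln x)\<^sup>2"
    using t2 by (simp add: t_def power_mult_distrib)
  also have "\<dots> \<le> ln (real (M2 n)) * ln L / L\<^sup>2"
  proof (rule frac_le)
    show lnML: "t\<^sup>2 * ln m * ln t \<le> ln (real (M2 n)) * ln L"
    proof (rule mult_mono[OF lnM])
      show "ln t \<le> ln L" using Lt t2 by (intro ln_mono) auto
      have "0 \<le> t\<^sup>2 * ln m" using lnm by simp
      then show "0 \<le> ln (real (M2 n))" using lnM by linarith
    qed (use lnm in auto)
    have "0 \<le> t\<^sup>2 * ln m * ln t" using lnm by simp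
    with lnML show "0 \<le> ln (real (M2 n)) * ln L" by (rule order.trans[rotated])
    show "0 < L\<^sup>2" using L2 by simp
    show "L\<^sup>2 \<le> (t * ln x)\<^sup>2" using Lx L2 by (intro power_mono) auto
  qed
  also have "\<dots> = ln (real (M2 n)) / lam n" by (simp add: lam_def L_def)
  finally show "ln m * ln (card P) / (ln x)\<^sup>2 \<le> ln (real (M2 (\<Prod>P))) / lam (\<Prod>P)" by (simp only: n_def)
qed

text \<open>\<open>s\<close> controls the distance of the ratio from 1/4, while \<open>r\<close> is
  free to push the product of the primes beyond \<open>N\<close>.\<close>

lemma frequently_ln_M2_ge:
  assumes s: "s \<ge> 2"
  shows "\<exists>n\<ge>N. real ((4 * s - 1) * (4 * s)) / real ((8 * s + 4)\<^sup>2) \<le> ln (real (M2 n)) / lam n"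
proof -
  have "eventually (\<lambda>r::nat. (\<exists>m. (2 ^ r) ^ (4 * s - 1) \<le> m \<and>
    (2 ^ r) ^ (4 * s) \<le> card {p. prime p \<and> p \<le> (2 ^ r) ^ (8 * s + 4) \<and> p mod m = (1::nat)}) \<and> r \<ge> N + 1) sequentially"
    using eventually_exists_modulus[OF s] eventually_ge_at_top[of "N + 1"] by (rule eventually_conj)
  from eventually_happens[OF this] obtain r m where r: "r \<ge> N + 1" and m: "(2 ^ r) ^ (4 * s - 1) \<le> m"
    and card: "(2 ^ r) ^ (4 * s) \<le> card {p. prime p \<and> p \<le> (2 ^ r) ^ (8 * s + 4) \<and> p mod m = (1::nat)}"
    by auto
  define q where "q = (2::nat) ^ r"
  have q2: "q \<ge> 2" using r unfolding q_def by (metis One_nat_def add_leE le_add2 one_le_numeral power_increasing power_one_right)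
  \<comment> \<open>Exactly \<open>q ^ (4 * s)\<close> of the available primes are taken, which
    makes \<open>ln (card P)\<close> an exact multiple of \<open>ln q\<close>.\<close>
  obtain P where P: "P \<subseteq> {p. prime p \<and> p \<le> q ^ (8 * s + 4) \<and> p mod m = 1}" "finite P" "card P = q ^ (4 * s)"
    using obtain_subset_with_card_n[OF card] unfolding q_def by blast
  have "q ^ 1 \<le> q ^ (4 * s - 1)" using q2 s by (intro power_increasing) auto
  then have m2: "m \<ge> 2" using m q2 unfolding q_def by simp
  have "q ^ 1 \<le> q ^ (4 * s)" using q2 s by (intro power_increasing) auto
  then have cardq: "card P \<ge> q" using P by simp
  have PP: "p \<in> P \<Longrightarrow> prime p \<and> p \<le> q ^ (8 * s + 4) \<and> p mod m = 1" for p using P(1) by blast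
  have "ln m * ln (card P) / (ln (q ^ (8 * s + 4)))\<^sup>2 \<le> ln (real (M2 (\<Prod>P))) / lam (\<Prod>P)"
    using M2_ratio_ge(1)[OF P(2) PP m2] cardq q2 by simp
  moreover have "real ((4 * s - 1) * (4 * s)) / real ((8 * s + 4)\<^sup>2) \<le> ln m * ln (card P) / (ln (q ^ (8 * s + 4)))\<^sup>2"
  proof -
    define l where "l = ln (real q)"
    have l: "l > 0" using q2 by (simp add: l_def)
    have "real (q ^ (4 * s - 1)) \<le> real m" using m unfolding q_def by (simp only: of_nat_le_iff)
    then have "ln (real (q ^ (4 * s - 1))) \<le> ln (real m)" using q2 by (intro ln_mono) auto
    then have "real (4 * s - 1) * l \<le> ln m" using q2 by (simp add: ln_realpow l_def)
    then have "real (4 * s - 1) * l * (real (4 * s) * l) \<le> ln m * (real (4 * s) * l)"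
      using l by (intro mult_right_mono) auto
    moreover have "ln (card P) = real (4 * s) * l" using q2 by (simp add: P(3) ln_realpow l_def)
    moreover have "ln (q ^ (8 * s + 4)) = real (8 * s + 4) * l" using q2 by (simp add: ln_realpow l_def)
    moreover have "real ((4 * s - 1) * (4 * s)) / real ((8 * s + 4)\<^sup>2) =
        (real (4 * s - 1) * l * (real (4 * s) * l)) / (real (8 * s + 4) * l)\<^sup>2"
      using l by (simp add: power_mult_distrib power2_eq_square)
    ultimately show ?thesis by (simp only:) (intro divide_right_mono, auto)
  qed
  moreover have "N \<le> \<Prod>P"
  proof -
    have "N \<le> r" using r by simp
    also have "r \<le> q" unfolding q_def by (simp add: less_imp_le)
    also have "q \<le> card P" by (rule cardq)
    also have "\<dots> \<le> \<Prod>P" using M2_ratio_ge(2)[OF P(2) PP m2] cardq q2 by simp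
    finally show ?thesis .
  qed
  ultimately show ?thesis by (intro exI[of _ "\<Prod>P"]) auto
qed

lemma limsup_M2_ge: "limsup (\<lambda>n. ereal (ln (real (M2 n)) / lam n)) \<ge> ereal (1/4)"
proof (rule ccontr)
  define f where "f = (\<lambda>n. ln (real (M2 n)) / lam n)"
  assume "\<not> ?thesis"
  then have "limsup (\<lambda>n. ereal (f n)) < ereal (1/4)" by (simp add: f_def not_le)
  then obtain y where y: "limsup (\<lambda>n. ereal (f n)) < ereal y" "ereal y < ereal (1/4)"
    using ereal_dense2 by blast
  have "((\<lambda>s::nat. (4 * real s - 1) * (4 * real s) / (8 * real s + 4)\<^sup>2) \<longlongrightarrow> 1/4) sequentially"
    by real_asymp
  then have "eventually (\<lambda>s::nat. (4 * real s - 1) * (4 * real s) / (8 * real s + 4)\<^sup>2 > y) sequentially"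
    using y(2) by (intro order_tendstoD) auto
  with eventually_ge_at_top[of 2]
  have "eventually (\<lambda>s::nat. s \<ge> 2 \<and> (4 * real s - 1) * (4 * real s) / (8 * real s + 4)\<^sup>2 > y) sequentially"
    by (rule eventually_conj)
  from eventually_happens[OF this] obtain s :: nat where
    s: "s \<ge> 2" "(4 * real s - 1) * (4 * real s) / (8 * real s + 4)\<^sup>2 > y" by auto
  have "eventually (\<lambda>n. ereal (f n) < ereal y) sequentially"
    using y(1) by (rule Limsup_lessD)
  then obtain N where N: "\<And>n. n \<ge> N \<Longrightarrow> f n < y" by (auto simp: eventually_sequentially)
  obtain n where n: "n \<ge> N" "real ((4 * s - 1) * (4 * s)) / real ((8 * s + 4)\<^sup>2) \<le> f n"
    using frequently_ln_M2_ge[OF s(1), of N] unfolding f_def by blast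
  have "real ((4 * s - 1) * (4 * s)) / real ((8 * s + 4)\<^sup>2) = (4 * real s - 1) * (4 * real s) / (8 * real s + 4)\<^sup>2"
    using s(1) by (simp add: of_nat_diff)
  then show False using n N[of n] s(2) by linarith
qed

lemma ln_M1_div_lam_tendsto: "(\<lambda>n. ln (real (M1 n)) / lam n) \<longlonglongrightarrow> 1/4"
proof (rule order_tendstoI)
  fix a :: real assume "a < 1/4"
  then obtain b where b: "a < b" "b < 1/4" using dense by blast
  then have "0 < 1/4 - b" by simp
  from eventually_ln_M1_ge[OF this] show "eventually (\<lambda>n. a < ln (real (M1 n)) / lam n) sequentially"
  proof eventually_elim
    case (elim n)
    then have "b \<le> ln (real (M1 n)) / lam n" by simp
    with b(1) show ?case by (rule less_le_trans)
  qed
next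
  fix a :: real assume "1/4 < a"
  then obtain b where b: "1/4 < b" "b < a" using dense by blast
  then have "0 < b - 1/4" by simp
  from eventually_ln_M1_le[OF this] show "eventually (\<lambda>n. ln (real (M1 n)) / lam n < a) sequentially"
  proof eventually_elim
    case (elim n)
    then have "ln (real (M1 n)) / lam n \<le> b" by simp
    then show ?case using b(2) by (rule le_less_trans)
  qed
qed

theorem theorem9p1:
  shows "liminf (\<lambda>n. ereal (ln (real (M1 n)) / lam n)) = ereal (1/4)
     \<and> limsup (\<lambda>n. ereal (ln (real (M2 n)) / lam n)) = ereal (1/4)"
proof
  \<comment> \<open>For \<open>M1\<close> the whole sequence converges, so the same limit gives its
    liminf and, through its limsup, the upper bound for \<open>M2\<close>.\<close>
  have lim: "(\<lambda>n. ereal (ln (real (M1 n)) / lam n)) \<longlonglongrightarrow> ereal (1/4)"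
    using ln_M1_div_lam_tendsto by (rule tendsto_ereal)
  show "liminf (\<lambda>n. ereal (ln (real (M1 n)) / lam n)) = ereal (1/4)"
    using lim by (intro lim_imp_Liminf) auto
  have "eventually (\<lambda>n. lam n > 0) sequentially" unfolding lam_def by real_asymp
  with eventually_ge_at_top[of "1::nat"]
  have "eventually (\<lambda>n. ereal (ln (real (M2 n)) / lam n) \<le> ereal (ln (real (M1 n)) / lam n)) sequentially"
  proof eventually_elim
    case (elim n)
    have "ln (real (M2 n)) \<le> ln (real (M1 n))"
      using M2_le_M1[of n] M2_pos[of n] elim by (intro ln_mono) auto
    then show ?case using elim by (auto intro: divide_right_mono)
  qed
  then have "limsup (\<lambda>n. ereal (ln (real (M2 n)) / lam n)) \<le> limsup (\<lambda>n. ereal (ln (real (M1 n)) / lam n))"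
    by (rule Limsup_mono)
  also have "\<dots> = ereal (1/4)" using lim by (intro lim_imp_Limsup) auto
  finally show "limsup (\<lambda>n. ereal (ln (real (M2 n)) / lam n)) = ereal (1/4)"
    using limsup_M2_ge by (intro antisym)
qed

end
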